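(* Let $\Phi$ be a PCA on $S^{\mathbb{Z}^d}$ with neighbourhood $\mathcal{N}=\{n_1,\dots,n_m\}$ and local rule $\varphi$, and let $p_{\mathsf c}(\mathcal{N})$ denote the critical value of the $(d+1)$-dimensional directed site percolation with neighbourhood $\mathcal{N}$. Put $$p_{?}(\Phi) = 1-\sum_{b\in S}\ \min_{a_1,\dots,a_m\in S}\varphi(a_1,\dots,a_m)(b).$$ If $p_{?}(\Phi)<p_{\mathsf c}(\mathcal{N})$, then $\Phi$ is uniformly ergodic, and the unique invariant measure of $\Phi$ is spatially mixing and admits a perfect sampling algorithm.
   Context: Let $S$ be a finite set, $d\ge 1$, and $\mathcal{X}=S^{\mathbb{Z}^d}$ with the product topology. For finite $K\subseteq\mathbb{Z}^d$ and $y_K\in S^K$, the cylinder $[y_K]$ is $\{x\in\mathcal{X}: x_k=y_k\ \forall k\in K\}$. For $k\in\mathbb{Z}^d$ the shift is $(\sigma^k x)_i=x_{k+i}$. A probabilistic cellular automaton (PCA) with neighbourhood $\mathcal{N}=\{n_1,\dots,n_m\}\subseteq\mathbb{Z}^d$ and local rule $\varphi:S^m\times S\to[0,1]$ (a stochastic matrix: $\sum_b\varphi(a_1,\dots,a_m)(b)=1$) is the Markov kernel $\Phi$ on $\mathcal{X}$ with $\Phi(x,[y_K])=\prod_{k\in K}\varphi(x_{k+n_1},\dots,x_{k+n_m})(y_k)$ for every cylinder $[y_K]$. $\Phi^t$ is the $t$-step kernel. A Borel probability measure $\pi$ on $\mathcal{X}$ is invariant if $\pi\Phi=\pi$. $\Phi$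 is uniformly ergodic if it has a unique invariant measure $\pi$ and $\Phi^t(x,[u])\to\pi([u])$ as $t\to\infty$, uniformly in $x\in\mathcal{X}$, for each cylinder $[u]$. A measure $\pi$ is spatially mixing if $\lim_{k\to\infty}\pi([u]\cap\sigma^{-k}[v])=\pi([u])\pi([v])$ for all cylinders $[u],[v]$. A perfect sampling algorithm for a probability measure $\mu$ on $\mathcal{X}$ is an algorithm that, given a finite set $A\subseteq\mathbb{Z}^d$ and using an unbounded source of independent uniform samples from $[0,1]$ (and with access to a symbolic presentation of the real transition probabilities of the PCA), outputs a random pattern $W_A\in S^A$ with $\mathbb{P}(W_A=w)=\mu([w])$ for all $w\in S^A$. Directed site percolation: consider the directed graph with vertex set $\mathbb{Z}^d\times\mathbb{N}$ and an edge from $(k,t)$ to $(\ell,t+1)$ whenever $k\in\ell+\mathcal{N}$. Each vertex is declared open with probability $p$ and closed otherwise, independently. $p_{\mathsf c}(\mathcal{N})$ is the critical value: the supremum of the $p\in[0,1]$ for which there is almost surely no infinite open oriented path. *)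

theory Defs
  imports "HOL-Probability.Probability"
begin

text \<open>
  The alphabet is a finite type \<open>'s\<close>, the lattice is \<^typ>\<open>int ^ 'd\<close> with \<open>'d\<close> a finite type
  (so the dimension is \<open>CARD('d) \<ge> 1\<close>), and the neighbourhood is a family
  \<open>nb :: 'm \<Rightarrow> int ^ 'd\<close> over a finite type \<open>'m\<close>. A pattern on a finite set \<open>K\<close> is represented by a
  configuration whose values outside \<open>K\<close> are irrelevant.
\<close>

section \<open>Configurations, cylinders and measures\<close>

type_synonym ('d, 's) config = "(int ^ 'd) \<Rightarrow> 's"

text \<open>Since the lattice is countable and the alphabet finite, the product sigma-algebra is the
  Borel sigma-algebra of the product topology.\<close>

definition config_space :: "('d::finite, 's::finite) config measure" where
  "config_space = (\<Pi>\<^sub>M k\<in>UNIV. count_space UNIV)"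

definition cyl :: "(int ^ 'd::finite) set \<Rightarrow> ('d, 's) config \<Rightarrow> ('d, 's) config set" where
  "cyl K y = {x. \<forall>k\<in>K. x k = y k}"

definition shift :: "int ^ 'd::finite \<Rightarrow> ('d, 's) config \<Rightarrow> ('d, 's) config" where
  "shift k x = (\<lambda>i. x (k + i))"

text \<open>The limit \<open>k \<rightarrow> \<infinity>\<close> in the lattice is along the complements of finite sets.\<close>

definition spatially_mixing :: "('d::finite, 's::finite) config measure \<Rightarrow> bool" where
  "spatially_mixing \<pi> \<longleftrightarrow>
    (\<forall>K L u v. finite K \<longrightarrow> finite L \<longrightarrow>
      ((\<lambda>k. measure \<pi> (cyl K u \<inter> shift k -` cyl L v))
         \<longlongrightarrow> measure \<pi> (cyl K u) * measure \<pi> (cyl L v)) cofinite)"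


section \<open>Probabilistic cellular automata\<close>

text \<open>The update is independent over the sites, so the kernel is a product measure; the lemma
  \<open>measure_pca_cyl\<close> below gives its values on cylinders.\<close>

definition pca ::
  "('m::finite \<Rightarrow> int ^ 'd::finite) \<Rightarrow> (('m \<Rightarrow> 's::finite) \<Rightarrow> 's pmf)
    \<Rightarrow> ('d, 's) config \<Rightarrow> ('d, 's) config measure" where
  "pca nb \<phi> x = (\<Pi>\<^sub>M k\<in>UNIV. measure_pmf (\<phi> (\<lambda>i. x (k + nb i))))"

lemma cyl_eq_prod_emb:
  "cyl K y = prod_emb UNIV (\<lambda>k. measure_pmf (p k)) K (Pi\<^sub>E K (\<lambda>k. {y k}))"
  by (auto simp: cyl_def prod_emb_def PiE_iff restrict_def extensional_def)

lemma measure_pca_cyl: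
  assumes "finite K"
  shows "measure (pca nb \<phi> x) (cyl K y) = (\<Prod>k\<in>K. pmf (\<phi> (\<lambda>i. x (k + nb i))) (y k))"
proof -
  let ?p = "\<lambda>k. \<phi> (\<lambda>i. x (k + nb i))"
  interpret product_prob_space "\<lambda>k. measure_pmf (?p k)" UNIV
    by standard
  show ?thesis
    unfolding pca_def cyl_eq_prod_emb[where p = ?p]
    using assms by (subst measure_PiM_emb) (auto simp: measure_pmf_single)
qed

lemma sets_pca: "sets (pca nb \<phi> x) = sets config_space"
  unfolding pca_def config_space_def by (intro sets_PiM_cong) auto

lemma prob_space_pca: "prob_space (pca nb \<phi> x)"
  unfolding pca_def by (intro prob_space_PiM measure_pmf.prob_space_axioms)

lemma measurable_pca: "pca nb \<phi> \<in> config_space \<rightarrow>\<^sub>M prob_algebra config_space"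
proof (rule measurable_prob_algebra_generated[where G = "prod_algebra UNIV (\<lambda>_. count_space UNIV)"
      and \<Omega> = "\<Pi>\<^sub>E k\<in>UNIV. space (count_space UNIV)"])
  show "sets config_space = sigma_sets (\<Pi>\<^sub>E k\<in>UNIV. space (count_space UNIV))
      (prod_algebra UNIV (\<lambda>_. count_space UNIV))"
    unfolding config_space_def by (rule sets_PiM)
next
  fix A :: "('a, 'b) config set"
  assume "A \<in> prod_algebra UNIV (\<lambda>_. count_space UNIV)"
  then obtain K E where A: "A = prod_emb UNIV (\<lambda>_. count_space UNIV) K (Pi\<^sub>E K E)" "finite K"
    by (auto elim!: prod_algebraE)
  have eq: "emeasure (pca nb \<phi> x) A = (\<Prod>k\<in>K. emeasure (measure_pmf (\<phi> (\<lambda>i. x (k + nb i)))) (E k))"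
    for x
  proof -
    let ?p = "\<lambda>k. \<phi> (\<lambda>i. x (k + nb i))"
    interpret product_prob_space "\<lambda>k. measure_pmf (?p k)" UNIV
      by standard
    have "A = prod_emb UNIV (\<lambda>k. measure_pmf (?p k)) K (Pi\<^sub>E K E)"
      by (simp add: A prod_emb_def)
    then show ?thesis
      unfolding pca_def using A(2) by (simp add: emeasure_PiM_emb)
  qed
  have loc: "(\<lambda>x i. x (k + nb i)) \<in> config_space \<rightarrow>\<^sub>M count_space (UNIV :: ('c \<Rightarrow> 'b) set)" for k
  proof (subst measurable_count_space_eq2, simp, intro conjI ballI)
    show "(\<lambda>x i. x (k + nb i)) \<in> space config_space \<rightarrow> UNIV" by simp
    fix a :: "'c \<Rightarrow> 'b"
    have "(\<lambda>x i. x (k + nb i)) -` {a} \<inter> space config_space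
        = {x \<in> space config_space. \<forall>i. x (k + nb i) = a i}"
      by auto
    also have "\<dots> \<in> sets config_space"
      unfolding config_space_def by measurable
    finally show "(\<lambda>x i. x (k + nb i)) -` {a} \<inter> space config_space \<in> sets config_space" .
  qed
  show "(\<lambda>x. emeasure (pca nb \<phi> x) A) \<in> borel_measurable config_space"
    unfolding eq
    by (intro borel_measurable_prod_ennreal
        measurable_compose[OF loc, of "\<lambda>a. emeasure (measure_pmf (\<phi> a)) (E _)"]) simp
qed (auto simp: sets_pca prob_space_pca Int_stable_prod_algebra dest: subsetD[OF prod_algebra_sets_into_space])

primrec kernel_pow ::
  "(('d::finite, 's::finite) config \<Rightarrow> ('d, 's) config measure) \<Rightarrow> nat
    \<Rightarrow> ('d, 's) config \<Rightarrow> ('d, 's) config measure" where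
  "kernel_pow \<Phi> 0 x = return config_space x"
| "kernel_pow \<Phi> (Suc t) x = kernel_pow \<Phi> t x \<bind> \<Phi>"

definition invariant_measure ::
  "(('d::finite, 's::finite) config \<Rightarrow> ('d, 's) config measure)
    \<Rightarrow> ('d, 's) config measure \<Rightarrow> bool" where
  "invariant_measure \<Phi> \<pi> \<longleftrightarrow>
    prob_space \<pi> \<and> sets \<pi> = sets config_space \<and> \<pi> \<bind> \<Phi> = \<pi>"

definition uniformly_ergodic ::
  "(('d::finite, 's::finite) config \<Rightarrow> ('d, 's) config measure) \<Rightarrow> bool" where
  "uniformly_ergodic \<Phi> \<longleftrightarrow>
    (\<exists>\<pi>. invariant_measure \<Phi> \<pi> \<and> (\<forall>\<pi>'. invariant_measure \<Phi> \<pi>' \<longrightarrow> \<pi>' = \<pi>) \<and>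
      (\<forall>K u. finite K \<longrightarrow>
        uniform_limit UNIV (\<lambda>t x. measure (kernel_pow \<Phi> t x) (cyl K u))
          (\<lambda>_. measure \<pi> (cyl K u)) sequentially))"

definition p_unknown :: "(('m::finite \<Rightarrow> 's::finite) \<Rightarrow> 's pmf) \<Rightarrow> real" where
  "p_unknown \<phi> = 1 - (\<Sum>b\<in>UNIV. MIN a\<in>UNIV. pmf (\<phi> a) b)"


section \<open>Directed site percolation\<close>

definition perc_edge ::
  "('m::finite \<Rightarrow> int ^ 'd::finite) \<Rightarrow> (int ^ 'd) \<times> nat \<Rightarrow> (int ^ 'd) \<times> nat \<Rightarrow> bool" where
  "perc_edge nb v w \<longleftrightarrow> snd w = Suc (snd v) \<and> fst v \<in> (\<lambda>n. fst w + n) ` range nb"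

definition percolates ::
  "('m::finite \<Rightarrow> int ^ 'd::finite) \<Rightarrow> ((int ^ 'd) \<times> nat \<Rightarrow> bool) \<Rightarrow> bool" where
  "percolates nb \<omega> \<longleftrightarrow>
    (\<exists>\<gamma> :: nat \<Rightarrow> (int ^ 'd) \<times> nat. \<forall>j. \<omega> (\<gamma> j) \<and> perc_edge nb (\<gamma> j) (\<gamma> (Suc j)))"

definition perc_measure :: "real \<Rightarrow> ((int ^ 'd::finite) \<times> nat \<Rightarrow> bool) measure" where
  "perc_measure p = (\<Pi>\<^sub>M v\<in>UNIV. measure_pmf (bernoulli_pmf p))"

definition p_crit :: "('m::finite \<Rightarrow> int ^ 'd::finite) \<Rightarrow> real" where
  "p_crit nb = Sup {p \<in> {0..1}. AE \<omega> in perc_measure p. \<not> percolates nb \<omega>}"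


section \<open>Perfect sampling algorithms\<close>

text \<open>
  Algorithms are while programs for a randomised real RAM. There is one memory of integers and
  one of real numbers, both addressed by integers, with exact arithmetic and comparison in each.
  The only numeric constants in a program are integers and the names \<open>RProb a b\<close> of the
  transition probabilities \<open>\<phi>(a)(b)\<close>: this is the access to a symbolic presentation of these
  numbers. Arbitrary real constants must not be allowed, because a single one can encode an
  infinite amount of information. The command \<open>Sample e\<close> stores the next independent uniform
  sample in the real memory at address \<open>e\<close>.
\<close>

datatype iexp =
    IConst int
  | IMem iexp
  | IAdd iexp iexp
  | ISub iexp iexp
  | IMul iexp iexp
  | IDiv iexp iexp
  | IMod iexp iexp

datatype ('m, 's) rexp =
    RProb "'m \<Rightarrow> 's" 's
  | RInt iexp
  | RMem iexp
  | RAdd "('m, 's) rexp" "('m, 's) rexp"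
  | RSub "('m, 's) rexp" "('m, 's) rexp"
  | RMul "('m, 's) rexp" "('m, 's) rexp"
  | RDiv "('m, 's) rexp" "('m, 's) rexp"

datatype ('m, 's) bexp =
    ILess iexp iexp
  | RLess "('m, 's) rexp" "('m, 's) rexp"
  | BNot "('m, 's) bexp"
  | BAnd "('m, 's) bexp" "('m, 's) bexp"

datatype ('m, 's) com =
    Skip
  | IAssign iexp iexp
  | RAssign iexp "('m, 's) rexp"
  | Sample iexp
  | Seq "('m, 's) com" "('m, 's) com"
  | Cond "('m, 's) bexp" "('m, 's) com" "('m, 's) com"
  | While "('m, 's) bexp" "('m, 's) com"

record store =
  imem :: "int \<Rightarrow> int"
  rmem :: "int \<Rightarrow> real"
  drawn :: nat  \<comment> \<open>number of uniform samples used so far\<close>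

primrec ival :: "iexp \<Rightarrow> store \<Rightarrow> int" where
  "ival (IConst c) s = c"
| "ival (IMem e) s = imem s (ival e s)"
| "ival (IAdd e f) s = ival e s + ival f s"
| "ival (ISub e f) s = ival e s - ival f s"
| "ival (IMul e f) s = ival e s * ival f s"
| "ival (IDiv e f) s = ival e s div ival f s"
| "ival (IMod e f) s = ival e s mod ival f s"

primrec rval :: "(('m \<Rightarrow> 's) \<Rightarrow> 's pmf) \<Rightarrow> ('m, 's) rexp \<Rightarrow> store \<Rightarrow> real" where
  "rval \<phi> (RProb a b) s = pmf (\<phi> a) b"
| "rval \<phi> (RInt e) s = of_int (ival e s)"
| "rval \<phi> (RMem e) s = rmem s (ival e s)"
| "rval \<phi> (RAdd e f) s = rval \<phi> e s + rval \<phi> f s"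
| "rval \<phi> (RSub e f) s = rval \<phi> e s - rval \<phi> f s"
| "rval \<phi> (RMul e f) s = rval \<phi> e s * rval \<phi> f s"
| "rval \<phi> (RDiv e f) s = rval \<phi> e s / rval \<phi> f s"

primrec bval :: "(('m \<Rightarrow> 's) \<Rightarrow> 's pmf) \<Rightarrow> ('m, 's) bexp \<Rightarrow> store \<Rightarrow> bool" where
  "bval \<phi> (ILess e f) s \<longleftrightarrow> ival e s < ival f s"
| "bval \<phi> (RLess e f) s \<longleftrightarrow> rval \<phi> e s < rval \<phi> f s"
| "bval \<phi> (BNot b) s \<longleftrightarrow> \<not> bval \<phi> b s"
| "bval \<phi> (BAnd b c) s \<longleftrightarrow> bval \<phi> b s \<and> bval \<phi> c s"

text \<open>Big-step semantics: \<open>exec \<phi> U c s s'\<close> says that, with \<open>U\<close> as the source of samples,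
  the run of \<open>c\<close> from \<open>s\<close> halts in \<open>s'\<close>.\<close>

inductive exec ::
  "(('m \<Rightarrow> 's) \<Rightarrow> 's pmf) \<Rightarrow> (nat \<Rightarrow> real) \<Rightarrow> ('m, 's) com \<Rightarrow> store \<Rightarrow> store \<Rightarrow> bool"
  for \<phi> :: "('m \<Rightarrow> 's) \<Rightarrow> 's pmf" and U :: "nat \<Rightarrow> real" where
  exec_Skip: "exec \<phi> U Skip s s"
| exec_IAssign: "exec \<phi> U (IAssign e f) s (s\<lparr>imem := (imem s)(ival e s := ival f s)\<rparr>)"
| exec_RAssign: "exec \<phi> U (RAssign e r) s (s\<lparr>rmem := (rmem s)(ival e s := rval \<phi> r s)\<rparr>)"
| exec_Sample: "exec \<phi> U (Sample e) s
    (s\<lparr>rmem := (rmem s)(ival e s := U (drawn s)), drawn := Suc (drawn s)\<rparr>)"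
| exec_Seq: "exec \<phi> U c s s' \<Longrightarrow> exec \<phi> U c' s' s'' \<Longrightarrow> exec \<phi> U (Seq c c') s s''"
| exec_CondT: "bval \<phi> b s \<Longrightarrow> exec \<phi> U c s s' \<Longrightarrow> exec \<phi> U (Cond b c c') s s'"
| exec_CondF: "\<not> bval \<phi> b s \<Longrightarrow> exec \<phi> U c' s s' \<Longrightarrow> exec \<phi> U (Cond b c c') s s'"
| exec_WhileF: "\<not> bval \<phi> b s \<Longrightarrow> exec \<phi> U (While b c) s s"
| exec_WhileT: "bval \<phi> b s \<Longrightarrow> exec \<phi> U c s s' \<Longrightarrow> exec \<phi> U (While b c) s' s''
    \<Longrightarrow> exec \<phi> U (While b c) s s''"

text \<open>A finite set of sites is given to the program as a list \<open>ks\<close>, with \<open>cs\<close> an enumeration of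
  the coordinates: cell 0 contains the number of sites and the following cells contain the
  coordinates of the sites, one site after the other.\<close>

definition sites_input :: "'d list \<Rightarrow> (int ^ 'd::finite) list \<Rightarrow> int list" where
  "sites_input cs ks = int (length ks) # concat (map (\<lambda>k. map (\<lambda>j. k $ j) cs) ks)"

definition init_store :: "int list \<Rightarrow> store" where
  "init_store xs =
    \<lparr>imem = (\<lambda>a. if 0 \<le> a \<and> a < int (length xs) then xs ! nat a else 0),
     rmem = (\<lambda>_. 0), drawn = 0\<rparr>"

definition uniform_source :: "(nat \<Rightarrow> real) measure" where
  "uniform_source = (\<Pi>\<^sub>M n\<in>UNIV. uniform_measure lborel {0..1})"

text \<open>Symbols are coded by integers through an injective map \<open>enc\<close>; on halting, cell \<open>i\<close> contains
  the code of the symbol at the \<open>i\<close>-th site. The probabilities of the outputs in the definition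
  below add up to 1, so the program halts almost surely. The program depends on the PCA but not on
  the given set of sites.\<close>

definition outputs ::
  "(('m \<Rightarrow> 's) \<Rightarrow> 's pmf) \<Rightarrow> (nat \<Rightarrow> real) \<Rightarrow> ('m, 's) com \<Rightarrow> ('s \<Rightarrow> int) \<Rightarrow> 'd list
    \<Rightarrow> (int ^ 'd::finite) list \<Rightarrow> ('d, 's) config \<Rightarrow> bool" where
  "outputs \<phi> U c enc cs ks w \<longleftrightarrow>
    (\<exists>s. exec \<phi> U c (init_store (sites_input cs ks)) s \<and>
         (\<forall>i < length ks. imem s (int i) = enc (w (ks ! i))))"

definition admits_perfect_sampling ::
  "(('m::finite \<Rightarrow> 's::finite) \<Rightarrow> 's pmf) \<Rightarrow> ('d::finite, 's) config measure \<Rightarrow> bool" where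
  "admits_perfect_sampling \<phi> \<mu> \<longleftrightarrow>
    (\<forall>enc :: 's \<Rightarrow> int. \<forall>cs :: 'd list. inj enc \<longrightarrow> distinct cs \<longrightarrow> set cs = UNIV \<longrightarrow>
      (\<exists>c :: ('m, 's) com. \<forall>ks w. distinct ks \<longrightarrow>
        {U \<in> space uniform_source. outputs \<phi> U c enc cs ks w} \<in> sets uniform_source \<and>
        measure uniform_source {U \<in> space uniform_source. outputs \<phi> U c enc cs ks w}
          = measure \<mu> (cyl (set ks) w)))"

end

theory Submission
  imports Defs
begin

text \<open>
  Coupling from the past. The update at a site reads one uniform number \<open>u\<close>: the interval
  \<open>[0, 1 - p_unknown \<phi>)\<close> is divided among the symbols with lengths \<open>pmf_min \<phi> b\<close>, so that a number
  in it determines the new symbol without looking at the neighbours. A site whose symbol is not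
  determined by the numbers of finitely many past steps therefore starts an infinite path of sites
  with \<open>u \<ge> 1 - p_unknown \<phi>\<close>, and below the percolation threshold there is almost surely none.
  Hence the value at time 0 is almost surely a function of finitely many of the numbers. This value
  has the invariant law; the probability that \<open>t\<close> steps do not suffice bounds the distance to it
  uniformly in the initial configuration; values at remote sites use disjoint sets of numbers; and a
  program that reads more and more of the numbers until the values are determined samples the law.
\<close>

text \<open>The hypothesis concerns a supremum, so it provides some \<open>p\<close> with
  \<open>p_unknown \<phi> < p\<close> and almost surely no percolation, and monotonicity in the
  parameter does the rest. Working backward rather than forward is essential: a value at time 0,
  once determined, is not revised however much more of the past is inspected, so the moment at which
  the computation stops does not bias its law. The obstacle for the program is that a space-time
  vertex is reached along many paths and must read the same number each time. Instead of looking up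
  visited vertices, each vertex owns the sample whose number is an injective polynomial function of
  its coordinates; samples are drawn in their natural order, and a vertex waits until its own has
  been drawn. The output is then a pointwise function of the sequence of samples. The program has a
  single loop with a loop-free body, so that its semantics is the iteration of a function.\<close>

section \<open>Product measures\<close>

text \<open>Injectivity of \<open>g\<close> gives every \<open>j\<close> a coordinate of its own, so
  independence survives. The lemma serves to compare the numbers with Bernoulli variables, to obtain
  the kernel from one layer of numbers, to translate the field, and to read the field off a sequence
  of samples.\<close>

lemma distr_PiM_map_reindex:
  assumes M: "\<And>i. prob_space (M i)" and g: "inj g"
    and f[measurable]: "\<And>j. f j \<in> M (g j) \<rightarrow>\<^sub>M N j"
  shows "distr (PiM UNIV M) (PiM UNIV N) (\<lambda>\<omega> j. f j (\<omega> (g j)))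
    = PiM UNIV (\<lambda>j. distr (M (g j)) (N j) (f j))"
proof -
  interpret D: prob_space "distr (M (g j)) (N j) (f j)" for j
    using M by (intro prob_space.prob_space_distr f)
  interpret D: product_prob_space "\<lambda>j. distr (M (g j)) (N j) (f j)" UNIV
    by standard
  have meas: "(\<lambda>\<omega> j. f j (\<omega> (g j))) \<in> PiM UNIV M \<rightarrow>\<^sub>M PiM UNIV N"
    by (intro measurable_PiM_single') (auto simp: space_PiM intro!: measurable_compose[OF _ f]
        measurable_space[OF f])
  show ?thesis
  proof (rule D.PiM_eq)
    show "sets (distr (PiM UNIV M) (PiM UNIV N) (\<lambda>\<omega> j. f j (\<omega> (g j))))
        = sets (PiM UNIV (\<lambda>j. distr (M (g j)) (N j) (f j)))"
      by (simp, intro sets_PiM_cong) auto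
    fix J F
    assume J: "finite J" "J \<subseteq> UNIV"
      and F: "\<And>j. j \<in> J \<Longrightarrow> F j \<in> sets (distr (M (g j)) (N j) (f j))"
    define G where "G i = f (inv g i) -` F (inv g i) \<inter> space (M i)" for i
    have inv: "inv g (g j) = j" for j
      using g by simp
    have G: "G i \<in> sets (M i)" if "i \<in> g ` J" for i
      using that F unfolding G_def by (auto simp: inv intro!: measurable_sets[OF f])
    have emb: "prod_emb UNIV (\<lambda>j. distr (M (g j)) (N j) (f j)) J (Pi\<^sub>E J F) \<in> sets (PiM UNIV N)"
    proof -
      have "prod_emb UNIV (\<lambda>j. distr (M (g j)) (N j) (f j)) J (Pi\<^sub>E J F) = prod_emb UNIV N J (Pi\<^sub>E J F)"
        by (simp add: prod_emb_def)
      then show ?thesis using J F by (auto intro!: sets_PiM_I)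
    qed
    have "(\<lambda>\<omega> j. f j (\<omega> (g j))) -` prod_emb UNIV (\<lambda>j. distr (M (g j)) (N j) (f j)) J (Pi\<^sub>E J F)
        \<inter> space (PiM UNIV M) = prod_emb UNIV M (g ` J) (Pi\<^sub>E (g ` J) G)"
      using measurable_space[OF f]
      by (auto simp: prod_emb_def space_PiM PiE_iff G_def inv)
    then have "emeasure (distr (PiM UNIV M) (PiM UNIV N) (\<lambda>\<omega> j. f j (\<omega> (g j))))
        (prod_emb UNIV (\<lambda>j. distr (M (g j)) (N j) (f j)) J (Pi\<^sub>E J F))
        = emeasure (PiM UNIV M) (prod_emb UNIV M (g ` J) (Pi\<^sub>E (g ` J) G))"
      by (simp add: emeasure_distr[OF meas emb])
    also have "\<dots> = (\<Prod>i\<in>g ` J. emeasure (M i) (G i))"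
      using M J G by (intro emeasure_PiM_emb) auto
    also have "\<dots> = (\<Prod>j\<in>J. emeasure (M (g j)) (G (g j)))"
      using g by (subst prod.reindex) (auto intro: inj_on_subset)
    also have "\<dots> = (\<Prod>j\<in>J. emeasure (distr (M (g j)) (N j) (f j)) (F j))"
      using F by (intro prod.cong) (auto simp: emeasure_distr G_def inv)
    finally show "emeasure (distr (PiM UNIV M) (PiM UNIV N) (\<lambda>\<omega> j. f j (\<omega> (g j))))
        (prod_emb UNIV (\<lambda>j. distr (M (g j)) (N j) (f j)) J (Pi\<^sub>E J F))
        = (\<Prod>j\<in>J. emeasure (distr (M (g j)) (N j) (f j)) (F j))" .
  qed
qed

definition time_cons :: "('k \<Rightarrow> 'a) \<Rightarrow> ('k \<times> nat \<Rightarrow> 'a) \<Rightarrow> 'k \<times> nat \<Rightarrow> 'a" where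
  "time_cons a U = (\<lambda>(k, s). case s of 0 \<Rightarrow> a k | Suc s \<Rightarrow> U (k, s))"

lemma time_cons_simps [simp]:
  "time_cons a U (k, 0) = a k" "time_cons a U (k, Suc s) = U (k, s)"
  by (simp_all add: time_cons_def)

lemma measurable_time_cons:
  "(\<lambda>(a, U). time_cons a U) \<in>
    PiM UNIV (\<lambda>_::'k. L) \<Otimes>\<^sub>M PiM UNIV (\<lambda>_::'k \<times> nat. L) \<rightarrow>\<^sub>M PiM UNIV (\<lambda>_. L)"
proof (rule measurable_PiM_single')
  fix v :: "'k \<times> nat"
  show "(\<lambda>\<omega>. (case \<omega> of (a, U) \<Rightarrow> time_cons a U) v)
      \<in> PiM UNIV (\<lambda>_::'k. L) \<Otimes>\<^sub>M PiM UNIV (\<lambda>_::'k \<times> nat. L) \<rightarrow>\<^sub>M L"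
    by (cases v; cases "snd v") (auto simp: split_beta' intro!: measurable_compose[OF measurable_fst]
        measurable_compose[OF measurable_snd])
next
  show "(\<lambda>(a, U). time_cons a U) \<in> space (PiM UNIV (\<lambda>_::'k. L) \<Otimes>\<^sub>M PiM UNIV (\<lambda>_::'k \<times> nat. L))
      \<rightarrow> (\<Pi>\<^sub>E i\<in>UNIV. space L)"
    by (auto simp: space_pair_measure space_PiM PiE_iff time_cons_def split: nat.split)
qed

text \<open>A rectangle over space-time splits into its part at time 0 and its shifted remainder,
  and both sides give the product of the masses. Adding a fresh present thus reproduces the law of
  the field, which makes the backward recursion Markovian.\<close>

lemma distr_time_cons:
  assumes L: "prob_space L"
  shows "distr (PiM UNIV (\<lambda>_::'k. L) \<Otimes>\<^sub>M PiM UNIV (\<lambda>_::'k \<times> nat. L)) (PiM UNIV (\<lambda>_. L))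
      (\<lambda>(a, U). time_cons a U) = PiM UNIV (\<lambda>_::'k \<times> nat. L)"
    (is "distr (?P \<Otimes>\<^sub>M ?Q) _ _ = _")
proof -
  interpret L: prob_space L by fact
  interpret P: product_prob_space "\<lambda>_::'k. L" UNIV by standard
  interpret Q: product_prob_space "\<lambda>_::'k \<times> nat. L" UNIV by standard
  show ?thesis
  proof (rule Q.PiM_eq)
    fix J :: "('k \<times> nat) set" and F
    assume J: "finite J" and F: "\<And>j. j \<in> J \<Longrightarrow> F j \<in> sets L"
    define next_time where "next_time v = (fst v, Suc (snd v))" for v :: "'k \<times> nat"
    define J0 where "J0 = (\<lambda>k. (k, 0)) -` J"
    define J1 where "J1 = next_time -` J"
    have inj: "inj (\<lambda>k::'k. (k, 0::nat))" "inj next_time"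
      by (auto simp: inj_on_def next_time_def prod_eq_iff)
    have fin: "finite J0" "finite J1"
      unfolding J0_def J1_def by (intro finite_vimageI J inj)+
    have cases: "v = (fst v, 0) \<or> v = next_time (fst v, snd v - 1)" for v
      by (cases "snd v") (auto simp: next_time_def prod_eq_iff)
    have un: "J = (\<lambda>k. (k, 0)) ` J0 \<union> next_time ` J1"
    proof (intro set_eqI iffI)
      fix v assume "v \<in> J"
      then show "v \<in> (\<lambda>k. (k, 0)) ` J0 \<union> next_time ` J1"
        using cases[of v] unfolding J0_def J1_def by (metis UnI1 UnI2 imageI vimageI)
    qed (auto simp: J0_def J1_def)
    have disj: "(\<lambda>k. (k, 0)) ` J0 \<inter> next_time ` J1 = {}"
      by (auto simp: next_time_def)
    have all: "(\<forall>j\<in>J. Q j) \<longleftrightarrow> (\<forall>k\<in>J0. Q (k, 0)) \<and> (\<forall>v\<in>J1. Q (next_time v))" for Q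
      by (subst un) auto
    let ?A = "prod_emb UNIV (\<lambda>_. L) J0 (\<Pi>\<^sub>E k\<in>J0. F (k, 0))"
    let ?B = "prod_emb UNIV (\<lambda>_. L) J1 (\<Pi>\<^sub>E v\<in>J1. F (next_time v))"
    have A: "emeasure ?P ?A = (\<Prod>k\<in>J0. emeasure L (F (k, 0)))"
      using fin F by (intro P.emeasure_PiM_emb) (auto simp: J0_def)
    have B: "emeasure ?Q ?B = (\<Prod>v\<in>J1. emeasure L (F (next_time v)))"
      using fin F by (intro Q.emeasure_PiM_emb) (auto simp: J1_def)
    have AB: "?A \<in> sets ?P" "?B \<in> sets ?Q"
      using fin F by (auto intro!: sets_PiM_I simp: J0_def J1_def)
    have emb: "x \<in> prod_emb UNIV (\<lambda>_. L) I (Pi\<^sub>E I G) \<longleftrightarrow> (\<forall>i. x i \<in> space L) \<and> (\<forall>i\<in>I. x i \<in> G i)"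
      for x :: "'i \<Rightarrow> 'a" and I G
      by (auto simp: prod_emb_def PiE_iff)
    have tc: "time_cons a U (next_time v) = U v" for a U v
      by (simp add: next_time_def)
    have sp: "time_cons a U v \<in> space L" if "\<And>k. a k \<in> space L" "\<And>v. U v \<in> space L" for a U v
      using that unfolding time_cons_def by (cases v) (auto split: nat.split)
    have "(\<lambda>(a, U). time_cons a U) -` prod_emb UNIV (\<lambda>_. L) J (Pi\<^sub>E J F) \<inter> space (?P \<Otimes>\<^sub>M ?Q)
        = ?A \<times> ?B"
      by (auto simp: emb all tc space_pair_measure space_PiM PiE_iff intro!: sp)
    then have "emeasure (distr (?P \<Otimes>\<^sub>M ?Q) (PiM UNIV (\<lambda>_. L)) (\<lambda>(a, U). time_cons a U))
        (prod_emb UNIV (\<lambda>_. L) J (Pi\<^sub>E J F)) = emeasure (?P \<Otimes>\<^sub>M ?Q) (?A \<times> ?B)"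
      using J F by (subst emeasure_distr[OF measurable_time_cons]) (auto intro!: sets_PiM_I)
    also have "\<dots> = emeasure ?P ?A * emeasure ?Q ?B"
      using AB by (intro Q.P.emeasure_pair_measure_Times)
    also have "\<dots> = (\<Prod>j\<in>J. emeasure L (F j))"
      unfolding A B using inj fin
      by (subst un, subst prod.union_disjoint)
        (auto simp: prod.reindex[OF inj_on_subset[OF inj(1)]] prod.reindex[OF inj_on_subset[OF inj(2)]]
          disj)
    finally show "emeasure (distr (?P \<Otimes>\<^sub>M ?Q) (PiM UNIV (\<lambda>_. L)) (\<lambda>(a, U). time_cons a U))
        (prod_emb UNIV (\<lambda>_. L) J (Pi\<^sub>E J F)) = (\<Prod>j\<in>J. emeasure L (F j))" .
  qed simp
qed

section \<open>Sampling the local rule from one uniform number\<close>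

abbreviation unif :: "real measure" where
  "unif \<equiv> uniform_measure lborel {0..1}"

lemma prob_space_unif: "prob_space unif"
  by (intro prob_space_uniform_measure) auto

lemma sets_unif [simp, measurable_cong]: "sets unif = sets borel"
  by simp

lemma space_unif [simp]: "space unif = UNIV"
  by simp

lemma emeasure_unif: "A \<in> sets borel \<Longrightarrow> emeasure unif A = emeasure lborel ({0..1} \<inter> A)"
  by (simp add: ennreal_divide_eq_top_iff divide_ennreal_def)

text \<open>One choice serves the symbols, the neighbours and the neighbour patterns, so that the
  mathematical functions and the program text go through them in the same order.\<close>

definition enumeration :: "'a::finite list" where
  "enumeration = (SOME xs. distinct xs \<and> set xs = UNIV)"

lemma distinct_enumeration: "distinct (enumeration :: 'a::finite list)"
  and set_enumeration: "set (enumeration :: 'a::finite list) = UNIV"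
proof -
  have "\<exists>xs :: 'a list. distinct xs \<and> set xs = UNIV"
    using finite_distinct_list[of "UNIV :: 'a set"] by auto
  from someI_ex[OF this] show "distinct (enumeration :: 'a list)" "set (enumeration :: 'a list) = UNIV"
    unfolding enumeration_def by auto
qed

lemma enumeration_not_Nil: "enumeration \<noteq> ([] :: 'a::finite list)"
  using set_enumeration[where 'a='a] by force

lemma sum_list_enumeration: "(\<Sum>x\<leftarrow>enumeration. f x) = (\<Sum>x\<in>UNIV. f x :: real)"
  by (metis distinct_enumeration set_enumeration sum.distinct_set_conv_list)

text \<open>Inversion of a distribution function: half-open intervals of the given lengths are laid
  end to end from \<open>c\<close>. Only right ends are tested, so numbers below \<open>c\<close>
  fall to the first entry; hence the condition \<open>c \<le> u\<close> in
  \<open>emeasure_pick\<close>.\<close>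

primrec pick :: "(real \<times> 's) list \<Rightarrow> real \<Rightarrow> real \<Rightarrow> 's option" where
  "pick [] c u = None"
| "pick (x # xs) c u = (if u < c + fst x then Some (snd x) else pick xs (c + fst x) u)"

lemma pick_append:
  "pick (xs @ ys) c u = (case pick xs c u of None \<Rightarrow> pick ys (c + sum_list (map fst xs)) u | Some b \<Rightarrow> Some b)"
  by (induction xs arbitrary: c) (auto simp: add.assoc split: option.split)

lemma pick_None: "pick xs c u = None \<Longrightarrow> xs \<noteq> [] \<Longrightarrow> c + sum_list (map fst xs) \<le> u"
proof (induction xs arbitrary: c)
  case (Cons x xs)
  then show ?case
    using Cons.IH[of "c + fst x"] by (cases "xs = []") (auto simp: add.assoc split: if_splits)
qed simp

lemma pick_Some_less:
  "pick xs c u = Some b \<Longrightarrow> (\<And>x. x \<in> set xs \<Longrightarrow> 0 \<le> fst x) \<Longrightarrow> u < c + sum_list (map fst xs)"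
proof (induction xs arbitrary: c)
  case (Cons x xs)
  have "0 \<le> sum_list (map fst xs)"
    using Cons.prems(2) by (intro sum_list_nonneg) auto
  with Cons.prems Cons.IH[of "c + fst x"] show ?case by (auto split: if_splits)
qed simp

lemma measurable_pick [measurable]: "pick xs c \<in> borel \<rightarrow>\<^sub>M count_space UNIV"
proof (induction xs arbitrary: c)
  case (Cons x xs)
  have "pick (x # xs) c = (\<lambda>u. if u < c + fst x then Some (snd x) else pick xs (c + fst x) u)"
    by (simp add: fun_eq_iff)
  with Cons show ?case by simp
next
  case Nil
  have "pick [] c = (\<lambda>_. None :: 'a option)" by (simp add: fun_eq_iff)
  then show ?case by simp
qed

lemma emeasure_pick:
  assumes "\<And>x. x \<in> set xs \<Longrightarrow> 0 \<le> fst x"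
  shows "emeasure lborel {u. c \<le> u \<and> pick xs c u = Some b}
    = ennreal (\<Sum>x\<leftarrow>xs. if snd x = b then fst x else 0)"
  using assms
proof (induction xs arbitrary: c)
  case (Cons x xs)
  let ?A = "if snd x = b then {c..<c + fst x} else {}"
  let ?B = "{u. c + fst x \<le> u \<and> pick xs (c + fst x) u = Some b}"
  have x: "0 \<le> fst x" using Cons.prems by simp
  have m: "?B \<in> sets borel" by measurable
  have "0 \<le> (if snd y = b then fst y else 0)" if "y \<in> set xs" for y
    using Cons.prems[of y] that by simp
  then have nonneg: "0 \<le> (\<Sum>y\<leftarrow>xs. if snd y = b then fst y else 0)"
    by (metis (no_types, lifting) image_iff list.set_map sum_list_nonneg)
  have "{u. c \<le> u \<and> pick (x # xs) c u = Some b} = ?A \<union> ?B"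
    using x by auto
  also have "emeasure lborel (?A \<union> ?B) = emeasure lborel ?A + emeasure lborel ?B"
    using m by (intro plus_emeasure[symmetric]) auto
  also have "\<dots> = ennreal (if snd x = b then fst x else 0)
      + ennreal (\<Sum>x\<leftarrow>xs. if snd x = b then fst x else 0)"
    using Cons x by auto
  also have "\<dots> = ennreal (\<Sum>x\<leftarrow>x # xs. if snd x = b then fst x else 0)"
    using x nonneg by (subst ennreal_plus[symmetric]) auto
  finally show ?case .
qed simp

definition pmf_min :: "(('m::finite \<Rightarrow> 's::finite) \<Rightarrow> 's pmf) \<Rightarrow> 's \<Rightarrow> real" where
  "pmf_min \<phi> b = (MIN a\<in>UNIV. pmf (\<phi> a) b)"

definition known_part :: "(('m::finite \<Rightarrow> 's::finite) \<Rightarrow> 's pmf) \<Rightarrow> (real \<times> 's) list" where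
  "known_part \<phi> = map (\<lambda>b. (pmf_min \<phi> b, b)) enumeration"

definition unknown_part :: "(('m::finite \<Rightarrow> 's::finite) \<Rightarrow> 's pmf) \<Rightarrow> ('m \<Rightarrow> 's) \<Rightarrow> (real \<times> 's) list" where
  "unknown_part \<phi> a = map (\<lambda>b. (pmf (\<phi> a) b - pmf_min \<phi> b, b)) enumeration"

text \<open>Each symbol owns two intervals, one common to all patterns \<open>a\<close> and one that
  tops it up to \<open>pmf (\<phi> a) b\<close>. The lengths add up to 1, so the default symbol is
  reached only for \<open>u \<ge> 1\<close>.\<close>

definition update :: "(('m::finite \<Rightarrow> 's::finite) \<Rightarrow> 's pmf) \<Rightarrow> real \<Rightarrow> ('m \<Rightarrow> 's) \<Rightarrow> 's" where
  "update \<phi> u a = (case pick (known_part \<phi> @ unknown_part \<phi> a) 0 u of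
     Some b \<Rightarrow> b | None \<Rightarrow> hd enumeration)"

lemma pmf_min_le: "pmf_min \<phi> b \<le> pmf (\<phi> a) b"
  unfolding pmf_min_def by (intro Min_le) auto

lemma pmf_min_attained: "\<exists>a. pmf_min \<phi> b = pmf (\<phi> a) b"
proof -
  have "pmf_min \<phi> b \<in> range (\<lambda>a. pmf (\<phi> a) b)"
    unfolding pmf_min_def by (intro Min_in) auto
  then show ?thesis by auto
qed

lemma pmf_min_nonneg: "0 \<le> pmf_min \<phi> b"
  by (metis pmf_min_attained pmf_nonneg)

lemma sum_known_part: "sum_list (map fst (known_part \<phi>)) = 1 - p_unknown \<phi>"
  by (simp add: known_part_def p_unknown_def pmf_min_def o_def sum_list_enumeration)

lemma update_known: "pick (known_part \<phi>) 0 u = Some b \<Longrightarrow> update \<phi> u a = b"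
  by (simp add: update_def pick_append)

lemma known_part_not_Nil: "known_part \<phi> \<noteq> []"
  by (simp add: known_part_def enumeration_not_Nil)

lemma known_part_None: "pick (known_part \<phi>) 0 u = None \<Longrightarrow> 1 - p_unknown \<phi> \<le> u"
  using pick_None[of "known_part \<phi>" 0 u] by (simp add: sum_known_part known_part_not_Nil)

lemma measurable_update [measurable]: "(\<lambda>u. update \<phi> u a) \<in> borel \<rightarrow>\<^sub>M count_space UNIV"
  unfolding update_def by (rule measurable_compose[OF measurable_pick]) simp

lemma distr_update: "distr unif (count_space UNIV) (\<lambda>u. update \<phi> u a) = measure_pmf (\<phi> a)"
proof (rule measure_eqI_countable[where A = UNIV])
  fix b
  let ?L = "known_part \<phi> @ unknown_part \<phi> a"
  have nn: "0 \<le> fst x" if "x \<in> set ?L" for x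
    using that by (auto simp: known_part_def unknown_part_def pmf_min_nonneg pmf_min_le)
  have "sum_list (map fst (unknown_part \<phi> a)) = (\<Sum>b\<in>UNIV. pmf (\<phi> a) b - pmf_min \<phi> b)"
    by (simp add: unknown_part_def o_def sum_list_enumeration)
  also have "\<dots> = p_unknown \<phi>"
    using sum_pmf_eq_1[of UNIV "\<phi> a"] by (simp add: sum_subtractf p_unknown_def pmf_min_def)
  finally have sum: "sum_list (map fst ?L) = 1"
    by (simp add: sum_known_part)
  let ?B = "{u. 0 \<le> u \<and> pick ?L 0 u = Some b}"
  have "(\<Sum>x\<leftarrow>?L. if snd x = b then fst x else 0)
      = (\<Sum>c\<leftarrow>enumeration. if c = b then pmf_min \<phi> c else 0)
      + (\<Sum>c\<leftarrow>enumeration. if c = b then pmf (\<phi> a) c - pmf_min \<phi> c else 0)"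
    by (simp add: known_part_def unknown_part_def o_def cong: if_cong)
  also have "\<dots> = pmf (\<phi> a) b"
    by (simp add: sum_list_enumeration)
  finally have B: "emeasure lborel ?B = ennreal (pmf (\<phi> a) b)"
    using emeasure_pick[of ?L 0 b] nn by simp
  let ?A = "(\<lambda>u. update \<phi> u a) -` {b} \<inter> space unif"
  have mA: "?A \<in> sets borel"
    using measurable_sets[OF measurable_update, of "{b}" \<phi> a] by simp
  have [measurable]: "?A \<in> sets borel" "?B \<in> sets borel"
    using mA by simp measurable
  have "?L \<noteq> []" by (simp add: known_part_not_Nil)
  then have L: "u < 1 \<Longrightarrow> pick ?L 0 u \<noteq> None" for u
    using pick_None[of ?L 0 u] sum by auto
  have "emeasure lborel ({0..1} \<inter> ?A) = emeasure lborel ?B"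
  proof (rule emeasure_eq_AE)
    show "AE u in lborel. u \<in> {0..1} \<inter> ?A \<longleftrightarrow> u \<in> ?B"
    \<comment> \<open>The half-open intervals exhaust [0, 1), so the closed unit interval exceeds
      their union by the single null point 1.\<close>
    proof (rule AE_mp[OF AE_lborel_singleton[of 1] AE_I2], rule impI)
      fix u :: real assume u: "u \<noteq> 1"
      show "u \<in> {0..1} \<inter> ?A \<longleftrightarrow> u \<in> ?B"
      proof
        assume "u \<in> {0..1} \<inter> ?A"
        then show "u \<in> ?B" using u L[of u] by (auto simp: update_def)
      next
        assume *: "u \<in> ?B"
        then have "u < 1" using pick_Some_less[of ?L 0 u b] nn sum by auto
        then show "u \<in> {0..1} \<inter> ?A" using * by (auto simp: update_def)
      qed
    qed
  qed (use mA in auto)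
  then have "emeasure unif ?A = emeasure lborel ?B"
    using mA by (simp only: emeasure_unif)
  with B show "emeasure (distr unif (count_space UNIV) (\<lambda>u. update \<phi> u a)) {b}
      = emeasure (measure_pmf (\<phi> a)) {b}"
    by (subst emeasure_distr) (auto simp: emeasure_pmf_single)
qed auto

section \<open>Backward evaluation\<close>

text \<open>The vertex \<open>(k, s)\<close> stands for the site \<open>k\<close> at the time \<open>s\<close> steps before the present.\<close>

definition child :: "('m \<Rightarrow> int ^ 'd) \<Rightarrow> (int ^ 'd) \<times> nat \<Rightarrow> 'm \<Rightarrow> (int ^ 'd) \<times> nat" where
  "child nb v i = (fst v + nb i, Suc (snd v))"

text \<open>\<open>None\<close> at depth 0 stands for complete ignorance of the configuration that
  far back. Once the number at \<open>v\<close> misses the common intervals, the values of all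
  neighbours are demanded; a failure is then always inherited from some neighbour, and this creates
  the percolation path.\<close>

primrec kval ::
  "('m::finite \<Rightarrow> int ^ 'd::finite) \<Rightarrow> (('m \<Rightarrow> 's::finite) \<Rightarrow> 's pmf)
    \<Rightarrow> ((int ^ 'd) \<times> nat \<Rightarrow> real) \<Rightarrow> nat \<Rightarrow> (int ^ 'd) \<times> nat \<Rightarrow> 's option" where
  "kval nb \<phi> U 0 v = None"
| "kval nb \<phi> U (Suc t) v =
    (if pick (known_part \<phi>) 0 (U v) \<noteq> None then pick (known_part \<phi>) 0 (U v)
     else if \<forall>i. kval nb \<phi> U t (child nb v i) \<noteq> None
     then Some (update \<phi> (U v) (\<lambda>i. the (kval nb \<phi> U t (child nb v i)))) else None)"

text \<open>The forward dynamics unrolled backwards: \<open>y\<close> is the configuration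
  \<open>t\<close> steps earlier, and every vertex on the way uses its own number. All
  \<open>y\<close> are thereby driven by the same numbers.\<close>

primrec xval ::
  "('m::finite \<Rightarrow> int ^ 'd::finite) \<Rightarrow> (('m \<Rightarrow> 's::finite) \<Rightarrow> 's pmf)
    \<Rightarrow> ((int ^ 'd) \<times> nat \<Rightarrow> real) \<Rightarrow> ('d, 's) config \<Rightarrow> nat \<Rightarrow> (int ^ 'd) \<times> nat \<Rightarrow> 's" where
  "xval nb \<phi> U y 0 v = y (fst v)"
| "xval nb \<phi> U y (Suc t) v = update \<phi> (U v) (\<lambda>i. xval nb \<phi> U y t (child nb v i))"

text \<open>Coalescence: \<open>y\<close> occurs on one side only, so all initial configurations
  lead to the same symbol once the recursion succeeds.\<close>

lemma kval_xval: "kval nb \<phi> U t v = Some b \<Longrightarrow> xval nb \<phi> U y t v = b"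
proof (induction t arbitrary: v b)
  case (Suc t)
  show ?case
  proof (cases "pick (known_part \<phi>) 0 (U v)")
    case (Some c)
    then show ?thesis using Suc.prems by (simp add: update_known)
  next
    case None
    with Suc.prems have "\<forall>i. kval nb \<phi> U t (child nb v i) \<noteq> None"
      by (auto split: if_splits)
    then have "xval nb \<phi> U y t (child nb v i) = the (kval nb \<phi> U t (child nb v i))" for i
      using Suc.IH by (metis option.collapse)
    with None Suc.prems show ?thesis by (auto split: if_splits)
  qed
qed simp

lemma kval_mono: "kval nb \<phi> U t v = Some b \<Longrightarrow> t \<le> t' \<Longrightarrow> kval nb \<phi> U t' v = Some b"
proof (induction t arbitrary: t' v b)
  case (Suc t)
  then obtain t'' where t': "t' = Suc t''" "t \<le> t''" by (cases t') auto
  show ?case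
  proof (cases "pick (known_part \<phi>) 0 (U v)")
    case None
    with Suc.prems have "\<forall>i. kval nb \<phi> U t (child nb v i) \<noteq> None"
      by (auto split: if_splits)
    then have "kval nb \<phi> U t'' (child nb v i) = kval nb \<phi> U t (child nb v i)" for i
      using Suc.IH[OF _ t'(2)] by (metis option.collapse)
    with None Suc.prems show ?thesis by (auto split: if_splits simp: t'(1))
  qed (use Suc.prems in \<open>auto simp: t'\<close>)
qed simp

lemma kval_unique: "kval nb \<phi> U t v = Some b \<Longrightarrow> kval nb \<phi> U t' v = Some b' \<Longrightarrow> b = b'"
  using kval_mono[of nb \<phi> U t v b "max t t'"] kval_mono[of nb \<phi> U t' v b' "max t t'"] by simp

lemma kval_shift:
  assumes "\<And>v. U' v = U (fst v + z, snd v + s)"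
  shows "kval nb \<phi> U' t v = kval nb \<phi> U t (fst v + z, snd v + s)"
proof (induction t arbitrary: v)
  case (Suc t)
  have "child nb (fst v + z, snd v + s) i = (fst (child nb v i) + z, snd (child nb v i) + s)" for i
    by (simp add: child_def add_ac)
  moreover have "U' v = U (fst v + z, snd v + s)" by (rule assms)
  ultimately show ?case by (simp only: kval.simps Suc)
qed simp

lemma xval_shift:
  assumes "\<And>v. U' v = U (fst v, snd v + s)"
  shows "xval nb \<phi> U' y t v = xval nb \<phi> U y t (fst v, snd v + s)"
proof (induction t arbitrary: v)
  case (Suc t)
  then show ?case by (simp add: assms child_def add_ac)
qed simp

primrec reach :: "('m::finite \<Rightarrow> int ^ 'd::finite) \<Rightarrow> nat \<Rightarrow> (int ^ 'd) \<times> nat \<Rightarrow> ((int ^ 'd) \<times> nat) set" where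
  "reach nb 0 v = {}"
| "reach nb (Suc t) v = insert v (\<Union>i. reach nb t (child nb v i))"

lemma finite_reach: "finite (reach nb t v)"
  by (induction t arbitrary: v) auto

lemma reach_shift: "w \<in> reach nb t (fst v + z, snd v) \<Longrightarrow> (fst w - z, snd w) \<in> reach nb t v"
proof (induction t arbitrary: v)
  case (Suc t)
  have *: "child nb (fst v + z, snd v) i = (fst (child nb v i) + z, snd (child nb v i))" for i
    by (simp add: child_def add_ac)
  from Suc.prems consider "w = (fst v + z, snd v)" | i where "w \<in> reach nb t (child nb (fst v + z, snd v) i)"
    by auto
  then show ?case
  proof cases
    case 2
    then have "(fst w - z, snd w) \<in> reach nb t (child nb v i)"
      unfolding * by (rule Suc.IH)
    then show ?thesis by auto
  qed simp
qed simp

lemma kval_cong: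
  "(\<And>w. w \<in> reach nb t v \<Longrightarrow> U w = U' w) \<Longrightarrow> kval nb \<phi> U t v = kval nb \<phi> U' t v"
proof (induction t arbitrary: v)
  case (Suc t)
  have "kval nb \<phi> U t (child nb v i) = kval nb \<phi> U' t (child nb v i)" for i
    using Suc.prems by (intro Suc.IH) auto
  moreover have "U v = U' v" using Suc.prems by simp
  ultimately show ?case by (simp only: kval.simps)
qed simp

text \<open>Both ways of producing a value must fail at every depth. If each neighbour were known at
  some depth, the maximum of these finitely many depths would serve all of them; so one fixed
  neighbour stays unknown at all depths, which is what allows the argument to be repeated
  there.\<close>

lemma kval_step_None:
  assumes "\<And>t. kval nb \<phi> U t v = None"
  shows "1 - p_unknown \<phi> \<le> U v" "\<exists>i. \<forall>t. kval nb \<phi> U t (child nb v i) = None"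
proof -
  have p: "pick (known_part \<phi>) 0 (U v) = None"
    using assms[of "Suc 0"] by (auto split: if_splits)
  then show "1 - p_unknown \<phi> \<le> U v" by (rule known_part_None)
  show "\<exists>i. \<forall>t. kval nb \<phi> U t (child nb v i) = None"
  proof (rule ccontr)
    assume "\<not> ?thesis"
    then have "\<forall>i. \<exists>t. kval nb \<phi> U t (child nb v i) \<noteq> None" by blast
    then obtain t where t: "\<And>i. kval nb \<phi> U (t i) (child nb v i) \<noteq> None" by metis
    have "t i \<le> Max (range t)" for i by simp
    then have "kval nb \<phi> U (Max (range t)) (child nb v i) \<noteq> None" for i
      using t[of i] by (metis kval_mono not_None_eq)
    then have "kval nb \<phi> U (Suc (Max (range t))) v \<noteq> None" using p by simp
    with assms[of "Suc (Max (range t))"] show False by contradiction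
  qed
qed

text \<open>Koenig's lemma. The reflection is needed because the value at \<open>k\<close> depends on \<open>k + nb i\<close> one
  step further in the past, while a percolation path moves from \<open>k + nb i\<close> to \<open>k\<close>.\<close>

lemma undetermined_imp_percolates:
  assumes "\<And>t. kval nb \<phi> U t v = None"
  shows "percolates nb (\<lambda>w. 1 - p_unknown \<phi> \<le> U (- fst w, snd w))"
proof -
  define g where "g = rec_nat v (\<lambda>_ w. child nb w (SOME i. \<forall>t. kval nb \<phi> U t (child nb w i) = None))"
  have g0: "g 0 = v" and gS: "g (Suc n) = child nb (g n) (SOME i. \<forall>t. kval nb \<phi> U t (child nb (g n) i) = None)" for n
    by (simp_all add: g_def)
  have g: "\<forall>t. kval nb \<phi> U t (g n) = None" for n
  proof (induction n)
    case (Suc n)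
    from someI_ex[OF kval_step_None(2)[of nb \<phi> U "g n"]] Suc show ?case by (simp add: gS)
  qed (simp add: g0 assms)
  let ?\<gamma> = "\<lambda>n. (- fst (g n), snd (g n))"
  have "1 - p_unknown \<phi> \<le> U (g n)" for n
    using kval_step_None(1)[of nb \<phi> U "g n"] g by blast
  moreover have "perc_edge nb (?\<gamma> n) (?\<gamma> (Suc n))" for n
    by (auto simp: perc_edge_def gS child_def)
  ultimately show ?thesis
    unfolding percolates_def by (intro exI[of _ ?\<gamma>]) simp
qed

section \<open>The field of uniform numbers\<close>

definition site_source :: "((int ^ 'd::finite) \<times> nat \<Rightarrow> real) measure" where
  "site_source = PiM UNIV (\<lambda>_. unif)"

lemma prob_space_site_source: "prob_space site_source"
  unfolding site_source_def by (intro prob_space_PiM prob_space_unif)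

lemma space_site_source [simp]: "space site_source = UNIV"
  by (auto simp: site_source_def space_PiM)

lemma space_config_space [simp]: "space config_space = UNIV"
  by (auto simp: config_space_def space_PiM)

lemma measurable_site: "(\<lambda>U. U v) \<in> site_source \<rightarrow>\<^sub>M borel"
proof -
  have "(\<lambda>U. U v) \<in> site_source \<rightarrow>\<^sub>M unif"
    unfolding site_source_def by (rule measurable_component_singleton) simp
  then show ?thesis by (simp cong: measurable_cong_sets)
qed

lemma measurable_finite_fun:
  fixes f :: "'m::finite \<Rightarrow> 'a \<Rightarrow> 's::countable"
  assumes "\<And>i. f i \<in> M \<rightarrow>\<^sub>M count_space UNIV"
  shows "(\<lambda>x i. f i x) \<in> M \<rightarrow>\<^sub>M count_space UNIV"
proof (subst measurable_count_space_eq_countable)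
  show "countable (UNIV :: ('m \<Rightarrow> 's) set)" by simp
  have "(\<lambda>x i. f i x) -` {a} \<inter> space M \<in> sets M" for a
  proof -
    have "(\<lambda>x i. f i x) -` {a} \<inter> space M = (\<Inter>i. f i -` {a i} \<inter> space M)"
      by auto
    also have "\<dots> \<in> sets M"
      using assms by (intro sets.finite_INT) (auto intro: measurable_sets)
    finally show ?thesis .
  qed
  then show "(\<lambda>x i. f i x) \<in> space M \<rightarrow> UNIV \<and> (\<forall>a\<in>UNIV. (\<lambda>x i. f i x) -` {a} \<inter> space M \<in> sets M)"
    by simp
qed

lemma measurable_update_comp:
  assumes u: "u \<in> M \<rightarrow>\<^sub>M borel" and f: "\<And>i. f i \<in> M \<rightarrow>\<^sub>M count_space UNIV"
  shows "(\<lambda>x. update \<phi> (u x) (\<lambda>i. f i x)) \<in> M \<rightarrow>\<^sub>M count_space UNIV"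
  by (rule measurable_compose_countable[OF _ measurable_finite_fun[OF f]])
    (rule measurable_compose[OF u measurable_update])

lemma measurable_kval: "(\<lambda>U. kval nb \<phi> U t v) \<in> site_source \<rightarrow>\<^sub>M count_space UNIV"
proof (induction t arbitrary: v)
  case (Suc t)
  note [measurable] = Suc
  have [measurable]: "(\<lambda>U. update \<phi> (U v) (\<lambda>i. the (kval nb \<phi> U t (child nb v i)))) \<in> site_source \<rightarrow>\<^sub>M count_space UNIV"
    by (intro measurable_update_comp measurable_site measurable_compose[OF Suc]) simp
  have [measurable]: "(\<lambda>U. pick (known_part \<phi>) 0 (U v)) \<in> site_source \<rightarrow>\<^sub>M count_space UNIV"
    by (rule measurable_compose[OF measurable_site measurable_pick])
  show ?case by simp measurable
qed simp

lemma measurable_xval: "(\<lambda>U. xval nb \<phi> U y t v) \<in> site_source \<rightarrow>\<^sub>M count_space UNIV"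
proof (induction t arbitrary: v)
  case (Suc t)
  show ?case unfolding xval.simps by (intro measurable_update_comp measurable_site Suc)
qed simp

lemma distr_site_source_shift:
  assumes "inj g"
  shows "distr site_source site_source (\<lambda>U v. U (g v)) = site_source"
  using distr_PiM_map_reindex[OF prob_space_unif assms, of "\<lambda>_ x. x" "\<lambda>_. unif"]
  by (simp add: site_source_def distr_id2)

section \<open>Ergodicity and mixing\<close>

lemma percolates_mono: "percolates nb \<omega> \<Longrightarrow> (\<And>v. \<omega> v \<Longrightarrow> \<omega>' v) \<Longrightarrow> percolates nb \<omega>'"
  unfolding percolates_def by blast

text \<open>The set in the definition of \<open>p_crit\<close> must be nonempty before
  \<open>less_cSup_iff\<close> can extract a parameter from its supremum.\<close>

lemma AE_not_percolates_0:
  fixes nb :: "'m::finite \<Rightarrow> int ^ 'd::finite"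
  shows "AE \<omega> in perc_measure 0. \<not> percolates nb \<omega>"
proof -
  have "AE \<omega> in perc_measure 0. \<not> \<omega> v" for v :: "(int ^ 'd) \<times> nat"
    unfolding perc_measure_def
    by (rule AE_PiM_component) (auto simp: measure_pmf.prob_space_axioms AE_measure_pmf_iff set_pmf_iff)
  then have "AE \<omega> in perc_measure 0. \<forall>v :: (int ^ 'd) \<times> nat. \<not> \<omega> v"
    unfolding AE_all_countable by blast
  then show ?thesis
  proof (rule AE_mp, intro AE_I2 impI)
    fix \<omega> :: "(int ^ 'd) \<times> nat \<Rightarrow> bool"
    assume "\<forall>v. \<not> \<omega> v"
    then show "\<not> percolates nb \<omega>" unfolding percolates_def by blast
  qed
qed

lemma distr_unif_bernoulli:
  assumes "p \<in> {0..1}"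
  shows "distr unif (measure_pmf (bernoulli_pmf p)) (\<lambda>u. 1 - p \<le> u) = measure_pmf (bernoulli_pmf p)"
    (is "?D = _")
proof -
  interpret unif: prob_space unif by (rule prob_space_unif)
  have meas: "(\<lambda>u. 1 - p \<le> u) \<in> unif \<rightarrow>\<^sub>M measure_pmf (bernoulli_pmf p)"
    by measurable
  interpret D: prob_space ?D
    using meas by (rule unif.prob_space_distr)
  have "(\<lambda>u. 1 - p \<le> u) -` {True} \<inter> space unif = {1 - p..}"
    by auto
  then have "emeasure ?D {True} = emeasure unif {1 - p..}"
    using emeasure_distr[OF meas, of "{True}"] by simp
  also have "\<dots> = emeasure lborel ({0..1} \<inter> {1 - p..})"
    by (rule emeasure_unif) simp
  also have "{0..1} \<inter> {1 - p..} = {1 - p..1}"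
    using assms by auto
  also have "emeasure lborel {1 - p..1} = ennreal p"
    using assms by simp
  finally have T: "measure ?D {True} = p"
    using assms by (simp add: measure_def)
  have "measure ?D {False} = 1 - measure ?D {True}"
    by (subst D.prob_compl[symmetric]) (auto intro!: arg_cong[where f = "measure ?D"])
  with T have F: "measure ?D {False} = 1 - p" by simp
  show ?thesis
  proof (rule measure_eqI_countable[where A = UNIV])
    fix b
    show "emeasure ?D {b} = emeasure (measure_pmf (bernoulli_pmf p)) {b}"
      using T F assms
      by (cases b) (auto simp: D.emeasure_eq_measure emeasure_pmf_single)
  qed auto
qed

lemma AE_determined:
  fixes nb :: "'m::finite \<Rightarrow> int ^ 'd::finite"
  assumes "p_unknown \<phi> < p_crit nb"
  shows "AE U in site_source. \<forall>v. \<exists>t. kval nb \<phi> U t v \<noteq> None"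
proof -
  let ?P = "{p \<in> {0..1}. AE \<omega> in perc_measure p. \<not> percolates nb \<omega>}"
  have ne: "?P \<noteq> {}" using AE_not_percolates_0[of nb] by force
  have bdd: "bdd_above ?P" by (rule bdd_aboveI[of _ 1]) auto
  \<comment> \<open>Below the supremum there is a level \<open>p\<close> without percolation that
    still exceeds \<open>p_unknown \<phi>\<close>. Passing from \<open>p_unknown \<phi>\<close> to
    \<open>p\<close> only opens more vertices.\<close>
  from assms obtain p where p: "p \<in> {0..1}" "p_unknown \<phi> < p"
    and AE: "AE \<omega> in perc_measure p. \<not> percolates nb \<omega>"
    unfolding p_crit_def less_cSup_iff[OF ne bdd] by auto
  define g :: "(int ^ 'd) \<times> nat \<Rightarrow> (int ^ 'd) \<times> nat" where "g w = (- fst w, snd w)" for w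
  have "inj g" by (auto simp: inj_on_def g_def prod_eq_iff)
  note law = distr_PiM_map_reindex[OF prob_space_unif this, of "\<lambda>_ u. 1 - p \<le> u"
      "\<lambda>_. measure_pmf (bernoulli_pmf p)", unfolded distr_unif_bernoulli[OF p(1)],
      folded perc_measure_def site_source_def]
  have law: "distr site_source (perc_measure p) (\<lambda>U w. 1 - p \<le> U (g w)) = perc_measure p"
    by (rule law) measurable
  have meas: "(\<lambda>U w. 1 - p \<le> U (g w)) \<in> site_source \<rightarrow>\<^sub>M perc_measure p"
    unfolding perc_measure_def
  proof (intro measurable_PiM_single')
    note [measurable] = measurable_site
    show "(\<lambda>U. 1 - p \<le> U (g w)) \<in> site_source \<rightarrow>\<^sub>M measure_pmf (bernoulli_pmf p)" for w
      by measurable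
  qed auto
  \<comment> \<open>A null set covering the percolation event is pulled back, so the event itself
    may be non-measurable as far as this step is concerned.\<close>
  have "AE U in site_source. \<not> percolates nb (\<lambda>w. 1 - p \<le> U (g w))"
    using AE by (intro AE_distrD[OF meas]) (simp only: law)
  then show ?thesis
  proof (rule AE_mp, intro AE_I2 impI allI)
    fix U :: "(int ^ 'd) \<times> nat \<Rightarrow> real" and v
    assume np: "\<not> percolates nb (\<lambda>w. 1 - p \<le> U (g w))"
    show "\<exists>t. kval nb \<phi> U t v \<noteq> None"
    proof (rule ccontr)
      assume "\<not> ?thesis"
      then have "percolates nb (\<lambda>w. 1 - p_unknown \<phi> \<le> U (g w))"
        unfolding g_def by (intro undetermined_imp_percolates[where v = v]) auto
      then have "percolates nb (\<lambda>w. 1 - p \<le> U (g w))"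
        by (rule percolates_mono) (use p in auto)
      with np show False by contradiction
    qed
  qed
qed

text \<open>The value from the infinite past. \<open>LEAST\<close> makes it a measurable function of
  the whole field; where no depth suffices, a null event below the threshold, it is the arbitrary
  symbol \<open>the None\<close>.\<close>

definition lim_val ::
  "('m::finite \<Rightarrow> int ^ 'd::finite) \<Rightarrow> (('m \<Rightarrow> 's::finite) \<Rightarrow> 's pmf)
    \<Rightarrow> ((int ^ 'd) \<times> nat \<Rightarrow> real) \<Rightarrow> (int ^ 'd) \<times> nat \<Rightarrow> 's" where
  "lim_val nb \<phi> U v = the (kval nb \<phi> U (LEAST t. kval nb \<phi> U t v \<noteq> None) v)"

lemma lim_val_eq: "kval nb \<phi> U t v = Some b \<Longrightarrow> lim_val nb \<phi> U v = b"
  unfolding lim_val_def using LeastI[of "\<lambda>t. kval nb \<phi> U t v \<noteq> None" t]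
  by (auto dest: kval_unique)

lemma lim_val_shift:
  assumes "\<And>v. U' v = U (fst v + z, snd v + s)"
  shows "lim_val nb \<phi> U' v = lim_val nb \<phi> U (fst v + z, snd v + s)"
  unfolding lim_val_def kval_shift[of U' U z s nb \<phi>, OF assms] ..

text \<open>At a depth that suffices for all neighbours, the recursion can be read with limits in
  place of approximations. Hence the limits form a trajectory of the dynamics over the whole past,
  which is the source of invariance.\<close>

lemma lim_val_step:
  assumes "\<forall>v. \<exists>t. kval nb \<phi> U t v \<noteq> None"
  shows "lim_val nb \<phi> U v = update \<phi> (U v) (\<lambda>i. lim_val nb \<phi> U (child nb v i))"
proof -
  from assms have "\<forall>i. \<exists>t. kval nb \<phi> U t (child nb v i) \<noteq> None" by blast
  then obtain t where t: "\<And>i. kval nb \<phi> U (t i) (child nb v i) \<noteq> None" by metis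
  let ?T = "Max (range t)"
  have "t i \<le> ?T" for i by simp
  then have *: "kval nb \<phi> U ?T (child nb v i) = Some (lim_val nb \<phi> U (child nb v i))" for i
    using t[of i] by (metis kval_mono lim_val_eq not_None_eq)
  \<comment> \<open>If the number at \<open>v\<close> falls into a common interval,
    \<open>update\<close> ignores the pattern, so both successful branches of \<open>kval\<close>
    have this form.\<close>
  have "kval nb \<phi> U (Suc ?T) v = Some (update \<phi> (U v) (\<lambda>i. lim_val nb \<phi> U (child nb v i)))"
    by (simp add: * update_known split: option.split) (auto simp: update_known)
  then show ?thesis by (rule lim_val_eq)
qed

lemma measurable_lim_val: "(\<lambda>U. lim_val nb \<phi> U v) \<in> site_source \<rightarrow>\<^sub>M count_space UNIV"
  unfolding lim_val_def
proof (rule measurable_compose_countable[where g = "\<lambda>U. LEAST t. kval nb \<phi> U t v \<noteq> None"])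
  show "(\<lambda>U. LEAST t. kval nb \<phi> U t v \<noteq> None) \<in> site_source \<rightarrow>\<^sub>M count_space UNIV"
    by (intro measurable_Least measurable_compose[OF measurable_kval]) simp
qed (rule measurable_compose[OF measurable_kval], simp)

section \<open>The law of the limit and its invariance\<close>

lemma measurable_to_config:
  assumes "\<And>k. (\<lambda>x. f x k) \<in> M \<rightarrow>\<^sub>M count_space UNIV"
  shows "f \<in> M \<rightarrow>\<^sub>M config_space"
  unfolding config_space_def using assms by (intro measurable_PiM_single') auto

lemma measurable_config_component: "(\<lambda>x. x k) \<in> config_space \<rightarrow>\<^sub>M count_space UNIV"
  unfolding config_space_def by (rule measurable_component_singleton) simp

lemma distr_update_config:
  "distr (PiM UNIV (\<lambda>_. unif)) config_space (\<lambda>a k. update \<phi> (a k) (\<lambda>i. z (k + nb i))) = pca nb \<phi> z"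
proof -
  have "(\<lambda>u. update \<phi> u (\<lambda>i. z (k + nb i))) \<in> unif \<rightarrow>\<^sub>M count_space UNIV" for k
    using measurable_update by (simp cong: measurable_cong_sets)
  from distr_PiM_map_reindex[OF prob_space_unif inj_on_id2 this] show ?thesis
    by (simp add: config_space_def pca_def distr_update)
qed

text \<open>Shifted by one step, \<open>Y\<close> does not read the numbers at time 0. Given the
  past, these produce one application of the kernel, and integrating over the past gives the bind.
  \<open>Y\<close> is arbitrary because the lemma is applied to \<open>xval\<close> for the kernel
  powers and to \<open>lim_val\<close> for invariance.\<close>

lemma distr_step:
  fixes nb :: "'m::finite \<Rightarrow> int ^ 'd::finite" and \<phi> :: "('m \<Rightarrow> 's::finite) \<Rightarrow> 's pmf"
  assumes Y: "Y \<in> site_source \<rightarrow>\<^sub>M config_space"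
  shows "distr site_source config_space
      (\<lambda>U k. update \<phi> (U (k, 0)) (\<lambda>i. Y (\<lambda>v. U (fst v, Suc (snd v))) (k + nb i)))
    = distr site_source config_space Y \<bind> pca nb \<phi>" (is "distr _ _ ?X = _")
proof -
  let ?P = "PiM UNIV (\<lambda>_ :: int ^ 'd. unif)"
  interpret S: prob_space "site_source :: ((int ^ 'd) \<times> nat \<Rightarrow> real) measure"
    by (rule prob_space_site_source)
  interpret P: prob_space ?P by (intro prob_space_PiM prob_space_unif)
  interpret PS: pair_sigma_finite ?P "site_source :: ((int ^ 'd) \<times> nat \<Rightarrow> real) measure" ..
  let ?G = "\<lambda>(a, U) k. update \<phi> (a k) (\<lambda>i. Y U (k + nb i))"
  have tc: "(\<lambda>(a, U). time_cons a U) \<in> ?P \<Otimes>\<^sub>M site_source \<rightarrow>\<^sub>M site_source"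
    unfolding site_source_def by (rule measurable_time_cons)
  have shift: "(\<lambda>U v. U (fst v, Suc (snd v))) \<in> site_source \<rightarrow>\<^sub>M (site_source :: ((int ^ 'd) \<times> nat \<Rightarrow> real) measure)"
    by (subst (2) site_source_def, intro measurable_PiM_single')
      (auto intro: measurable_compose[OF measurable_site, of _ unif] simp: measurable_ident_sets)
  have X: "?X \<in> site_source \<rightarrow>\<^sub>M config_space"
    by (intro measurable_to_config measurable_update_comp measurable_site
        measurable_compose[OF shift] measurable_compose[OF Y] measurable_config_component)
  have fstk: "(\<lambda>x. fst x k) \<in> ?P \<Otimes>\<^sub>M N \<rightarrow>\<^sub>M borel" for k and N :: "'z measure"
  proof -
    have "(\<lambda>x. fst x k) \<in> ?P \<Otimes>\<^sub>M N \<rightarrow>\<^sub>M unif" by measurable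
    then show ?thesis by (simp cong: measurable_cong_sets)
  qed
  have G: "?G \<in> ?P \<Otimes>\<^sub>M site_source \<rightarrow>\<^sub>M config_space"
    unfolding split_beta'
    by (intro measurable_to_config measurable_update_comp fstk
        measurable_compose[OF measurable_snd] measurable_compose[OF Y] measurable_config_component)
  have pca: "pca nb \<phi> \<in> config_space \<rightarrow>\<^sub>M subprob_algebra config_space"
    by (rule measurable_prob_algebraD[OF measurable_pca])
  have pca': "pca nb \<phi> \<in> distr site_source config_space Y \<rightarrow>\<^sub>M subprob_algebra config_space"
    by (subst measurable_cong_sets[OF sets_distr refl]) (rule pca)
  have S: "site_source = distr (?P \<Otimes>\<^sub>M site_source) site_source (\<lambda>(a, U). time_cons a U)"
    unfolding site_source_def by (rule distr_time_cons[OF prob_space_unif, symmetric])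
  have "distr site_source config_space ?X = distr (?P \<Otimes>\<^sub>M site_source) config_space ?G"
    by (subst S, subst distr_distr[OF X tc]) (auto intro!: distr_cong simp: o_def split_beta')
  also have "\<dots> = distr site_source config_space Y \<bind> pca nb \<phi>"
  proof (rule measure_eqI)
    show "sets (distr (?P \<Otimes>\<^sub>M site_source) config_space ?G) = sets (distr site_source config_space Y \<bind> pca nb \<phi>)"
      by (subst sets_bind[where N = config_space]) (auto simp: sets_pca)
    fix A assume "A \<in> sets (distr (?P \<Otimes>\<^sub>M site_source) config_space ?G)"
    then have A: "A \<in> sets config_space" by simp
    have "emeasure (distr (?P \<Otimes>\<^sub>M site_source) config_space ?G) A
        = emeasure (?P \<Otimes>\<^sub>M site_source) (?G -` A \<inter> space (?P \<Otimes>\<^sub>M site_source))"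
      by (rule emeasure_distr[OF G A])
    also have "\<dots> = (\<integral>\<^sup>+U. emeasure ?P ((\<lambda>a. (a, U)) -` (?G -` A \<inter> space (?P \<Otimes>\<^sub>M site_source))) \<partial>site_source)"
      by (rule PS.emeasure_pair_measure_alt2[OF measurable_sets[OF G A]])
    also have "\<dots> = (\<integral>\<^sup>+U. emeasure (pca nb \<phi> (Y U)) A \<partial>site_source)"
    proof (rule nn_integral_cong)
      fix U
      have m: "(\<lambda>a k. update \<phi> (a k) (\<lambda>i. Y U (k + nb i))) \<in> ?P \<rightarrow>\<^sub>M config_space"
        using measurable_compose[OF measurable_Pair2' G, of U] by simp
      have "(\<lambda>a. (a, U)) -` (?G -` A \<inter> space (?P \<Otimes>\<^sub>M site_source))
          = (\<lambda>a k. update \<phi> (a k) (\<lambda>i. Y U (k + nb i))) -` A \<inter> space ?P"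
        by (auto simp: space_pair_measure)
      then show "emeasure ?P ((\<lambda>a. (a, U)) -` (?G -` A \<inter> space (?P \<Otimes>\<^sub>M site_source)))
          = emeasure (pca nb \<phi> (Y U)) A"
        by (simp add: distr_update_config[symmetric] emeasure_distr[OF m A])
    qed
    also have "\<dots> = (\<integral>\<^sup>+x. emeasure (pca nb \<phi> x) A \<partial>distr site_source config_space Y)"
      using A pca pca' by (intro nn_integral_distr[OF Y, symmetric] measurable_emeasure_kernel)
    also have "\<dots> = emeasure (distr site_source config_space Y \<bind> pca nb \<phi>) A"
      using A by (intro emeasure_bind[OF _ pca', symmetric]) auto
    finally show "emeasure (distr (?P \<Otimes>\<^sub>M site_source) config_space ?G) A
        = emeasure (distr site_source config_space Y \<bind> pca nb \<phi>) A" .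
  qed
  finally show ?thesis .
qed

lemma measurable_xval_config: "(\<lambda>U k. xval nb \<phi> U y t (k, 0)) \<in> site_source \<rightarrow>\<^sub>M config_space"
  by (intro measurable_to_config measurable_xval)

text \<open>The last factor of the kernel power is the step into time 0, which is the outermost call
  of \<open>xval\<close>; the remaining calls live on the field shifted by one step.\<close>

lemma kernel_pow_eq_distr:
  "kernel_pow (pca nb \<phi>) t y = distr site_source config_space (\<lambda>U k. xval nb \<phi> U y t (k, 0))"
proof (induction t)
  case 0
  then show ?case
    by (simp add: prob_space.distr_const[OF prob_space_site_source])
next
  case (Suc t)
  have "xval nb \<phi> (\<lambda>v. U (fst v, Suc (snd v))) y t (k, 0) = xval nb \<phi> U y t (k, Suc 0)" for U k
    using xval_shift[of "\<lambda>v. U (fst v, Suc (snd v))" U 1 nb \<phi> y t "(k, 0)"] by simp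
  then show ?case
    by (simp add: Suc distr_step[OF measurable_xval_config, symmetric] child_def)
qed

definition pca_limit ::
  "('m::finite \<Rightarrow> int ^ 'd::finite) \<Rightarrow> (('m \<Rightarrow> 's::finite) \<Rightarrow> 's pmf) \<Rightarrow> ('d, 's) config measure" where
  "pca_limit nb \<phi> = distr site_source config_space (\<lambda>U k. lim_val nb \<phi> U (k, 0))"

lemma measurable_lim_config: "(\<lambda>U k. lim_val nb \<phi> U (k, 0)) \<in> site_source \<rightarrow>\<^sub>M config_space"
  by (intro measurable_to_config measurable_lim_val)

lemma prob_space_pca_limit: "prob_space (pca_limit nb \<phi>)"
  unfolding pca_limit_def
  by (rule prob_space.prob_space_distr[OF prob_space_site_source measurable_lim_config])

lemma sets_pca_limit [simp]: "sets (pca_limit nb \<phi>) = sets config_space"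
  by (simp add: pca_limit_def)

lemma invariant_pca_limit:
  assumes "p_unknown \<phi> < p_crit nb"
  shows "invariant_measure (pca nb \<phi>) (pca_limit nb \<phi>)"
proof -
  have s: "lim_val nb \<phi> (\<lambda>v. U (fst v, Suc (snd v))) (k, 0) = lim_val nb \<phi> U (k, Suc 0)" for U k
    using lim_val_shift[of "\<lambda>v. U (fst v, Suc (snd v))" U 0 1 nb \<phi> "(k, 0)"] by simp
  have Z: "(\<lambda>U k. update \<phi> (U (k, 0)) (\<lambda>i. lim_val nb \<phi> U (k + nb i, Suc 0))) \<in> site_source \<rightarrow>\<^sub>M config_space"
    by (intro measurable_to_config measurable_update_comp measurable_site measurable_lim_val)
  have "pca_limit nb \<phi> \<bind> pca nb \<phi> = distr site_source config_space
      (\<lambda>U k. update \<phi> (U (k, 0)) (\<lambda>i. lim_val nb \<phi> U (k + nb i, Suc 0)))"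
    by (simp add: pca_limit_def distr_step[OF measurable_lim_config, symmetric] s)
  also have "\<dots> = pca_limit nb \<phi>"
    unfolding pca_limit_def
  proof (rule distr_cong_AE[OF refl refl _ Z measurable_lim_config])
    show "AE U in site_source. (\<lambda>k. update \<phi> (U (k, 0)) (\<lambda>i. lim_val nb \<phi> U (k + nb i, Suc 0)))
        = (\<lambda>k. lim_val nb \<phi> U (k, 0))"
      using AE_determined[OF assms]
      by (rule AE_mp) (auto intro!: AE_I2 simp: lim_val_step[of nb \<phi> _ "(_, 0)"] child_def)
  qed
  finally show ?thesis
    by (simp add: invariant_measure_def prob_space_pca_limit)
qed

section \<open>Convergence, uniform in the initial configuration\<close>

definition undetermined_prob ::
  "('m::finite \<Rightarrow> int ^ 'd::finite) \<Rightarrow> (('m \<Rightarrow> 's::finite) \<Rightarrow> 's pmf) \<Rightarrow> (int ^ 'd) set \<Rightarrow> nat \<Rightarrow> real" where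
  "undetermined_prob nb \<phi> K t = measure site_source {U. \<exists>k\<in>K. kval nb \<phi> U t (k, 0) = None}"

lemma sets_kval_Collect: "{U. P (kval nb \<phi> U t v)} \<in> sets site_source"
  using measurable_sets[OF measurable_kval, of "Collect P" nb \<phi> t v] by (simp add: vimage_def)

lemma sets_lim_val_Collect: "{U. P (lim_val nb \<phi> U v)} \<in> sets site_source"
  using measurable_sets[OF measurable_lim_val, of "Collect P" nb \<phi> v] by (simp add: vimage_def)

lemma sets_undetermined:
  "finite K \<Longrightarrow> {U. \<exists>k\<in>K. kval nb \<phi> U t (k, 0) = None} \<in> sets site_source"
proof -
  assume "finite K"
  moreover have "{U. \<exists>k\<in>K. kval nb \<phi> U t (k, 0) = None} = (\<Union>k\<in>K. {U. kval nb \<phi> U t (k, 0) = None})"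
    by auto
  ultimately show ?thesis by (auto intro!: sets.finite_UN sets_kval_Collect)
qed

text \<open>The events decrease in \<open>t\<close> by \<open>kval_mono\<close>, and their
  intersection is null: when each site of the finite set \<open>K\<close> has a sufficient depth,
  the largest of these serves all.\<close>

lemma tendsto_undetermined_prob:
  assumes "p_unknown \<phi> < p_crit nb" "finite K"
  shows "undetermined_prob nb \<phi> K \<longlonglongrightarrow> 0"
proof -
  interpret prob_space "site_source :: ((int ^ 'd) \<times> nat \<Rightarrow> real) measure"
    by (rule prob_space_site_source)
  let ?A = "\<lambda>t. {U. \<exists>k\<in>K. kval nb \<phi> U t (k, 0) = None}"
  have "(\<lambda>t. measure site_source (?A t)) \<longlonglongrightarrow> measure site_source (\<Inter>t. ?A t)"
  proof (rule finite_Lim_measure_decseq)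
    show "range ?A \<subseteq> sets site_source" using sets_undetermined[OF assms(2)] by auto
    show "decseq ?A"
    proof (rule decseq_SucI, safe)
      fix t U k
      assume "k \<in> K" "kval nb \<phi> U (Suc t) (k, 0) = None"
      then show "\<exists>k\<in>K. kval nb \<phi> U t (k, 0) = None"
        using kval_mono[of nb \<phi> U t "(k, 0)" _ "Suc t"] by (metis le_SucI not_None_eq order_refl)
    qed
  qed
  also have "measure site_source (\<Inter>t. ?A t) = 0"
  proof -
    have "AE U in site_source. U \<notin> (\<Inter>t. ?A t)"
      using AE_determined[OF assms(1)]
    proof (rule AE_mp, intro AE_I2 impI notI)
      fix U assume det: "\<forall>v. \<exists>t. kval nb \<phi> U t v \<noteq> None" and "U \<in> (\<Inter>t. ?A t)"
      then have *: "\<forall>t. \<exists>k\<in>K. kval nb \<phi> U t (k, 0) = None" by auto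
      from det have "\<forall>k. \<exists>t. kval nb \<phi> U t (k, 0) \<noteq> None" by blast
      then obtain t where t: "\<And>k. kval nb \<phi> U (t k) (k, 0) \<noteq> None" by metis
      have "t k \<le> Max (t ` K)" if "k \<in> K" for k using that assms(2) by simp
      then have "kval nb \<phi> U (Max (t ` K)) (k, 0) \<noteq> None" if "k \<in> K" for k
        using t[of k] that by (metis kval_mono not_None_eq)
      with * show False by blast
    qed
    moreover have "(\<Inter>t. ?A t) \<in> sets site_source"
      using sets_undetermined[OF assms(2)] by auto
    ultimately show ?thesis
      using prob_eq_0 by blast
  qed
  finally show ?thesis by (simp add: undetermined_prob_def[abs_def])
qed

lemma (in prob_space) abs_prob_diff_le:
  assumes "A \<in> events" "B \<in> events" "C \<in> events" "A \<subseteq> B \<union> C" "B \<subseteq> A \<union> C"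
  shows "\<bar>prob A - prob B\<bar> \<le> prob C"
proof -
  have "prob A \<le> prob B + prob C"
    using assms by (intro order.trans[OF finite_measure_mono measure_Un_le]) auto
  moreover have "prob B \<le> prob A + prob C"
    using assms by (intro order.trans[OF finite_measure_mono measure_Un_le]) auto
  ultimately show ?thesis by linarith
qed

text \<open>Coupling inequality: built from the same numbers, the two configurations can differ on
  \<open>K\<close> only where depth \<open>t\<close> leaves a site of \<open>K\<close> undetermined.
  The bound does not involve \<open>x\<close>, hence uniformity. \<open>A\<close> is any event over
  \<open>K\<close> because uniqueness is checked on the rectangles that generate the
  sigma-algebra.\<close>

lemma kernel_pow_approx:
  assumes K: "finite K" and A: "A \<in> sets config_space"
    and loc: "\<And>x y. (\<And>k. k \<in> K \<Longrightarrow> x k = y k) \<Longrightarrow> x \<in> A \<Longrightarrow> y \<in> A"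
  shows "\<bar>measure (kernel_pow (pca nb \<phi>) t x) A - measure (pca_limit nb \<phi>) A\<bar> \<le> undetermined_prob nb \<phi> K t"
proof -
  let ?X = "\<lambda>U k. xval nb \<phi> U x t (k, 0)" and ?Y = "\<lambda>U k. lim_val nb \<phi> U (k, 0)"
  interpret prob_space "site_source :: ((int ^ 'd) \<times> nat \<Rightarrow> real) measure"
    by (rule prob_space_site_source)
  have eq: "?X U k = ?Y U k" if "kval nb \<phi> U t (k, 0) \<noteq> None" for U k
    using that by (auto dest: kval_xval lim_val_eq)
  have "\<bar>prob (?X -` A \<inter> space site_source) - prob (?Y -` A \<inter> space site_source)\<bar>
      \<le> prob {U. \<exists>k\<in>K. kval nb \<phi> U t (k, 0) = None}"
  proof (rule abs_prob_diff_le)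
    show "?X -` A \<inter> space site_source \<in> events" "?Y -` A \<inter> space site_source \<in> events"
      by (rule measurable_sets[OF measurable_xval_config A] measurable_sets[OF measurable_lim_config A])+
    show "{U. \<exists>k\<in>K. kval nb \<phi> U t (k, 0) = None} \<in> events"
      by (rule sets_undetermined[OF K])
    show "?X -` A \<inter> space site_source \<subseteq> ?Y -` A \<inter> space site_source \<union> {U. \<exists>k\<in>K. kval nb \<phi> U t (k, 0) = None}"
      using loc[of "?X _" "?Y _"] eq by (auto simp del: not_None_eq) metis
    show "?Y -` A \<inter> space site_source \<subseteq> ?X -` A \<inter> space site_source \<union> {U. \<exists>k\<in>K. kval nb \<phi> U t (k, 0) = None}"
      using loc[of "?Y _" "?X _"] eq by (auto simp del: not_None_eq)
  qed
  then show ?thesis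
    by (simp add: kernel_pow_eq_distr pca_limit_def undetermined_prob_def
        measure_distr[OF measurable_xval_config A] measure_distr[OF measurable_lim_config A])
qed

lemma sets_cyl: "finite K \<Longrightarrow> cyl K u \<in> sets config_space"
proof -
  assume "finite K"
  moreover have "cyl K u = prod_emb UNIV (\<lambda>_. count_space UNIV) K (Pi\<^sub>E K (\<lambda>k. {u k}))"
    by (auto simp: cyl_def prod_emb_def PiE_iff)
  ultimately show ?thesis by (auto simp: config_space_def intro!: sets_PiM_I)
qed

lemma measurable_kernel_pow: "kernel_pow (pca nb \<phi>) t \<in> config_space \<rightarrow>\<^sub>M prob_algebra config_space"
proof (induction t)
  case (Suc t)
  have "kernel_pow (pca nb \<phi>) (Suc t) = (\<lambda>x. kernel_pow (pca nb \<phi>) t x \<bind> pca nb \<phi>)"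
    by (simp add: fun_eq_iff)
  then show ?case using measurable_bind_prob_space[OF Suc measurable_pca] by simp
qed (simp add: measurable_return_prob_space cong: measurable_cong)

lemma bind_kernel_pow:
  assumes "invariant_measure (pca nb \<phi>) \<pi>"
  shows "\<pi> \<bind> kernel_pow (pca nb \<phi>) t = \<pi>"
proof (induction t)
  case 0
  then show ?case
    using assms by (simp add: invariant_measure_def bind_return'' cong: bind_cong)
next
  case (Suc t)
  have sets: "sets \<pi> = sets config_space" using assms by (simp add: invariant_measure_def)
  have m: "kernel_pow (pca nb \<phi>) t \<in> \<pi> \<rightarrow>\<^sub>M subprob_algebra config_space"
    using measurable_prob_algebraD[OF measurable_kernel_pow] sets by (simp cong: measurable_cong_sets)
  have "kernel_pow (pca nb \<phi>) (Suc t) = (\<lambda>x. kernel_pow (pca nb \<phi>) t x \<bind> pca nb \<phi>)"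
    by (simp add: fun_eq_iff)
  then have "\<pi> \<bind> kernel_pow (pca nb \<phi>) (Suc t) = \<pi> \<bind> (\<lambda>x. kernel_pow (pca nb \<phi>) t x \<bind> pca nb \<phi>)"
    by (simp only:)
  also have "\<dots> = (\<pi> \<bind> kernel_pow (pca nb \<phi>) t) \<bind> pca nb \<phi>"
    by (rule bind_assoc[OF m measurable_prob_algebraD[OF measurable_pca], symmetric])
  also have "\<dots> = \<pi>" using Suc assms by (simp add: invariant_measure_def)
  finally show ?case .
qed

text \<open>An invariant measure is the mixture of the \<open>t\<close>-step laws over its own
  configurations. Each of these laws is within \<open>undetermined_prob\<close> of the limit, the
  mixture inherits the bound, and \<open>t\<close> tends to infinity.\<close>

lemma invariant_measure_unique:
  fixes nb :: "'m::finite \<Rightarrow> int ^ 'd::finite" and \<phi> :: "('m \<Rightarrow> 's::finite) \<Rightarrow> 's pmf"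
  assumes p: "p_unknown \<phi> < p_crit nb" and inv: "invariant_measure (pca nb \<phi>) \<pi>"
  shows "\<pi> = pca_limit nb \<phi>"
proof -
  have sets: "sets \<pi> = sets config_space" using inv by (simp add: invariant_measure_def)
  interpret \<pi>: prob_space \<pi> using inv by (simp add: invariant_measure_def)
  interpret L: prob_space "pca_limit nb \<phi>" by (rule prob_space_pca_limit)
  have eq: "measure \<pi> A = measure (pca_limit nb \<phi>) A"
    if K: "finite K" and A: "A \<in> sets config_space"
      and loc: "\<And>x y. (\<And>k. k \<in> K \<Longrightarrow> x k = y k) \<Longrightarrow> x \<in> A \<Longrightarrow> y \<in> A" for K A
  proof -
    have bound: "\<bar>measure \<pi> A - measure (pca_limit nb \<phi>) A\<bar> \<le> undetermined_prob nb \<phi> K t" for t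
    proof -
      let ?f = "\<lambda>x. measure (kernel_pow (pca nb \<phi>) t x) A"
      have m: "kernel_pow (pca nb \<phi>) t \<in> \<pi> \<rightarrow>\<^sub>M subprob_algebra config_space"
        using measurable_prob_algebraD[OF measurable_kernel_pow] sets by (simp cong: measurable_cong_sets)
      have "measure \<pi> A = measure (\<pi> \<bind> kernel_pow (pca nb \<phi>) t) A"
        by (simp add: bind_kernel_pow[OF inv])
      also have "\<dots> = (\<integral>x. ?f x \<partial>\<pi>)"
        by (rule \<pi>.measure_bind[OF m A])
      finally have 1: "measure \<pi> A = (\<integral>x. ?f x \<partial>\<pi>)" .
      have *: "\<bar>?f x - measure (pca_limit nb \<phi>) A\<bar> \<le> undetermined_prob nb \<phi> K t" for x
        by (rule kernel_pow_approx[OF K A loc])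
      have "?f \<in> borel_measurable \<pi>"
        by (rule measurable_compose[OF m measurable_measure_subprob_algebra[OF A]])
      moreover have "norm (?f x) \<le> 1" for x
        by (simp add: kernel_pow_eq_distr prob_space.prob_le_1 prob_space.prob_space_distr[OF prob_space_site_source measurable_xval_config])
      ultimately have int: "integrable \<pi> ?f"
        by (intro \<pi>.integrable_const_bound[where B = 1]) auto
      have "(\<integral>x. ?f x \<partial>\<pi>) \<le> measure (pca_limit nb \<phi>) A + undetermined_prob nb \<phi> K t"
        using * by (intro \<pi>.integral_le_const[OF int] AE_I2) (smt (verit))
      moreover have "(\<integral>x. ?f x \<partial>\<pi>) \<ge> measure (pca_limit nb \<phi>) A - undetermined_prob nb \<phi> K t"
        using * by (intro \<pi>.integral_ge_const[OF int] AE_I2) (smt (verit))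
      ultimately show ?thesis unfolding 1 by linarith
    qed
    have "\<bar>measure \<pi> A - measure (pca_limit nb \<phi>) A\<bar> \<le> 0"
      by (rule LIMSEQ_le_const[OF tendsto_undetermined_prob[OF p K]]) (use bound in auto)
    then show ?thesis by simp
  qed
  show ?thesis
  proof (rule measure_eqI_PiM_infinite)
    show "sets \<pi> = sets (PiM UNIV (\<lambda>_. count_space UNIV))"
      "sets (pca_limit nb \<phi>) = sets (PiM UNIV (\<lambda>_. count_space UNIV))"
      using sets by (simp_all add: config_space_def)
    show "finite_measure \<pi>" by (rule \<pi>.finite_measure_axioms)
    fix A :: "int ^ 'd \<Rightarrow> 's set" and J :: "(int ^ 'd) set"
    assume J: "finite J"
    let ?E = "prod_emb UNIV (\<lambda>_. count_space UNIV) J (Pi\<^sub>E J A)"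
    have "measure \<pi> ?E = measure (pca_limit nb \<phi>) ?E"
    proof (rule eq[OF J])
      show "?E \<in> sets config_space"
        using J by (auto simp: config_space_def intro!: sets_PiM_I)
    qed (auto simp: prod_emb_def PiE_iff)
    then show "emeasure \<pi> ?E = emeasure (pca_limit nb \<phi>) ?E"
      by (simp add: \<pi>.emeasure_eq_measure L.emeasure_eq_measure)
  qed
qed

lemma uniformly_ergodic_pca:
  fixes nb :: "'m::finite \<Rightarrow> int ^ 'd::finite" and \<phi> :: "('m \<Rightarrow> 's::finite) \<Rightarrow> 's pmf"
  assumes "p_unknown \<phi> < p_crit nb"
  shows "uniformly_ergodic (pca nb \<phi>)"
  unfolding uniformly_ergodic_def
proof (intro exI conjI allI impI)
  show "invariant_measure (pca nb \<phi>) (pca_limit nb \<phi>)"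
    by (rule invariant_pca_limit[OF assms])
  show "\<pi>' = pca_limit nb \<phi>" if "invariant_measure (pca nb \<phi>) \<pi>'" for \<pi>'
    using assms that by (rule invariant_measure_unique)
  fix K :: "(int ^ 'd) set" and u :: "('d, 's) config"
  assume K: "finite K"
  show "uniform_limit UNIV (\<lambda>t x. measure (kernel_pow (pca nb \<phi>) t x) (cyl K u))
      (\<lambda>_. measure (pca_limit nb \<phi>) (cyl K u)) sequentially"
  proof (rule uniform_limitI)
    fix e :: real assume "e > 0"
    then have "\<forall>\<^sub>F t in sequentially. undetermined_prob nb \<phi> K t < e"
      using order_tendstoD(2)[OF tendsto_undetermined_prob[OF assms K]] by simp
    then show "\<forall>\<^sub>F t in sequentially. \<forall>x\<in>UNIV.
        dist (measure (kernel_pow (pca nb \<phi>) t x) (cyl K u)) (measure (pca_limit nb \<phi>) (cyl K u)) < e"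
    proof eventually_elim
      case (elim t)
      have "\<bar>measure (kernel_pow (pca nb \<phi>) t x) (cyl K u) - measure (pca_limit nb \<phi>) (cyl K u)\<bar>
          \<le> undetermined_prob nb \<phi> K t" for x
        by (rule kernel_pow_approx[OF K sets_cyl[OF K]]) (auto simp: cyl_def)
      with elim show ?case by (auto simp: dist_real_def intro: le_less_trans)
    qed
  qed
qed


section \<open>Independence of remote sites and spatial mixing\<close>

definition depends_on :: "'v set \<Rightarrow> ('v \<Rightarrow> 'a) set \<Rightarrow> bool" where
  "depends_on D P \<longleftrightarrow> (\<forall>U U'. (\<forall>v\<in>D. U v = U' v) \<longrightarrow> U \<in> P \<longrightarrow> U' \<in> P)"

lemma depends_onD: "depends_on D P \<Longrightarrow> (\<And>v. v \<in> D \<Longrightarrow> U v = U' v) \<Longrightarrow> U \<in> P \<longleftrightarrow> U' \<in> P"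
  unfolding depends_on_def by metis

lemma measure_Int_depends_on:
  fixes P Q :: "((int ^ 'd::finite) \<times> nat \<Rightarrow> real) set"
  assumes P: "depends_on D P" "P \<in> sets site_source" and Q: "depends_on E Q" "Q \<in> sets site_source"
    and DE: "D \<inter> E = {}"
  shows "measure site_source (P \<inter> Q) = measure site_source P * measure site_source Q"
proof -
  interpret prob_space "site_source :: ((int ^ 'd) \<times> nat \<Rightarrow> real) measure"
    by (rule prob_space_site_source)
  have X: "(\<lambda>U. U v) \<in> site_source \<rightarrow>\<^sub>M unif" for v :: "(int ^ 'd) \<times> nat"
    using measurable_site by (simp cong: measurable_cong_sets)
  have "distr site_source unif (\<lambda>U. U v) = unif" for v :: "(int ^ 'd) \<times> nat"
    unfolding site_source_def by (rule distr_PiM_component) (auto intro: prob_space_unif)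
  then have ind: "indep_vars (\<lambda>_. unif) (\<lambda>v U. U v) (UNIV :: ((int ^ 'd) \<times> nat) set)"
    by (subst indep_vars_iff_distr_eq_PiM'[OF _ X])
      (simp_all add: site_source_def[symmetric] distr_id2 restrict_def)
  \<comment> \<open>Independence is available for restrictions, that is, for events on partial
    fields. Filling up with 0 turns a partial field into a full one, and an event that depends on
    \<open>A\<close> alone does not notice the filling.\<close>
  define ext :: "((int ^ 'd) \<times> nat) set \<Rightarrow> ((int ^ 'd) \<times> nat \<Rightarrow> real) \<Rightarrow> (int ^ 'd) \<times> nat \<Rightarrow> real"
    where "ext = (\<lambda>A w v. if v \<in> A then w v else 0)"
  have ext: "ext A \<in> PiM A (\<lambda>_. unif) \<rightarrow>\<^sub>M site_source" for A
    unfolding site_source_def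
  proof (rule measurable_PiM_single')
    fix v
    show "(\<lambda>w. ext A w v) \<in> PiM A (\<lambda>_. unif) \<rightarrow>\<^sub>M unif"
      unfolding ext_def by (cases "v \<in> A") auto
  qed auto
  let ?P = "ext D -` P \<inter> space (PiM D (\<lambda>_. unif))" and ?Q = "ext E -` Q \<inter> space (PiM E (\<lambda>_. unif))"
  have restrict_space: "restrict U A \<in> space (PiM A (\<lambda>_. unif))"
    for U and A :: "((int ^ 'd) \<times> nat) set"
    by (simp add: space_PiM)
  have P_iff: "restrict U D \<in> ?P \<longleftrightarrow> U \<in> P" for U
    using depends_onD[OF P(1), of "ext D (restrict U D)" U] restrict_space by (simp add: ext_def)
  have Q_iff: "restrict U E \<in> ?Q \<longleftrightarrow> U \<in> Q" for U
    using depends_onD[OF Q(1), of "ext E (restrict U E)" U] restrict_space by (simp add: ext_def)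
  have "prob ((\<lambda>U. (restrict (\<lambda>i. U i) D, restrict (\<lambda>i. U i) E)) -` (?P \<times> ?Q) \<inter> space site_source)
    = prob ((\<lambda>U. restrict (\<lambda>i. U i) D) -` ?P \<inter> space site_source)
      * prob ((\<lambda>U. restrict (\<lambda>i. U i) E) -` ?Q \<inter> space site_source)"
    using measurable_sets[OF ext P(2)] measurable_sets[OF ext Q(2)]
    by (intro indep_varD[OF indep_var_restrict[OF ind DE]]) auto
  moreover have "(\<lambda>U. (restrict (\<lambda>i. U i) D, restrict (\<lambda>i. U i) E)) -` (?P \<times> ?Q) = P \<inter> Q"
    using P_iff Q_iff by blast
  moreover have "(\<lambda>U. restrict (\<lambda>i. U i) D) -` ?P = P" "(\<lambda>U. restrict (\<lambda>i. U i) E) -` ?Q = Q"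
    using P_iff Q_iff by blast+
  ultimately show ?thesis by simp
qed

lemma measure_site_source_translate:
  fixes P :: "((int ^ 'd::finite) \<times> nat \<Rightarrow> real) set"
  assumes "P \<in> sets site_source"
  shows "measure site_source {U. (\<lambda>v. U (fst v + z, snd v)) \<in> P} = measure site_source P"
proof -
  have inj: "inj (\<lambda>v :: (int ^ 'd) \<times> nat. (fst v + z, snd v))"
    by (auto simp: inj_on_def prod_eq_iff)
  have m: "(\<lambda>U v. U (fst v + z, snd v)) \<in> site_source \<rightarrow>\<^sub>M (site_source :: ((int ^ 'd) \<times> nat \<Rightarrow> real) measure)"
    by (subst (2) site_source_def, intro measurable_PiM_single')
      (auto intro: measurable_site simp: measurable_cong_sets[OF refl sets_unif])
  show ?thesis
    using measure_distr[OF m assms] unfolding distr_site_source_shift[OF inj]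
    by (simp add: vimage_def)
qed

text \<open>A finite-range stand-in for \<open>lim_event\<close>: for finite \<open>K\<close> it
  reads finitely many numbers, and it differs from the limit event only where some site is
  undetermined at depth \<open>t\<close>.\<close>

definition known_event ::
  "('m::finite \<Rightarrow> int ^ 'd::finite) \<Rightarrow> (('m \<Rightarrow> 's::finite) \<Rightarrow> 's pmf) \<Rightarrow> nat
    \<Rightarrow> (int ^ 'd) set \<Rightarrow> ('d, 's) config \<Rightarrow> ((int ^ 'd) \<times> nat \<Rightarrow> real) set" where
  "known_event nb \<phi> t K u = {U. \<forall>k\<in>K. kval nb \<phi> U t (k, 0) = Some (u k)}"

definition lim_event ::
  "('m::finite \<Rightarrow> int ^ 'd::finite) \<Rightarrow> (('m \<Rightarrow> 's::finite) \<Rightarrow> 's pmf)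
    \<Rightarrow> (int ^ 'd) set \<Rightarrow> ('d, 's) config \<Rightarrow> ((int ^ 'd) \<times> nat \<Rightarrow> real) set" where
  "lim_event nb \<phi> K u = {U. \<forall>k\<in>K. lim_val nb \<phi> U (k, 0) = u k}"

lemma sets_known_event: "finite K \<Longrightarrow> known_event nb \<phi> t K u \<in> sets site_source"
proof -
  assume "finite K"
  then have "space site_source \<inter> (\<Inter>k\<in>K. {U. kval nb \<phi> U t (k, 0) = Some (u k)}) \<in> sets site_source"
    using sets.top[of site_source]
    by (cases "K = {}") (auto intro!: sets.finite_INT sets_kval_Collect)
  then show ?thesis by (simp add: known_event_def INT_iff[abs_def] Collect_ball_eq)
qed

lemma sets_lim_event: "finite K \<Longrightarrow> lim_event nb \<phi> K u \<in> sets site_source"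
proof -
  assume "finite K"
  then have "space site_source \<inter> (\<Inter>k\<in>K. {U. lim_val nb \<phi> U (k, 0) = u k}) \<in> sets site_source"
    using sets.top[of site_source]
    by (cases "K = {}") (auto intro!: sets.finite_INT sets_lim_val_Collect)
  then show ?thesis by (simp add: lim_event_def Collect_ball_eq)
qed

lemma lim_event_approx:
  "known_event nb \<phi> t K u \<subseteq> lim_event nb \<phi> K u"
  "lim_event nb \<phi> K u \<subseteq> known_event nb \<phi> t K u \<union> {U. \<exists>k\<in>K. kval nb \<phi> U t (k, 0) = None}"
  by (auto simp: known_event_def lim_event_def lim_val_eq) (metis lim_val_eq option.exhaust)

lemma measure_pca_limit_cyl:
  assumes "finite K"
  shows "measure (pca_limit nb \<phi>) (cyl K u) = measure site_source (lim_event nb \<phi> K u)"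
  unfolding pca_limit_def
  by (subst measure_distr[OF measurable_lim_config sets_cyl[OF assms]])
    (simp add: lim_event_def cyl_def vimage_def)

lemma depends_on_known_event:
  "depends_on (\<Union>k\<in>K. reach nb t (k, 0)) (known_event nb \<phi> t K u)"
  unfolding depends_on_def
proof (intro allI impI)
  fix U U'
  assume eq: "\<forall>v\<in>\<Union>k\<in>K. reach nb t (k, 0). U v = U' v" and U: "U \<in> known_event nb \<phi> t K u"
  have "kval nb \<phi> U t (k, 0) = kval nb \<phi> U' t (k, 0)" if "k \<in> K" for k
    by (rule kval_cong) (use eq that in auto)
  with U show "U' \<in> known_event nb \<phi> t K u" by (simp add: known_event_def)
qed

lemma known_event_translate:
  "(\<lambda>v. U (fst v + z, snd v)) \<in> known_event nb \<phi> t L u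
    \<longleftrightarrow> U \<in> known_event nb \<phi> t ((+) z ` L) (\<lambda>k. u (k - z))"
proof -
  have "kval nb \<phi> (\<lambda>v. U (fst v + z, snd v)) t (k, 0) = kval nb \<phi> U t (z + k, 0)" for k
    using kval_shift[of "\<lambda>v. U (fst v + z, snd v)" U z 0 nb \<phi> t "(k, 0)"] by (simp add: add_ac)
  then show ?thesis by (simp add: known_event_def)
qed

lemma undetermined_prob_translate:
  assumes "finite L"
  shows "undetermined_prob nb \<phi> ((+) z ` L) t = undetermined_prob nb \<phi> L t"
proof -
  have "kval nb \<phi> (\<lambda>v. U (fst v + z, snd v)) t (k, 0) = kval nb \<phi> U t (z + k, 0)" for k U
    using kval_shift[of "\<lambda>v. U (fst v + z, snd v)" U z 0 nb \<phi> t "(k, 0)"] by (simp add: add_ac)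
  then show ?thesis
    using measure_site_source_translate[OF sets_undetermined[OF assms], of z nb \<phi> t]
    by (simp add: undetermined_prob_def)
qed

text \<open>At fixed \<open>t\<close> the finite-range events at remote sites are exactly
  independent. By \<open>undetermined_prob_translate\<close> the error of the replacement is the
  same for all translations, so the translation may go to infinity before \<open>t\<close>
  does.\<close>

lemma spatially_mixing_pca_limit:
  fixes nb :: "'m::finite \<Rightarrow> int ^ 'd::finite" and \<phi> :: "('m \<Rightarrow> 's::finite) \<Rightarrow> 's pmf"
  assumes "p_unknown \<phi> < p_crit nb"
  shows "spatially_mixing (pca_limit nb \<phi>)"
  unfolding spatially_mixing_def
proof (intro allI impI)
  fix K L :: "(int ^ 'd) set" and u v :: "('d, 's) config"
  assume K: "finite K" and L: "finite L"
  interpret S: prob_space "site_source :: ((int ^ 'd) \<times> nat \<Rightarrow> real) measure"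
    by (rule prob_space_site_source)
  let ?Lz = "\<lambda>z. (+) z ` L" and ?vz = "\<lambda>z k. v (k - z)"
  let ?A = "lim_event nb \<phi> K u" and ?B = "lim_event nb \<phi> L v"
  let ?Bz = "\<lambda>z. lim_event nb \<phi> (?Lz z) (?vz z)"
  let ?e = "\<lambda>t. undetermined_prob nb \<phi> K t + undetermined_prob nb \<phi> L t"
  have "cyl K u \<inter> shift z -` cyl L v = cyl K u \<inter> cyl (?Lz z) (?vz z)" for z
    by (auto simp: cyl_def shift_def)
  moreover have "measure (pca_limit nb \<phi>) (cyl K u \<inter> cyl (?Lz z) (?vz z)) = S.prob (?A \<inter> ?Bz z)" for z
    unfolding pca_limit_def
    by (subst measure_distr[OF measurable_lim_config sets.Int[OF sets_cyl sets_cyl]])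
      (use K L in \<open>auto simp: lim_event_def cyl_def vimage_def intro!: arg_cong[where f = "S.prob"]\<close>)
  ultimately have lhs: "measure (pca_limit nb \<phi>) (cyl K u \<inter> shift z -` cyl L v) = S.prob (?A \<inter> ?Bz z)" for z
    by simp
  have e: "?e \<longlonglongrightarrow> 0"
    using tendsto_add[OF tendsto_undetermined_prob[OF assms K] tendsto_undetermined_prob[OF assms L]] by simp
  have approx: "\<bar>S.prob (lim_event nb \<phi> M w) - S.prob (known_event nb \<phi> t M w)\<bar> \<le> undetermined_prob nb \<phi> M t"
    if "finite M" for M w t
    unfolding undetermined_prob_def
    using lim_event_approx[where nb = nb and \<phi> = \<phi> and t = t and K = M and u = w] that
    by (intro S.abs_prob_diff_le sets_lim_event sets_known_event sets_undetermined) auto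
  \<comment> \<open>One \<open>?e t\<close> pays for replacing the events in the intersection, the
    other for replacing them in the product.\<close>
  have main: "\<forall>\<^sub>F z in cofinite. \<bar>S.prob (?A \<inter> ?Bz z) - S.prob ?A * S.prob ?B\<bar> \<le> 2 * ?e t" for t
  proof -
    let ?D = "\<Union>k\<in>K. reach nb t (k, 0)" and ?E = "\<lambda>z. \<Union>k\<in>?Lz z. reach nb t (k, 0)"
    let ?At = "known_event nb \<phi> t K u" and ?Bt = "known_event nb \<phi> t L v"
    let ?Bzt = "\<lambda>z. known_event nb \<phi> t (?Lz z) (?vz z)"
    have E: "(fst w - z, snd w) \<in> ?E 0" if w: "w \<in> ?E z" for w z
    proof -
      from w obtain l where l: "l \<in> L" "w \<in> reach nb t (z + l, 0)" by auto
      then have "(fst w - z, snd w) \<in> reach nb t (l, 0)"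
        using reach_shift[of w nb t "(l, 0)" z] by (simp add: add_ac)
      with l(1) show ?thesis by auto
    qed
    \<comment> \<open>A vertex common to both cones, moved back by \<open>z\<close> into the cone of
      \<open>L\<close>, shows \<open>z\<close> to be one of finitely many differences of
      sites.\<close>
    have fin: "finite ((\<lambda>(a, b). fst a - fst b) ` (?D \<times> ?E 0))"
      using K L by (intro finite_imageI finite_cartesian_product finite_UN_I finite_reach) auto
    have "z \<in> (\<lambda>(a, b). fst a - fst b) ` (?D \<times> ?E 0)" if "?D \<inter> ?E z \<noteq> {}" for z
    proof -
      from that obtain w where w: "w \<in> ?D" "w \<in> ?E z" by blast
      show ?thesis
        by (rule image_eqI[of _ _ "(w, (fst w - z, snd w))"]) (use w(1) E[OF w(2)] in auto)
    qed
    then have "{z. ?D \<inter> ?E z \<noteq> {}} \<subseteq> (\<lambda>(a, b). fst a - fst b) ` (?D \<times> ?E 0)"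
      by blast
    with fin have "\<forall>\<^sub>F z in cofinite. ?D \<inter> ?E z = {}"
      unfolding eventually_cofinite by (rule rev_finite_subset)
    then show ?thesis
    proof eventually_elim
      case (elim z)
      have fin: "finite (?Lz z)" using L by simp
      have "S.prob (?At \<inter> ?Bzt z) = S.prob ?At * S.prob (?Bzt z)"
        by (rule measure_Int_depends_on[OF depends_on_known_event sets_known_event[OF K]
              depends_on_known_event sets_known_event[OF fin] elim])
      also have "S.prob (?Bzt z) = S.prob ?Bt"
        using measure_site_source_translate[OF sets_known_event[OF L], of z nb \<phi> t v]
        by (simp only: known_event_translate) simp
      finally have prod: "S.prob (?At \<inter> ?Bzt z) = S.prob ?At * S.prob ?Bt" .
      let ?U = "\<lambda>M. {U. \<exists>k\<in>M. kval nb \<phi> U t (k, 0) = None}"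
      have "\<bar>S.prob (?A \<inter> ?Bz z) - S.prob (?At \<inter> ?Bzt z)\<bar> \<le> S.prob (?U K \<union> ?U (?Lz z))"
        using lim_event_approx[where nb = nb and \<phi> = \<phi> and t = t and K = K and u = u] lim_event_approx[where nb = nb and \<phi> = \<phi> and t = t and K = "?Lz z" and u = "?vz z"] K fin
        by (intro S.abs_prob_diff_le sets.Int sets.Un sets_lim_event sets_known_event sets_undetermined) blast+
      also have "\<dots> \<le> S.prob (?U K) + S.prob (?U (?Lz z))"
        using K fin by (intro measure_Un_le sets_undetermined)
      also have "\<dots> = ?e t"
        using undetermined_prob_translate[OF L, of nb \<phi> z t] by (simp add: undetermined_prob_def)
      finally have 1: "\<bar>S.prob (?A \<inter> ?Bz z) - S.prob ?At * S.prob ?Bt\<bar> \<le> ?e t"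
        by (simp add: prod)
      have "\<bar>S.prob ?At * S.prob ?Bt - S.prob ?A * S.prob ?B\<bar>
          \<le> \<bar>S.prob ?At - S.prob ?A\<bar> * S.prob ?Bt + S.prob ?A * \<bar>S.prob ?Bt - S.prob ?B\<bar>"
      proof -
        have "S.prob ?At * S.prob ?Bt - S.prob ?A * S.prob ?B
            = (S.prob ?At - S.prob ?A) * S.prob ?Bt + S.prob ?A * (S.prob ?Bt - S.prob ?B)"
          by (simp add: algebra_simps)
        then show ?thesis
          by (simp only:) (rule order.trans[OF abs_triangle_ineq], simp add: abs_mult)
      qed
      also have "\<dots> \<le> \<bar>S.prob ?At - S.prob ?A\<bar> * 1 + 1 * \<bar>S.prob ?Bt - S.prob ?B\<bar>"
        by (intro add_mono mult_mono) auto
      also have "\<dots> \<le> ?e t"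
        using approx[OF K, of u t] approx[OF L, of v t] by (simp add: abs_minus_commute)
      finally show ?case
        using 1 dist_triangle[of "S.prob (?A \<inter> ?Bz z)" "S.prob ?A * S.prob ?B" "S.prob ?At * S.prob ?Bt"]
        by (simp add: dist_real_def)
    qed
  qed
  have "((\<lambda>z. S.prob (?A \<inter> ?Bz z)) \<longlongrightarrow> S.prob ?A * S.prob ?B) cofinite"
  proof (rule tendstoI)
    fix r :: real assume "r > 0"
    then have "\<forall>\<^sub>F t in sequentially. ?e t < r / 2"
      by (intro order_tendstoD(2)[OF e]) simp
    then obtain t where "?e t < r / 2" by (auto simp: eventually_sequentially)
    then have t: "2 * ?e t < r" by simp
    show "\<forall>\<^sub>F z in cofinite. dist (S.prob (?A \<inter> ?Bz z)) (S.prob ?A * S.prob ?B) < r"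
      using main[of t] by (rule eventually_mono) (use t in \<open>simp add: dist_real_def\<close>)
  qed
  then show "((\<lambda>z. measure (pca_limit nb \<phi>) (cyl K u \<inter> shift z -` cyl L v))
      \<longlongrightarrow> measure (pca_limit nb \<phi>) (cyl K u) * measure (pca_limit nb \<phi>) (cyl L v)) cofinite"
    by (simp add: lhs measure_pca_limit_cyl K L)
qed

section \<open>Straight-line programs\<close>

primrec straight :: "('m, 's) com \<Rightarrow> bool" where
  "straight Skip \<longleftrightarrow> True"
| "straight (IAssign e f) \<longleftrightarrow> True"
| "straight (RAssign e r) \<longleftrightarrow> True"
| "straight (Sample e) \<longleftrightarrow> True"
| "straight (Seq c c') \<longleftrightarrow> straight c \<and> straight c'"
| "straight (Cond b c c') \<longleftrightarrow> straight c \<and> straight c'"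
| "straight (While b c) \<longleftrightarrow> False"

primrec run :: "(('m \<Rightarrow> 's) \<Rightarrow> 's pmf) \<Rightarrow> (nat \<Rightarrow> real) \<Rightarrow> ('m, 's) com \<Rightarrow> store \<Rightarrow> store" where
  "run \<phi> U Skip s = s"
| "run \<phi> U (IAssign e f) s = s\<lparr>imem := (imem s)(ival e s := ival f s)\<rparr>"
| "run \<phi> U (RAssign e r) s = s\<lparr>rmem := (rmem s)(ival e s := rval \<phi> r s)\<rparr>"
| "run \<phi> U (Sample e) s = s\<lparr>rmem := (rmem s)(ival e s := U (drawn s)), drawn := Suc (drawn s)\<rparr>"
| "run \<phi> U (Seq c c') s = run \<phi> U c' (run \<phi> U c s)"
| "run \<phi> U (Cond b c c') s = (if bval \<phi> b s then run \<phi> U c s else run \<phi> U c' s)"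
| "run \<phi> U (While b c) s = s"

inductive_cases exec_SkipE: "exec \<phi> U Skip s s'"
  and exec_IAssignE: "exec \<phi> U (IAssign e f) s s'"
  and exec_RAssignE: "exec \<phi> U (RAssign e r) s s'"
  and exec_SampleE: "exec \<phi> U (Sample e) s s'"
  and exec_SeqE: "exec \<phi> U (Seq c c') s s'"
  and exec_CondE: "exec \<phi> U (Cond b c c') s s'"
  and exec_WhileE: "exec \<phi> U (While b c) s s'"

text \<open>Without loops, execution is total and deterministic, which turns the relation into a
  function that can be iterated and rewritten.\<close>

lemma exec_straight: "straight c \<Longrightarrow> exec \<phi> U c s s' \<longleftrightarrow> s' = run \<phi> U c s"
proof (induction c arbitrary: s s')
  case Skip
  then show ?case by (auto intro: exec_Skip elim: exec_SkipE)
next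
  case (IAssign e f)
  then show ?case by (auto intro: exec_IAssign elim: exec_IAssignE)
next
  case (RAssign e r)
  then show ?case by (auto intro: exec_RAssign elim: exec_RAssignE)
next
  case (Sample e)
  then show ?case by (auto intro: exec_Sample elim: exec_SampleE)
next
  case (Seq c c')
  then show ?case by (auto intro: exec_Seq elim!: exec_SeqE)
next
  case (Cond b c c')
  then show ?case by (auto intro: exec_CondT exec_CondF elim!: exec_CondE)
qed simp

text \<open>\<open>n\<close> is the first index at which the test fails along the orbit of the body.
  The sampling program has only one loop, so the analysis of its runs passes through here.\<close>

lemma exec_While_straight:
  assumes c: "straight c"
  shows "exec \<phi> U (While b c) s s' \<longleftrightarrow>
    (\<exists>n. s' = (run \<phi> U c ^^ n) s \<and> \<not> bval \<phi> b s' \<and> (\<forall>m<n. bval \<phi> b ((run \<phi> U c ^^ m) s)))"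
    (is "_ \<longleftrightarrow> (\<exists>n. ?P n s s')")
proof
  show "\<exists>n. ?P n s s'" if "exec \<phi> U (While b c) s s'"
    using that
  proof (induction "While b c" s s' rule: exec.induct)
    case (exec_WhileF s)
    then show ?case by (intro exI[of _ 0]) simp
  next
    case (exec_WhileT s s' s'')
    then obtain n where n: "?P n s' s''" by blast
    have s': "s' = run \<phi> U c s" using exec_WhileT(2) exec_straight[OF c] by blast
    have "bval \<phi> b ((run \<phi> U c ^^ m) s)" if "m < Suc n" for m
      using that n exec_WhileT(1) by (cases m) (simp_all add: s' funpow_swap1)
    moreover have "s'' = (run \<phi> U c ^^ Suc n) s"
      using n by (simp add: s' funpow_swap1)
    ultimately show ?case using n by blast
  qed
next
  assume "\<exists>n. ?P n s s'"
  then obtain n where "?P n s s'" by blast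
  then show "exec \<phi> U (While b c) s s'"
  proof (induction n arbitrary: s)
    case 0
    then show ?case by (auto intro: exec_WhileF)
  next
    case (Suc n)
    have "?P n (run \<phi> U c s) s'"
      using Suc.prems by (auto simp: funpow_swap1 dest: spec[of _ "Suc _"])
    then have "exec \<phi> U (While b c) (run \<phi> U c s) s'" by (rule Suc.IH)
    moreover have "bval \<phi> b s" using Suc.prems by (auto dest: spec[of _ 0])
    ultimately show ?case using exec_straight[OF c] by (blast intro: exec_WhileT)
  qed
qed

definition eq_test :: "iexp \<Rightarrow> iexp \<Rightarrow> ('m, 's) bexp" where
  "eq_test e f = BAnd (BNot (ILess e f)) (BNot (ILess f e))"

lemma bval_eq_test [simp]: "bval \<phi> (eq_test e f) s \<longleftrightarrow> ival e s = ival f s"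
  by (auto simp: eq_test_def)

definition conj_test :: "('m, 's) bexp list \<Rightarrow> ('m, 's) bexp" where
  "conj_test bs = foldr BAnd bs (eq_test (IConst 0) (IConst 0))"

lemma bval_conj_test [simp]: "bval \<phi> (conj_test bs) s \<longleftrightarrow> (\<forall>b\<in>set bs. bval \<phi> b s)"
  unfolding conj_test_def by (induction bs) auto

text \<open>Neighbours and neighbour patterns are not values that a store can hold; a case
  distinction over them is unrolled into the program text.\<close>

primrec switch :: "('x \<Rightarrow> ('m, 's) bexp) \<Rightarrow> ('x \<Rightarrow> ('m, 's) com) \<Rightarrow> ('m, 's) com \<Rightarrow> 'x list \<Rightarrow> ('m, 's) com" where
  "switch B C e [] = e"
| "switch B C e (x # xs) = Cond (B x) (C x) (switch B C e xs)"

lemma straight_switch: "(\<And>x. straight (C x)) \<Longrightarrow> straight e \<Longrightarrow> straight (switch B C e xs)"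
  by (induction xs) auto

lemma run_switch_unique:
  "x \<in> set xs \<Longrightarrow> bval \<phi> (B x) s \<Longrightarrow> (\<And>y. y \<in> set xs \<Longrightarrow> bval \<phi> (B y) s \<Longrightarrow> y = x)
    \<Longrightarrow> run \<phi> U (switch B C e xs) s = run \<phi> U (C x) s"
proof (induction xs)
  case (Cons y xs)
  show ?case
  proof (cases "bval \<phi> (B y) s")
    case True
    with Cons.prems(3)[of y] show ?thesis by simp
  next
    case False
    with Cons.prems(1,2) have "x \<in> set xs" by auto
    then have "run \<phi> U (switch B C e xs) s = run \<phi> U (C x) s"
      by (rule Cons.IH[OF _ Cons.prems(2)]) (rule Cons.prems(3), simp)
    with False show ?thesis by simp
  qed
qed simp

lemma run_switch_none:
  "(\<And>y. y \<in> set xs \<Longrightarrow> \<not> bval \<phi> (B y) s) \<Longrightarrow> run \<phi> U (switch B C e xs) s = run \<phi> U e s"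
  by (induction xs) auto

primrec pick_com ::
  "('m, 's) rexp \<Rightarrow> ('s \<Rightarrow> ('m, 's) com) \<Rightarrow> ('m, 's) com \<Rightarrow> (('m, 's) rexp \<times> 's) list
    \<Rightarrow> ('m, 's) rexp \<Rightarrow> ('m, 's) com" where
  "pick_com u C e [] c = e"
| "pick_com u C e (x # xs) c =
    Cond (RLess u (RAdd c (fst x))) (C (snd x)) (pick_com u C e xs (RAdd c (fst x)))"

lemma straight_pick_com: "(\<And>b. straight (C b)) \<Longrightarrow> straight e \<Longrightarrow> straight (pick_com u C e xs c)"
  by (induction xs arbitrary: c) auto

lemma run_pick_com:
  "run \<phi> U (pick_com u C e xs c) s =
    (case pick (map (\<lambda>x. (rval \<phi> (fst x) s, snd x)) xs) (rval \<phi> c s) (rval \<phi> u s) of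
      Some b \<Rightarrow> run \<phi> U (C b) s | None \<Rightarrow> run \<phi> U e s)"
  by (induction xs arbitrary: c) (auto split: option.split)

primrec assigns :: "(nat \<Rightarrow> iexp) \<Rightarrow> (nat \<Rightarrow> iexp) \<Rightarrow> nat list \<Rightarrow> ('m, 's) com" where
  "assigns E X [] = Skip"
| "assigns E X (j # js) = Seq (IAssign (E j) (X j)) (assigns E X js)"

lemma straight_assigns: "straight (assigns E X js)"
  by (induction js) auto

text \<open>\<open>J\<close> describes all target cells and stays fixed while \<open>js\<close>
  shrinks in the induction. Addresses and right-hand sides are constant on stores that agree with
  \<open>s0\<close> off these cells, so they keep their values while part of the cells has already
  been written.\<close>

lemma run_assigns:
  assumes stable: "\<And>s' j. j \<in> set js \<Longrightarrow> (\<forall>b. b \<notin> a ` J \<longrightarrow> imem s' b = imem s0 b)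
      \<Longrightarrow> ival (E j) s' = a j \<and> ival (X j) s' = x j"
    and J: "set js \<subseteq> J" "inj_on a J" "distinct js"
    and s: "\<forall>b. b \<notin> a ` J \<longrightarrow> imem s b = imem s0 b"
  shows "(\<forall>j\<in>set js. imem (run \<phi> U (assigns E X js) s) (a j) = x j)
    \<and> (\<forall>b. b \<notin> a ` set js \<longrightarrow> imem (run \<phi> U (assigns E X js) s) b = imem s b)
    \<and> rmem (run \<phi> U (assigns E X js) s) = rmem s \<and> drawn (run \<phi> U (assigns E X js) s) = drawn s"
  using assms
proof (induction js arbitrary: s)
  case (Cons j js)
  let ?s = "s\<lparr>imem := (imem s)(a j := x j)\<rparr>"
  have ev: "ival (E j) s = a j \<and> ival (X j) s = x j"
    by (rule Cons.prems(1)[OF _ Cons.prems(5)]) simp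
  have aj: "a j \<in> a ` J" using Cons.prems(2) by simp
  have IH: "(\<forall>j\<in>set js. imem (run \<phi> U (assigns E X js) ?s) (a j) = x j)
    \<and> (\<forall>b. b \<notin> a ` set js \<longrightarrow> imem (run \<phi> U (assigns E X js) ?s) b = imem ?s b)
    \<and> rmem (run \<phi> U (assigns E X js) ?s) = rmem ?s \<and> drawn (run \<phi> U (assigns E X js) ?s) = drawn ?s"
  proof (rule Cons.IH)
    show "ival (E j) s' = a j \<and> ival (X j) s' = x j"
      if "j \<in> set js" "\<forall>b. b \<notin> a ` J \<longrightarrow> imem s' b = imem s0 b" for s' j
      by (rule Cons.prems(1)[OF _ that(2)]) (simp add: that(1))
    show "set js \<subseteq> J" "distinct js" using Cons.prems(2,4) by simp_all
    show "\<forall>b. b \<notin> a ` J \<longrightarrow> imem ?s b = imem s0 b"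
      using Cons.prems(5) aj by (metis (no_types, lifting) fun_upd_other store.select_convs(1) store.surjective store.update_convs(1))
  qed (rule Cons.prems(3))
  have j: "a j \<notin> a ` set js"
    using Cons.prems(2,3,4) by (auto dest: inj_onD)
  have r: "run \<phi> U (assigns E X (j # js)) s = run \<phi> U (assigns E X js) ?s"
    by (simp add: ev)
  show ?case unfolding r using IH j by auto
next
  case Nil
  show ?case by simp
qed

text \<open>An injective polynomial numbering of the sites, so that a program can compute it.\<close>

definition fold_int :: "int \<Rightarrow> int" where
  "fold_int z = z * (2 * z + 1)"

primrec site_index :: "int list \<Rightarrow> int \<Rightarrow> int" where
  "site_index [] t = t"
| "site_index (z # zs) t =
    (fold_int z + site_index zs t) * (fold_int z + site_index zs t) + fold_int z"

lemma fold_int_nonneg: "0 \<le> fold_int z"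
  unfolding fold_int_def by (cases "0 \<le> z") (auto intro: mult_nonpos_nonpos)

text \<open>The values \<open>z * (2 * z + 1)\<close> are the triangular numbers, with even index
  for \<open>z \<ge> 0\<close> and odd index for \<open>z < 0\<close>. In the factorised difference
  the second factor is odd, hence nonzero.\<close>

lemma fold_int_inject: "fold_int y = fold_int z \<Longrightarrow> y = z"
proof -
  assume "fold_int y = fold_int z"
  then have "(y - z) * (2 * (y + z) + 1) = 0"
    by (simp add: fold_int_def algebra_simps)
  moreover have "2 * (y + z) + 1 \<noteq> 0" by presburger
  ultimately show ?thesis by simp
qed

lemma site_index_nonneg: "0 \<le> t \<Longrightarrow> 0 \<le> site_index zs t"
  by (cases zs) (simp_all add: fold_int_nonneg)

text \<open>Since \<open>a \<le> b\<close>, the number \<open>b * b + a\<close> lies below the next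
  square, so \<open>b\<close> is its integer square root and \<open>a\<close> the remainder. This
  decodes the pairing in \<open>site_index\<close>, where \<open>b\<close> is a sum with
  \<open>a\<close> as a summand.\<close>

lemma square_plus_inject:
  fixes a b c d :: int
  assumes "0 \<le> a" "a \<le> b" "0 \<le> c" "c \<le> d" "b * b + a = d * d + c"
  shows "b = d \<and> a = c"
proof -
  have *: False if "b < d" "b * b + a = d * d + c" "a \<le> b" "0 \<le> a" "0 \<le> c" for a b c d :: int
  proof -
    have "(b + 1) * (b + 1) \<le> d * d" using that by (intro mult_mono) auto
    then have "b * b + 2 * b + 1 \<le> d * d" by (simp add: algebra_simps)
    with that show False by linarith
  qed
  have "\<not> b < d" using *[of b d a c] assms by blast
  moreover have "\<not> d < b" using *[of d b c a] assms(1,3,4) assms(5)[symmetric] by blast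
  ultimately have "b = d" by simp
  with assms(5) show ?thesis by simp
qed

lemma site_index_inject:
  "length zs = length zs' \<Longrightarrow> 0 \<le> t \<Longrightarrow> 0 \<le> t' \<Longrightarrow> site_index zs t = site_index zs' t'
    \<Longrightarrow> zs = zs' \<and> t = t'"
proof (induction zs zs' rule: list_induct2)
  case (Cons z zs z' zs')
  have "fold_int z + site_index zs t = fold_int z' + site_index zs' t' \<and> fold_int z = fold_int z'"
    using Cons.prems(3)
    by (intro square_plus_inject) (simp_all add: fold_int_nonneg site_index_nonneg Cons.prems)
  then have "fold_int z = fold_int z'" "site_index zs t = site_index zs' t'" by simp_all
  with Cons.IH[OF Cons.prems(1,2)] fold_int_inject[of z z'] show ?case by simp
next
  case Nil
  then show ?case by simp
qed

text \<open>The number of the sample that belongs to \<open>v\<close>. Injectivity suffices for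
  independence; samples at the gaps of the numbering are drawn and never read.\<close>

definition vertex_index :: "'d list \<Rightarrow> (int ^ 'd::finite) \<times> nat \<Rightarrow> nat" where
  "vertex_index cs v = nat (site_index (map (\<lambda>j. fst v $ j) cs) (int (snd v)))"

lemma inj_vertex_index:
  assumes "set cs = UNIV"
  shows "inj (vertex_index cs)"
proof (rule injI)
  fix v w assume "vertex_index cs v = vertex_index cs w"
  then have "site_index (map (\<lambda>j. fst v $ j) cs) (int (snd v)) = site_index (map (\<lambda>j. fst w $ j) cs) (int (snd w))"
    unfolding vertex_index_def by (subst (asm) eq_nat_nat_iff) (auto intro: site_index_nonneg)
  then have "map (\<lambda>j. fst v $ j) cs = map (\<lambda>j. fst w $ j) cs \<and> int (snd v) = int (snd w)"
    by (intro site_index_inject) auto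
  then show "v = w" using assms by (auto simp: prod_eq_iff vec_eq_iff)
qed

definition fold_int_exp :: "iexp \<Rightarrow> iexp" where
  "fold_int_exp e = IMul e (IAdd (IMul (IConst 2) e) (IConst 1))"

primrec site_index_exp :: "iexp list \<Rightarrow> iexp \<Rightarrow> iexp" where
  "site_index_exp [] t = t"
| "site_index_exp (z # zs) t =
    IAdd (IMul (IAdd (fold_int_exp z) (site_index_exp zs t)) (IAdd (fold_int_exp z) (site_index_exp zs t)))
      (fold_int_exp z)"

lemma ival_site_index_exp:
  "ival (site_index_exp zs t) s = site_index (map (\<lambda>z. ival z s) zs) (ival t s)"
  by (induction zs) (auto simp: fold_int_exp_def fold_int_def)

lemma length_enumeration: "length (enumeration :: 'a::finite list) = CARD('a)"
  by (metis distinct_card distinct_enumeration set_enumeration)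

text \<open>The vertices on which the values at the sites \<open>ks\<close> depend, with repetitions, are listed as a
  forest: the roots come first, and the numbers of parent and children are arithmetic functions of
  each other. The test \<open>ks = []\<close> only serves termination.\<close>

function node :: "('m::finite \<Rightarrow> int ^ 'd::finite) \<Rightarrow> (int ^ 'd) list \<Rightarrow> nat \<Rightarrow> (int ^ 'd) \<times> nat" where
  "node nb ks p = (if p < length ks \<or> ks = [] then (ks ! p, 0)
    else child nb (node nb ks ((p - length ks) div CARD('m)))
      (enumeration ! ((p - length ks) mod CARD('m))))"
  by auto
termination
proof (relation "Wellfounded.measure (\<lambda>(nb, ks, p). p)")
  fix nb :: "'m \<Rightarrow> int ^ 'd" and ks :: "(int ^ 'd) list" and p
  assume "\<not> (p < length ks \<or> ks = [])"
  then have "p - length ks < p" by (auto simp: neq_Nil_conv)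
  with div_le_dividend have "(p - length ks) div CARD('m) < p" by (rule le_less_trans)
  then show "((nb, ks, (p - length ks) div CARD('m)), nb, ks, p) \<in> Wellfounded.measure (\<lambda>(nb, ks, p). p)"
    by simp
qed auto

declare node.simps [simp del]

lemma node_root: "p < length ks \<Longrightarrow> node nb ks p = (ks ! p, 0)"
  by (simp add: node.simps)

lemma node_child:
  fixes nb :: "'m::finite \<Rightarrow> int ^ 'd::finite"
  assumes "ks \<noteq> []" "i < CARD('m)"
  shows "node nb ks (length ks + CARD('m) * p + i) = child nb (node nb ks p) (enumeration ! i)"
  using assms by (subst node.simps) simp

section \<open>The sampling program\<close>

lemma nth_concat_map_const:
  assumes "\<And>k. length (f k) = d" "p < length ks" "j < d"
  shows "concat (map f ks) ! (d * p + j) = f (ks ! p) ! j"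
  using assms(2)
proof (induction ks arbitrary: p)
  case (Cons k ks)
  then show ?case using assms(1,3) by (cases p) (auto simp: nth_append)
qed simp

lemma imem_init_store_sites_input:
  assumes "p < length ks" "j < length cs"
  shows "imem (init_store (sites_input cs ks)) (int (1 + length cs * p + j)) = ks ! p $ (cs ! j)"
proof -
  let ?xs = "concat (map (\<lambda>k. map (\<lambda>j. k $ j) cs) ks)"
  have len: "length ?xs = length ks * length cs"
    by (simp add: length_concat o_def sum_list_triv)
  have "length cs * p + j < length cs * Suc p" using assms(2) by simp
  also have "\<dots> \<le> length cs * length ks" using assms(1) by (intro mult_le_mono) auto
  finally have "1 + length cs * p + j < length (sites_input cs ks)"
    using len by (simp add: sites_input_def mult.commute)
  then have "imem (init_store (sites_input cs ks)) (int (1 + length cs * p + j))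
      = sites_input cs ks ! (1 + length cs * p + j)"
    unfolding init_store_def by (simp only: store.simps of_nat_less_iff of_nat_0_le_iff nat_int) simp
  also have "\<dots> = ?xs ! (length cs * p + j)"
    by (simp add: sites_input_def)
  also have "\<dots> = ks ! p $ (cs ! j)"
    using assms by (subst nth_concat_map_const) auto
  finally show ?thesis .
qed

section \<open>Memory layout and loop invariant\<close>

locale sampler =
  fixes nb :: "'m::finite \<Rightarrow> int ^ 'd::finite" and \<phi> :: "('m \<Rightarrow> 's::finite) \<Rightarrow> 's pmf"
    and enc :: "'s \<Rightarrow> int" and cs :: "'d list"
  assumes inj_enc: "inj enc" and distinct_cs: "distinct cs" and set_cs: "set cs = UNIV"
begin

definition dim :: nat where "dim = length cs"

text \<open>The negative cells form a table with \<open>dim + 3\<close> columns and one row for every node: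
  columns below \<open>dim\<close> hold the coordinates, \<open>dim\<close> the time, \<open>dim + 1\<close> the coded value
  (0 while it is unknown). Rows 0 to 3 of the last column are registers: the number of sites, the
  number of nodes created, the node visited next, and the number of symbols output.\<close>

definition addr :: "nat \<Rightarrow> nat \<Rightarrow> int" where
  "addr c p = -1 - int ((dim + 3) * p + c)"

definition addr_exp :: "nat \<Rightarrow> iexp \<Rightarrow> iexp" where
  "addr_exp c e = ISub (IConst (-1)) (IAdd (IMul (IConst (int (dim + 3))) e) (IConst (int c)))"

abbreviation cell :: "nat \<Rightarrow> iexp \<Rightarrow> iexp" where
  "cell c e \<equiv> IMem (addr_exp c e)"

abbreviation reg :: "nat \<Rightarrow> iexp" where
  "reg i \<equiv> cell (dim + 2) (IConst (int i))"

definition mem :: "store \<Rightarrow> nat \<Rightarrow> nat \<Rightarrow> int" where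
  "mem s c p = imem s (addr c p)"

lemma ival_addr_exp: "ival e s = int p \<Longrightarrow> ival (addr_exp c e) s = addr c p"
  by (simp add: addr_exp_def addr_def)

lemma addr_eq_iff:
  assumes "c < dim + 3" "c' < dim + 3"
  shows "addr c p = addr c' p' \<longleftrightarrow> c = c' \<and> p = p'"
proof
  assume "addr c p = addr c' p'"
  then have "int ((dim + 3) * p + c) = int ((dim + 3) * p' + c')"
    unfolding addr_def by linarith
  then have eq: "(dim + 3) * p + c = (dim + 3) * p' + c'"
    by (simp only: of_nat_eq_iff)
  have "((dim + 3) * q + e) div (dim + 3) = q" "((dim + 3) * q + e) mod (dim + 3) = e"
    if "e < dim + 3" for q e
    using that by simp_all
  with eq assms show "c = c' \<and> p = p'" by metis
qed simp

lemma addr_neq_int [simp]: "addr c p \<noteq> int i" "int i \<noteq> addr c p"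
  unfolding addr_def by linarith+

lemma ival_cell: "ival e s = int p \<Longrightarrow> ival (cell c e) s = mem s c p"
  by (simp add: ival_addr_exp mem_def)

lemma ival_reg: "ival (reg i) s = mem s (dim + 2) i"
  by (rule ival_cell) simp

abbreviation put :: "nat \<Rightarrow> nat \<Rightarrow> int \<Rightarrow> store \<Rightarrow> store" where
  "put c p x s \<equiv> s\<lparr>imem := (imem s)(addr c p := x)\<rparr>"

lemma mem_put:
  "c < dim + 3 \<Longrightarrow> c' < dim + 3 \<Longrightarrow>
    mem (put c p x s) c' p' = (if c' = c \<and> p' = p then x else mem s c' p')"
  by (auto simp: mem_def addr_eq_iff)

lemma mem_output: "mem (s\<lparr>imem := (imem s)(int i := x)\<rparr>) c p = mem s c p"
  by (simp add: mem_def)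

definition unknown_symbol :: int where "unknown_symbol = (SOME z. z \<notin> range enc)"

text \<open>Shifting by an integer outside the range of \<open>enc\<close> frees 0 as the mark of an
  unknown value, which agrees with the initial contents of the memory.\<close>

definition code :: "'s \<Rightarrow> int" where "code b = enc b - unknown_symbol"

lemma code_neq_0 [simp]: "code b \<noteq> 0"
proof -
  have "finite (range enc)" by simp
  then have "\<exists>z. z \<notin> range enc" by (rule ex_new_if_finite[OF infinite_UNIV_int])
  then have "unknown_symbol \<notin> range enc" unfolding unknown_symbol_def by (rule someI_ex)
  then show ?thesis by (metis code_def eq_iff_diff_eq_0 rangeI)
qed

lemma code_inject [simp]: "code b = code c \<longleftrightarrow> b = c"
  using inj_enc by (auto simp: code_def dest: injD)

text \<open>The depth is hidden because the program meets values in an order unrelated to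
  it.\<close>

definition val_is :: "(nat \<Rightarrow> real) \<Rightarrow> (int ^ 'd) \<times> nat \<Rightarrow> 's \<Rightarrow> bool" where
  "val_is U v b \<longleftrightarrow> (\<exists>t. kval nb \<phi> (\<lambda>v. U (vertex_index cs v)) t v = Some b)"

text \<open>Loop invariant. One sample is drawn for every node created, so \<open>N\<close> counts
  both, and sample \<open>p\<close> lies at real address \<open>p\<close>. The output grows from
  cell 0 upwards over the input; \<open>k \<le> N\<close> guarantees that the coordinates of the
  roots not yet created are still intact. Values may become known in any order, but a known value is
  correct.\<close>

definition good :: "(nat \<Rightarrow> real) \<Rightarrow> (int ^ 'd) list \<Rightarrow> nat \<Rightarrow> nat \<Rightarrow> nat \<Rightarrow> store \<Rightarrow> bool" where
  "good U ks N n k s \<longleftrightarrow>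
    mem s (dim + 2) 0 = int (length ks) \<and> mem s (dim + 2) 1 = int N \<and>
    mem s (dim + 2) 2 = int n \<and> mem s (dim + 2) 3 = int k \<and>
    n \<le> N \<and> k \<le> N \<and> k \<le> length ks \<and>
    (\<forall>i\<ge>k. imem s (int i) = imem (init_store (sites_input cs ks)) (int i)) \<and>
    (\<forall>i<k. \<exists>b. imem s (int i) = enc b \<and> val_is U (ks ! i, 0) b) \<and>
    (\<forall>p<N. \<forall>j<dim. mem s j p = fst (node nb ks p) $ (cs ! j)) \<and>
    (\<forall>p<N. mem s dim p = int (snd (node nb ks p))) \<and>
    (\<forall>p. mem s (dim + 1) p \<noteq> 0 \<longrightarrow>
      p < N \<and> (\<exists>b. mem s (dim + 1) p = code b \<and> val_is U (node nb ks p) b)) \<and>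
    (\<forall>p<N. rmem s (int p) = U p) \<and> drawn s = N"

lemma goodD:
  assumes "good U ks N n k s"
  shows "mem s (dim + 2) 0 = int (length ks)" "mem s (dim + 2) 1 = int N"
    "mem s (dim + 2) 2 = int n" "mem s (dim + 2) 3 = int k"
    "n \<le> N" "k \<le> N" "k \<le> length ks"
    "k \<le> i \<Longrightarrow> imem s (int i) = imem (init_store (sites_input cs ks)) (int i)"
    "i < k \<Longrightarrow> \<exists>b. imem s (int i) = enc b \<and> val_is U (ks ! i, 0) b"
    "p < N \<Longrightarrow> j < dim \<Longrightarrow> mem s j p = fst (node nb ks p) $ (cs ! j)"
    "p < N \<Longrightarrow> mem s dim p = int (snd (node nb ks p))"
    "mem s (dim + 1) p \<noteq> 0 \<Longrightarrow> p < N"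
    "mem s (dim + 1) p \<noteq> 0 \<Longrightarrow> \<exists>b. mem s (dim + 1) p = code b \<and> val_is U (node nb ks p) b"
    "p < N \<Longrightarrow> rmem s (int p) = U p" "drawn s = N"
  using assms unfolding good_def by (simp_all add: numeral_2_eq_2)

lemma ival_reg_good:
  assumes "good U ks N n k s"
  shows "ival (reg 0) s = int (length ks)" "ival (reg 1) s = int N" "ival (reg 2) s = int n"
    "ival (reg 3) s = int k"
  unfolding ival_reg using goodD(1-4)[OF assms] by simp_all

definition index_exp :: iexp where
  "index_exp = site_index_exp (map (\<lambda>j. cell j (reg 2)) [0..<dim]) (cell dim (reg 2))"

lemma ival_index_exp:
  assumes s: "good U ks N n k s" and n: "n < N"
  shows "ival index_exp s = int (vertex_index cs (node nb ks n))"
proof -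
  note c = ival_cell[OF ival_reg_good(3)[OF s]]
  have "map (\<lambda>z. ival z s) (map (\<lambda>j. cell j (reg 2)) [0..<dim]) = map (\<lambda>j. mem s j n) [0..<dim]"
    by (simp only: map_map o_def c)
  also have "\<dots> = map (\<lambda>j. fst (node nb ks n) $ j) cs"
    using goodD(10)[OF s n] by (intro nth_equalityI) (simp_all add: dim_def)
  finally have "map (\<lambda>z. ival z s) (map (\<lambda>j. cell j (reg 2)) [0..<dim]) = map (\<lambda>j. fst (node nb ks n) $ j) cs" .
  then show ?thesis
    unfolding index_exp_def vertex_index_def ival_site_index_exp c
    using goodD(11)[OF s n] by (simp add: site_index_nonneg)
qed

definition assign_val :: "'s \<Rightarrow> ('m, 's) com" where
  "assign_val b = IAssign (addr_exp (dim + 1) (reg 2)) (IConst (code b))"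

lemma assign_val_good:
  assumes s: "good U ks N n k s" and n: "n < N" and b: "val_is U (node nb ks n) b"
  shows "run \<phi> U (assign_val b) s = put (dim + 1) n (code b) s"
    and "good U ks N n k (put (dim + 1) n (code b) s)"
proof -
  show "run \<phi> U (assign_val b) s = put (dim + 1) n (code b) s"
    unfolding assign_val_def run.simps ival_addr_exp[OF ival_reg_good(3)[OF s]] by simp
  show "good U ks N n k (put (dim + 1) n (code b) s)"
    using s n b unfolding good_def by (auto simp: mem_put)
qed

text \<open>The minimum is attained, so it has a name of the form \<open>RProb a b\<close>. The
  minimising pattern is chosen when the program is written, which is legitimate since the program
  may depend on the PCA.\<close>

definition known_exp :: "(('m, 's) rexp \<times> 's) list" where
  "known_exp = map (\<lambda>b. (RProb (SOME a. pmf_min \<phi> b = pmf (\<phi> a) b) b, b)) enumeration"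

definition unknown_exp :: "('m \<Rightarrow> 's) \<Rightarrow> (('m, 's) rexp \<times> 's) list" where
  "unknown_exp a = map (\<lambda>b. (RSub (RProb a b) (RProb (SOME a. pmf_min \<phi> b = pmf (\<phi> a) b) b), b)) enumeration"

lemma pmf_min_SOME: "pmf (\<phi> (SOME a. pmf_min \<phi> b = pmf (\<phi> a) b)) b = pmf_min \<phi> b"
  using someI_ex[OF pmf_min_attained[of \<phi> b]] by simp

lemma rval_known_exp: "map (\<lambda>x. (rval \<phi> (fst x) s, snd x)) known_exp = known_part \<phi>"
  by (simp add: known_exp_def known_part_def o_def pmf_min_SOME)

lemma rval_unknown_exp: "map (\<lambda>x. (rval \<phi> (fst x) s, snd x)) (unknown_exp a) = unknown_part \<phi> a"
  by (simp add: unknown_exp_def unknown_part_def o_def pmf_min_SOME)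

text \<open>An unknown child holds 0, which is no code, so the test then fails for every
  \<open>a\<close>. If all children are known, the invariant makes exactly one \<open>a\<close>
  pass.\<close>

definition child_test :: "('m \<Rightarrow> 's) \<Rightarrow> ('m, 's) bexp" where
  "child_test a = conj_test (map (\<lambda>i. eq_test
      (cell (dim + 1) (IAdd (reg 0) (IAdd (IMul (IConst (int CARD('m))) (reg 2)) (IConst (int i)))))
      (IConst (code (a (enumeration ! i))))) [0..<CARD('m)])"

lemma bval_child_test:
  assumes s: "good U ks N n k s"
  shows "bval \<phi> (child_test a) s \<longleftrightarrow>
    (\<forall>i<CARD('m). mem s (dim + 1) (length ks + CARD('m) * n + i) = code (a (enumeration ! i)))"
proof -
  have "ival (cell (dim + 1) (IAdd (reg 0) (IAdd (IMul (IConst (int CARD('m))) (reg 2)) (IConst (int i))))) s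
      = mem s (dim + 1) (length ks + CARD('m) * n + i)" for i
    using ival_reg_good[OF s] by (intro ival_cell) simp
  then show ?thesis
    unfolding child_test_def by (auto simp del: ival.simps(2))
qed

definition sample_exp :: "('m, 's) rexp" where
  "sample_exp = RMem index_exp"

definition eval_node :: "('m, 's) com" where
  "eval_node = pick_com sample_exp assign_val
    (switch child_test
      (\<lambda>a. pick_com sample_exp assign_val (assign_val (hd enumeration)) (known_exp @ unknown_exp a)
        (RInt (IConst 0)))
      Skip enumeration)
    known_exp (RInt (IConst 0))"

text \<open>The first test keeps known values from being recomputed; the second postpones the
  evaluation of a node whose sample has not been drawn yet.\<close>

definition visit_node :: "('m, 's) com" where
  "visit_node = Cond (BAnd (eq_test (cell (dim + 1) (reg 2)) (IConst 0)) (ILess index_exp (reg 1)))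
    eval_node Skip"

lemma val_is_known:
  "pick (known_part \<phi>) 0 (U (vertex_index cs v)) = Some b \<Longrightarrow> val_is U v b"
  unfolding val_is_def by (intro exI[of _ "Suc 0"]) simp

lemma val_is_unique: "val_is U v b \<Longrightarrow> val_is U v c \<Longrightarrow> b = c"
  unfolding val_is_def using kval_unique by blast

lemma val_is_update:
  assumes "\<And>i. val_is U (child nb v i) (a i)" "pick (known_part \<phi>) 0 (U (vertex_index cs v)) = None"
  shows "val_is U v (update \<phi> (U (vertex_index cs v)) a)"
proof -
  let ?V = "\<lambda>v. U (vertex_index cs v)"
  from assms(1) have "\<forall>i. \<exists>t. kval nb \<phi> ?V t (child nb v i) = Some (a i)"
    unfolding val_is_def by blast
  then obtain t where t: "\<And>i. kval nb \<phi> ?V (t i) (child nb v i) = Some (a i)" by metis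
  have "kval nb \<phi> ?V (Max (range t)) (child nb v i) = Some (a i)" for i
    by (rule kval_mono[OF t]) simp
  then have "kval nb \<phi> ?V (Suc (Max (range t))) v = Some (update \<phi> (?V v) a)"
    using assms(2) by simp
  then show ?thesis unfolding val_is_def by blast
qed

lemma run_eval_node:
  assumes s: "good U ks N n k s" and n: "n < N" and ks: "ks \<noteq> []"
    and idx: "vertex_index cs (node nb ks n) < N"
  shows "(\<exists>b. val_is U (node nb ks n) b \<and> run \<phi> U eval_node s = put (dim + 1) n (code b) s)
    \<or> run \<phi> U eval_node s = s \<and> pick (known_part \<phi>) 0 (U (vertex_index cs (node nb ks n))) = None
      \<and> (\<exists>i<CARD('m). mem s (dim + 1) (length ks + CARD('m) * n + i) = 0)"
proof -
  let ?v = "node nb ks n" and ?c = "\<lambda>i. length ks + CARD('m) * n + i"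
  have u: "rval \<phi> sample_exp s = U (vertex_index cs ?v)"
    unfolding sample_exp_def rval.simps ival_index_exp[OF s n] by (rule goodD(14)[OF s idx])
  have z: "rval \<phi> (RInt (IConst 0)) s = 0" by simp
  show ?thesis
  proof (cases "pick (known_part \<phi>) 0 (U (vertex_index cs ?v))")
    case (Some b)
    then have "run \<phi> U eval_node s = run \<phi> U (assign_val b) s"
      unfolding eval_node_def run_pick_com rval_known_exp u z by simp
    moreover have v: "val_is U ?v b" by (rule val_is_known[of U ?v b, OF Some])
    ultimately show ?thesis using assign_val_good(1)[OF s n v] by auto
  next
    case None
    then have r: "run \<phi> U eval_node s = run \<phi> U (switch child_test
      (\<lambda>a. pick_com sample_exp assign_val (assign_val (hd enumeration)) (known_exp @ unknown_exp a)
        (RInt (IConst 0))) Skip enumeration) s"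
      unfolding eval_node_def run_pick_com rval_known_exp u z by simp
    show ?thesis
    proof (cases "\<exists>i<CARD('m). mem s (dim + 1) (?c i) = 0")
      case True
      then have "\<not> bval \<phi> (child_test a) s" for a
        unfolding bval_child_test[OF s] by (metis code_neq_0)
      then have "run \<phi> U eval_node s = s"
        unfolding r by (subst run_switch_none) auto
      with None True show ?thesis by blast
    next
      case False
      \<comment> \<open>The table stores children by position, whereas \<open>update\<close> takes a
        function of the neighbour. Positions and neighbours correspond one to one because
        \<open>enumeration\<close> is distinct and complete.\<close>
      have ex: "\<exists>b. \<forall>i<CARD('m). enumeration ! i = x \<longrightarrow>
          mem s (dim + 1) (?c i) = code b \<and> val_is U (child nb ?v x) b" for x :: 'm
      proof -
        obtain j where j: "j < CARD('m)" "enumeration ! j = x"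
          using set_enumeration[where 'a = 'm] by (metis UNIV_I in_set_conv_nth length_enumeration)
        obtain b where b: "mem s (dim + 1) (?c j) = code b" "val_is U (node nb ks (?c j)) b"
          using False j goodD(13)[OF s] by blast
        have "i = j" if "i < CARD('m)" "enumeration ! i = x" for i
          using that j distinct_enumeration[where 'a = 'm]
          by (metis length_enumeration nth_eq_iff_index_eq)
        with b show ?thesis
          unfolding node_child[OF ks j(1)] using j(2) by blast
      qed
      have "\<exists>a. \<forall>x. \<forall>i<CARD('m). enumeration ! i = x \<longrightarrow>
          mem s (dim + 1) (?c i) = code (a x) \<and> val_is U (child nb ?v x) (a x)"
        by (intro choice allI ex)
      then obtain a where "\<forall>x. \<forall>i<CARD('m). enumeration ! i = x \<longrightarrow>
          mem s (dim + 1) (?c i) = code (a x) \<and> val_is U (child nb ?v x) (a x)"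
        by (rule exE)
      then have a: "\<And>i. i < CARD('m) \<Longrightarrow> mem s (dim + 1) (?c i) = code (a (enumeration ! i))"
        and val: "\<And>i. i < CARD('m) \<Longrightarrow> val_is U (child nb ?v (enumeration ! i)) (a (enumeration ! i))"
        by blast+
      have all: "\<exists>i<CARD('m). enumeration ! i = x" for x :: 'm
        using set_enumeration[where 'a = 'm] by (metis UNIV_I in_set_conv_nth length_enumeration)
      have t: "bval \<phi> (child_test a) s" unfolding bval_child_test[OF s] using a by simp
      have t': "a' = a" if "bval \<phi> (child_test a') s" for a'
      proof (rule ext)
        fix x :: 'm
        obtain i where i: "i < CARD('m)" "enumeration ! i = x" using all by blast
        have "mem s (dim + 1) (?c i) = code (a' x)"
          using that i unfolding bval_child_test[OF s] by blast
        then show "a' x = a x" using a[OF i(1)] i(2) by simp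
      qed
      let ?b = "update \<phi> (U (vertex_index cs ?v)) a"
      have "run \<phi> U eval_node s = run \<phi> U (pick_com sample_exp assign_val (assign_val (hd enumeration))
          (known_exp @ unknown_exp a) (RInt (IConst 0))) s"
        unfolding r
      proof (rule run_switch_unique)
        show "a \<in> set enumeration" by (simp add: set_enumeration)
        show "bval \<phi> (child_test a) s" by (rule t)
        show "a' = a" if "bval \<phi> (child_test a') s" for a' using that by (rule t')
      qed
      also have "\<dots> = run \<phi> U (assign_val ?b) s"
        unfolding run_pick_com map_append rval_known_exp rval_unknown_exp u z update_def
        by (auto split: option.split)
      finally have "run \<phi> U eval_node s = run \<phi> U (assign_val ?b) s" .
      moreover have vb: "val_is U ?v ?b"
      proof (rule val_is_update)
        fix x :: 'm
        obtain i where i: "i < CARD('m)" "enumeration ! i = x" using all by blast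
        show "val_is U (child nb ?v x) (a x)" using val[OF i(1)] unfolding i(2) .
      qed (rule None)
      ultimately show ?thesis using assign_val_good(1)[OF s n vb] by auto
    qed
  qed
qed

lemma run_visit_node:
  assumes s: "good U ks N n k s" and n: "n < N" and ks: "ks \<noteq> []"
  defines "s' \<equiv> run \<phi> U visit_node s"
  shows "good U ks N n k s'"
    and "p \<noteq> n \<or> mem s (dim + 1) p \<noteq> 0 \<Longrightarrow> mem s' (dim + 1) p = mem s (dim + 1) p"
    and "vertex_index cs (node nb ks n) < N \<Longrightarrow>
      pick (known_part \<phi>) 0 (U (vertex_index cs (node nb ks n))) \<noteq> None
        \<or> (\<forall>i<CARD('m). mem s (dim + 1) (length ks + CARD('m) * n + i) \<noteq> 0)
      \<Longrightarrow> mem s' (dim + 1) n \<noteq> 0"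
proof -
  have c: "ival (cell (dim + 1) (reg 2)) s = mem s (dim + 1) n"
    by (rule ival_cell[OF ival_reg_good(3)[OF s]])
  have s': "s' = (if mem s (dim + 1) n = 0 \<and> vertex_index cs (node nb ks n) < N
      then run \<phi> U eval_node s else s)"
    unfolding s'_def visit_node_def run.simps bval.simps bval_eq_test c ival_index_exp[OF s n]
      ival_reg_good(2)[OF s] by simp
  have "good U ks N n k s' \<and> (p \<noteq> n \<or> mem s (dim + 1) p \<noteq> 0 \<longrightarrow> mem s' (dim + 1) p = mem s (dim + 1) p)
    \<and> (vertex_index cs (node nb ks n) < N \<longrightarrow>
      pick (known_part \<phi>) 0 (U (vertex_index cs (node nb ks n))) \<noteq> None
        \<or> (\<forall>i<CARD('m). mem s (dim + 1) (length ks + CARD('m) * n + i) \<noteq> 0)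
      \<longrightarrow> mem s' (dim + 1) n \<noteq> 0)" for p
  proof (cases "mem s (dim + 1) n = 0 \<and> vertex_index cs (node nb ks n) < N")
    case True
    then have s': "s' = run \<phi> U eval_node s" by (simp add: s')
    from run_eval_node[OF s n ks conjunct2[OF True]] show ?thesis
    proof
      assume "\<exists>b. val_is U (node nb ks n) b \<and> run \<phi> U eval_node s = put (dim + 1) n (code b) s"
      then obtain b where b: "val_is U (node nb ks n) b" "s' = put (dim + 1) n (code b) s"
        unfolding s' by blast
      show ?thesis
        using assign_val_good(2)[OF s n b(1)] True unfolding b(2) by (simp add: mem_put)
    next
      assume "run \<phi> U eval_node s = s \<and> pick (known_part \<phi>) 0 (U (vertex_index cs (node nb ks n))) = None
        \<and> (\<exists>i<CARD('m). mem s (dim + 1) (length ks + CARD('m) * n + i) = 0)"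
      then show ?thesis using s by (simp add: s') blast
    qed
  next
    case False
    then have "s' = s" unfolding s' by (rule if_not_P)
    with False s show ?thesis by auto
  qed
  then show "good U ks N n k s'"
    and "p \<noteq> n \<or> mem s (dim + 1) p \<noteq> 0 \<Longrightarrow> mem s' (dim + 1) p = mem s (dim + 1) p"
    and "vertex_index cs (node nb ks n) < N \<Longrightarrow>
      pick (known_part \<phi>) 0 (U (vertex_index cs (node nb ks n))) \<noteq> None
        \<or> (\<forall>i<CARD('m). mem s (dim + 1) (length ks + CARD('m) * n + i) \<noteq> 0)
      \<Longrightarrow> mem s' (dim + 1) n \<noteq> 0"
    by blast+
qed

abbreviation set_reg :: "nat \<Rightarrow> iexp \<Rightarrow> ('m, 's) com" where
  "set_reg i e \<equiv> IAssign (addr_exp (dim + 2) (IConst (int i))) e"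

lemma run_set_reg: "run \<phi> U (set_reg i e) s = put (dim + 2) i (ival e s) s"
  unfolding run.simps by (subst ival_addr_exp[of _ _ i]) simp_all

text \<open>Roots occupy the first rows, so row \<open>k\<close> belongs to the site
  \<open>ks ! k\<close>. Symbols leave in the order of the input, at most one per round; a root that
  is known early waits for its predecessors.\<close>

definition output_symbol :: "('m, 's) com" where
  "output_symbol = Cond (eq_test (cell (dim + 1) (reg 3)) (IConst 0)) Skip
    (Seq (IAssign (reg 3) (IAdd (cell (dim + 1) (reg 3)) (IConst unknown_symbol)))
      (set_reg 3 (IAdd (reg 3) (IConst 1))))"

lemma run_output_symbol:
  assumes s: "good U ks N n k s" and k: "k < length ks"
  defines "s' \<equiv> run \<phi> U output_symbol s"
  shows "good U ks N n (if mem s (dim + 1) k = 0 then k else Suc k) s'"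
    and "mem s' (dim + 1) p = mem s (dim + 1) p"
proof -
  let ?x = "mem s (dim + 1) k"
  have c: "ival (cell (dim + 1) (reg 3)) s = ?x"
    by (rule ival_cell[OF ival_reg_good(4)[OF s]])
  have "good U ks N n (if ?x = 0 then k else Suc k) s' \<and> mem s' (dim + 1) p = mem s (dim + 1) p" for p
  proof (cases "?x = 0")
    case True
    then have "s' = s" unfolding s'_def output_symbol_def run.simps bval_eq_test c by simp
    with True s show ?thesis by simp
  next
    case False
    let ?s = "s\<lparr>imem := (imem s)(int k := ?x + unknown_symbol)\<rparr>"
    have "mem ?s (dim + 2) 3 = int k" using goodD(4)[OF s] by (simp add: mem_output)
    then have r3: "ival (reg 3) ?s = int k" by (simp only: ival_reg)
    have "s' = run \<phi> U (set_reg 3 (IAdd (reg 3) (IConst 1)))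
        (run \<phi> U (IAssign (reg 3) (IAdd (cell (dim + 1) (reg 3)) (IConst unknown_symbol))) s)"
      using False unfolding s'_def output_symbol_def run.simps bval_eq_test c by simp
    also have "run \<phi> U (IAssign (reg 3) (IAdd (cell (dim + 1) (reg 3)) (IConst unknown_symbol))) s = ?s"
      unfolding run.simps ival_reg_good(4)[OF s] ival.simps(3) c by simp
    also have "run \<phi> U (set_reg 3 (IAdd (reg 3) (IConst 1))) ?s = put (dim + 2) 3 (int (Suc k)) ?s"
      unfolding run_set_reg ival.simps(3) r3 by (simp add: add.commute)
    finally have s': "s' = put (dim + 2) 3 (int (Suc k)) ?s" .
    \<comment> \<open>Only created rows hold values, and this preserves \<open>k \<le> N\<close>
      when \<open>k\<close> is increased.\<close>
    have kN: "k < N" using goodD(12)[OF s False] .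
    obtain b where b: "?x = code b" "val_is U (node nb ks k) b"
      using goodD(13)[OF s False] by blast
    have out: "?x + unknown_symbol = enc b" "val_is U (ks ! k, 0) b"
      using b k by (simp_all add: code_def node_root)
    have mem_s': "mem s' c p = (if c = dim + 2 \<and> p = 3 then int (Suc k) else mem s c p)"
      if "c < dim + 3" for c p
      using that unfolding s' by (subst mem_put) (simp_all add: mem_output)
    have imem_s': "imem s' (int i) = (if i = k then enc b else imem s (int i))" for i
      unfolding s' out(1) by simp
    have "good U ks N n (Suc k) s'"
      unfolding good_def
    proof (intro conjI allI impI)
      show "\<exists>b. imem s' (int i) = enc b \<and> val_is U (ks ! i, 0) b" if "i < Suc k" for i
        using that goodD(9)[OF s, of i] out(2) by (cases "i = k") (auto simp: imem_s')
      show "imem s' (int i) = imem (init_store (sites_input cs ks)) (int i)" if "Suc k \<le> i" for i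
        using that goodD(8)[OF s, of i] by (simp add: imem_s')
      show "rmem s' (int p) = U p" if "p < N" for p
        using that goodD(14)[OF s] by (simp add: s')
      show "drawn s' = N" using goodD(15)[OF s] by (simp add: s')
      show "p < N" if "mem s' (dim + 1) p \<noteq> 0" for p
        using that goodD(12)[OF s, of p] by (simp add: mem_s')
      show "\<exists>b. mem s' (dim + 1) p = code b \<and> val_is U (node nb ks p) b" if "mem s' (dim + 1) p \<noteq> 0" for p
        using that goodD(13)[OF s, of p] by (simp add: mem_s')
    qed (use kN k goodD[OF s] in \<open>auto simp: mem_s'\<close>)
    with False show ?thesis by (simp add: mem_s')
  qed
  then show "good U ks N n (if ?x = 0 then k else Suc k) s'" "mem s' (dim + 1) p = mem s (dim + 1) p"
    by blast+
qed

lemma set_reg_2_good: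
  assumes s: "good U ks N n k s" and m: "m \<le> N"
  shows "good U ks N m k (put (dim + 2) 2 (int m) s)"
  using s m unfolding good_def by (auto simp: mem_put)


lemma run_set_reg_2:
  assumes s: "good U ks N n k s" and m: "m \<le> N" and e: "ival e s = int m"
  shows "good U ks N m k (run \<phi> U (set_reg 2 e) s)"
    and "mem (run \<phi> U (set_reg 2 e) s) (dim + 1) p = mem s (dim + 1) p"
  using set_reg_2_good[OF s m] unfolding run_set_reg e by (simp_all add: mem_put)

section \<open>Creation of nodes\<close>

text \<open>The row of a new node is computed from cells outside of it, so the order of the assignments is
  irrelevant (this is \<open>run_assign_row\<close>).\<close>

definition create_root :: "('m, 's) com" where
  "create_root = assigns (\<lambda>j. addr_exp j (reg 1))
    (\<lambda>j. if j < dim then IMem (IAdd (IAdd (IConst 1) (IMul (IConst (int dim)) (reg 1))) (IConst (int j)))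
      else IConst 0) [0..<dim + 1]"

definition offset_exp :: iexp where
  "offset_exp = ISub (reg 1) (reg 0)"

definition create_child :: "nat \<Rightarrow> ('m, 's) com" where
  "create_child i = assigns (\<lambda>j. addr_exp j (reg 1))
    (\<lambda>j. IAdd (cell j (IDiv offset_exp (IConst (int CARD('m)))))
      (IConst (if j < dim then nb (enumeration ! i) $ (cs ! j) else 1))) [0..<dim + 1]"

text \<open>\<open>Sample\<close> is executed before the counter is increased, so sample number
  \<open>N\<close> lands at address \<open>N\<close>. Visits then restart with node 0, since the new
  sample may belong to any node.\<close>

definition create_node :: "('m, 's) com" where
  "create_node = Seq (Cond (ILess (reg 1) (reg 0)) create_root
      (switch (\<lambda>i. eq_test (IMod offset_exp (IConst (int CARD('m)))) (IConst (int i))) create_child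
        Skip [0..<CARD('m)]))
    (Seq (Sample (reg 1)) (Seq (set_reg 1 (IAdd (reg 1) (IConst 1))) (set_reg 2 (IConst 0))))"

definition row :: "(int ^ 'd) list \<Rightarrow> nat \<Rightarrow> nat \<Rightarrow> int" where
  "row ks p j = (if j < dim then fst (node nb ks p) $ (cs ! j) else int (snd (node nb ks p)))"

lemma run_assign_row:
  fixes N :: nat
  assumes s: "good U ks N n k s"
    and X: "\<And>s' j. j < dim + 1 \<Longrightarrow>
      (\<And>i. imem s' (int i) = imem s (int i)) \<Longrightarrow> (\<And>i. ival (reg i) s' = ival (reg i) s) \<Longrightarrow>
      (\<And>c p. c < dim + 1 \<Longrightarrow> p < N \<Longrightarrow> mem s' c p = mem s c p) \<Longrightarrow> ival (X j) s' = row ks N j"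
  defines "s' \<equiv> run \<phi> U (assigns (\<lambda>j. addr_exp j (reg 1)) X [0..<dim + 1]) s"
  shows "imem s' (int i) = imem s (int i)"
    and "c < dim + 3 \<Longrightarrow> mem s' c p = (if c < dim + 1 \<and> p = N then row ks N c else mem s c p)"
    and "rmem s' = rmem s" "drawn s' = drawn s"
proof -
  let ?a = "\<lambda>j. addr j N"
  have *: "(\<forall>j\<in>set [0..<dim + 1]. imem s' (?a j) = row ks N j)
    \<and> (\<forall>b. b \<notin> ?a ` set [0..<dim + 1] \<longrightarrow> imem s' b = imem s b)
    \<and> rmem s' = rmem s \<and> drawn s' = drawn s"
    unfolding s'_def
  proof (rule run_assigns[where J = "{..<dim + 1}" and ?s0.0 = s])
    fix s' :: store and j assume j: "j \<in> set [0..<dim + 1]"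
      and eq: "\<forall>b. b \<notin> ?a ` {..<dim + 1} \<longrightarrow> imem s' b = imem s b"
    have "addr c p \<notin> ?a ` {..<dim + 1}" if "c < dim + 3" "c = dim + 2 \<or> p \<noteq> N" for c p
      using that by (auto simp: addr_eq_iff)
    then have mem: "mem s' c p = mem s c p" if "c < dim + 3" "c = dim + 2 \<or> p \<noteq> N" for c p
      using that eq unfolding mem_def by blast
    have reg: "ival (reg i) s' = ival (reg i) s" for i
      unfolding ival_reg by (rule mem) auto
    have "ival (addr_exp j (reg 1)) s' = ?a j"
      by (rule ival_addr_exp) (simp only: reg ival_reg_good(2)[OF s])
    moreover have "ival (X j) s' = row ks N j"
    proof (rule X)
      show "j < dim + 1" using j by auto
      show "imem s' (int i) = imem s (int i)" for i
      proof -
        have "int i \<notin> ?a ` {..<dim + 1}" by auto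
        then show ?thesis using eq by blast
      qed
      show "mem s' c p = mem s c p" if "c < dim + 1" "p < N" for c p using that by (intro mem) auto
    qed (rule reg)
    ultimately show "ival (addr_exp j (reg 1)) s' = ?a j \<and> ival (X j) s' = row ks N j" by blast
  next
    show "inj_on ?a {..<dim + 1}" by (auto simp: inj_on_def addr_eq_iff)
  qed auto
  have "int i \<notin> ?a ` set [0..<dim + 1]" by auto
  with * show "imem s' (int i) = imem s (int i)" by blast
  show "mem s' c p = (if c < dim + 1 \<and> p = N then row ks N c else mem s c p)" if "c < dim + 3"
  proof (cases "c < dim + 1 \<and> p = N")
    case True
    then have "c \<in> set [0..<dim + 1]" by auto
    with * have "imem s' (?a c) = row ks N c" by blast
    with True show ?thesis by (simp add: mem_def)
  next
    case False
    then have "addr c p \<notin> ?a ` set [0..<dim + 1]" using that by (auto simp: addr_eq_iff)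
    then have "imem s' (addr c p) = imem s (addr c p)" using * by blast
    then show ?thesis unfolding if_not_P[OF False] mem_def .
  qed
  show "rmem s' = rmem s" "drawn s' = drawn s" using * by blast+
qed

lemma run_create_row:
  assumes s: "good U ks N n k s" and ks: "ks \<noteq> []"
  defines "s' \<equiv> run \<phi> U (Cond (ILess (reg 1) (reg 0)) create_root
      (switch (\<lambda>i. eq_test (IMod offset_exp (IConst (int CARD('m)))) (IConst (int i))) create_child
        Skip [0..<CARD('m)])) s"
  shows "imem s' (int i) = imem s (int i)"
    and "c < dim + 3 \<Longrightarrow> mem s' c p = (if c < dim + 1 \<and> p = N then row ks N c else mem s c p)"
    and "rmem s' = rmem s" "drawn s' = drawn s"
proof -
  note reg = ival_reg_good[OF s]
  have "imem s' (int i) = imem s (int i)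
    \<and> (c < dim + 3 \<longrightarrow> mem s' c p = (if c < dim + 1 \<and> p = N then row ks N c else mem s c p))
    \<and> rmem s' = rmem s \<and> drawn s' = drawn s" for c p
  proof (cases "N < length ks")
    case True
    then have s': "s' = run \<phi> U create_root s"
      unfolding s'_def run.simps bval.simps reg by simp
    let ?X = "\<lambda>j. if j < dim then IMem (IAdd (IAdd (IConst 1) (IMul (IConst (int dim)) (reg 1))) (IConst (int j)))
      else IConst 0"
    have X: "ival (?X j) s' = row ks N j"
      if "j < dim + 1" "\<And>i. imem s' (int i) = imem s (int i)" "\<And>i. ival (reg i) s' = ival (reg i) s"
        "\<And>c p. c < dim + 1 \<Longrightarrow> p < N \<Longrightarrow> mem s' c p = mem s c p" for s' :: store and j
    proof (cases "j < dim")
      case j: True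
      have "ival (?X j) s' = imem s' (int (1 + dim * N + j))"
        using j unfolding if_P[OF j] ival.simps(2)[of "IAdd _ _"] ival.simps(1,3,5) that(3) reg by (simp add: add.assoc)
      \<comment> \<open>The output has overwritten only cells below \<open>k\<close>, and the cell
        read here lies beyond them: \<open>k \<le> N \<le> dim * N\<close>, as
        \<open>j < dim\<close> makes \<open>dim\<close> positive.\<close>
      also have "\<dots> = imem (init_store (sites_input cs ks)) (int (1 + dim * N + j))"
        unfolding that(2)
      proof (rule goodD(8)[OF s])
        have "k \<le> N" by (rule goodD(6)[OF s])
        also have "N \<le> dim * N" using j by simp
        finally show "k \<le> 1 + dim * N + j" by simp
      qed
      also have "\<dots> = row ks N j"
        using imem_init_store_sites_input[OF True, of j cs] j True
        by (simp add: dim_def row_def node_root)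
      finally show ?thesis .
    next
      case False
      then show ?thesis using True by (simp add: row_def node_root)
    qed
    show ?thesis
      unfolding s' create_root_def using run_assign_row[OF s X] by blast
  next
    case False
    define i where "i = (N - length ks) mod CARD('m)"
    define p where "p = (N - length ks) div CARD('m)"
    have i: "i < CARD('m)" by (simp add: i_def)
    have N: "N = length ks + CARD('m) * p + i" using False by (simp add: i_def p_def)
    \<comment> \<open>The parent precedes its child because at least one root stands in
      front.\<close>
    have "p \<le> CARD('m) * p" by simp
    moreover have "0 < length ks" using ks by simp
    ultimately have p: "p < N" unfolding N by linarith
    have off: "ival offset_exp s = int (CARD('m) * p + i)"
      unfolding offset_exp_def ival.simps(4) reg by (subst N) simp
    have "s' = run \<phi> U (switch (\<lambda>i. eq_test (IMod offset_exp (IConst (int CARD('m)))) (IConst (int i)))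
        create_child Skip [0..<CARD('m)]) s"
      using False unfolding s'_def run.simps bval.simps reg by simp
    also have "\<dots> = run \<phi> U (create_child i) s"
    proof (rule run_switch_unique)
      show "i \<in> set [0..<CARD('m)]" using i by simp
      have test: "bval \<phi> (eq_test (IMod offset_exp (IConst (int CARD('m)))) (IConst (int j))) s \<longleftrightarrow> i = j" for j
        unfolding bval_eq_test ival.simps(1,7) off of_nat_mod[symmetric] of_nat_eq_iff using i by simp
      show "bval \<phi> (eq_test (IMod offset_exp (IConst (int CARD('m)))) (IConst (int i))) s"
        unfolding test ..
      show "j = i" if "bval \<phi> (eq_test (IMod offset_exp (IConst (int CARD('m)))) (IConst (int j))) s" for j
        using that unfolding test ..
    qed
    finally have s': "s' = run \<phi> U (create_child i) s" .
    let ?X = "\<lambda>j. IAdd (cell j (IDiv offset_exp (IConst (int CARD('m)))))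
      (IConst (if j < dim then nb (enumeration ! i) $ (cs ! j) else 1))"
    have X: "ival (?X j) s' = row ks N j"
      if j: "j < dim + 1" and imem: "\<And>i. imem s' (int i) = imem s (int i)"
        and s': "\<And>i. ival (reg i) s' = ival (reg i) s"
        "\<And>c p. c < dim + 1 \<Longrightarrow> p < N \<Longrightarrow> mem s' c p = mem s c p" for s' :: store and j
    proof -
      have "ival offset_exp s' = int (CARD('m) * p + i)"
        using off unfolding offset_exp_def ival.simps(4) s'(1) .
      then have "ival (IDiv offset_exp (IConst (int CARD('m)))) s' = int p"
        unfolding ival.simps(1,6) using i by (simp only: of_nat_div[symmetric] of_nat_eq_iff) simp
      then have c: "ival (cell j (IDiv offset_exp (IConst (int CARD('m))))) s' = mem s j p"
        using s'(2)[OF j p] by (simp only: ival_cell)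
      have node: "node nb ks N = child nb (node nb ks p) (enumeration ! i)"
        unfolding N by (rule node_child[OF ks i])
      show ?thesis
      proof (cases "j < dim")
        case True
        then show ?thesis
          unfolding ival.simps(3) c using goodD(10)[OF s p True]
          by (simp add: row_def node child_def)
      next
        case False
        with j have "j = dim" by simp
        then show ?thesis
          unfolding ival.simps(3) c using goodD(11)[OF s p]
          by (simp add: row_def node child_def)
      qed
    qed
    show ?thesis
      unfolding s' create_child_def using run_assign_row[OF s X] by blast
  qed
  then show "imem s' (int i) = imem s (int i)"
    and "c < dim + 3 \<Longrightarrow> mem s' c p = (if c < dim + 1 \<and> p = N then row ks N c else mem s c p)"
    and "rmem s' = rmem s" "drawn s' = drawn s"
    by blast+
qed

lemma run_create_node:
  assumes s: "good U ks N n k s" and ks: "ks \<noteq> []"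
  defines "s' \<equiv> run \<phi> U create_node s"
  shows "good U ks (Suc N) 0 k s'" and "mem s' (dim + 1) p = mem s (dim + 1) p"
proof -
  define s1 where "s1 = run \<phi> U (Cond (ILess (reg 1) (reg 0)) create_root
      (switch (\<lambda>i. eq_test (IMod offset_exp (IConst (int CARD('m)))) (IConst (int i))) create_child
        Skip [0..<CARD('m)])) s"
  note s1 = run_create_row[OF s ks, folded s1_def]
  define s2 where "s2 = s1\<lparr>rmem := (rmem s1)(int N := U N), drawn := Suc N\<rparr>"
  have mem2: "mem s2 c p = (if c < dim + 1 \<and> p = N then row ks N c else mem s c p)" if "c < dim + 3" for c p
    using s1(2)[OF that] by (simp add: mem_def s2_def)
  have r1: "ival (reg 1) s1 = int N"
    unfolding ival_reg using s1(2)[of "dim + 2" 1] goodD(2)[OF s] by simp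
  have r2: "ival (reg 1) s2 = int N"
    unfolding ival_reg using mem2[of "dim + 2" 1] goodD(2)[OF s] by simp
  have "s' = run \<phi> U (Seq (set_reg 1 (IAdd (reg 1) (IConst 1))) (set_reg 2 (IConst 0))) s2"
    unfolding s'_def create_node_def run.simps(5) s1_def[symmetric] run.simps(4) r1 s1(4) goodD(15)[OF s] s2_def ..
  also have "\<dots> = put (dim + 2) 2 0 (put (dim + 2) 1 (int (Suc N)) s2)"
    unfolding run.simps(5) run_set_reg ival.simps(1,3) r2 by (simp add: add.commute)
  finally have s': "s' = put (dim + 2) 2 0 (put (dim + 2) 1 (int (Suc N)) s2)" .
  define s3 where "s3 = put (dim + 2) 1 (int (Suc N)) s2"
  have mem3: "mem s3 c p = (if c = dim + 2 \<and> p = 1 then int (Suc N)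
      else if c < dim + 1 \<and> p = N then row ks N c else mem s c p)" if "c < dim + 3" for c p
    unfolding s3_def using that by (simp add: mem_put mem2)
  have mem': "mem s' c p = (if c = dim + 2 \<and> p = 2 then 0 else if c = dim + 2 \<and> p = 1 then int (Suc N)
      else if c < dim + 1 \<and> p = N then row ks N c else mem s c p)" if "c < dim + 3" for c p
    unfolding s' s3_def[symmetric] using that by (simp add: mem_put mem3)
  have imem': "imem s' (int i) = imem s (int i)" for i
    unfolding s' by (simp add: s2_def s1(1))
  have rmem': "rmem s' = (rmem s)(int N := U N)" and drawn': "drawn s' = Suc N"
    unfolding s' by (simp_all add: s2_def s1(3))
  show "mem s' (dim + 1) p = mem s (dim + 1) p"
    by (simp add: mem')
  show "good U ks (Suc N) 0 k s'"
    unfolding good_def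
  proof (intro conjI allI impI)
    show "mem s' j p = fst (node nb ks p) $ (cs ! j)" if "p < Suc N" "j < dim" for p j
      using that goodD(10)[OF s, of p j] by (cases "p = N") (simp_all add: mem' row_def)
    show "mem s' dim p = int (snd (node nb ks p))" if "p < Suc N" for p
      using that goodD(11)[OF s, of p] by (cases "p = N") (simp_all add: mem' row_def)
    show "p < Suc N" if "mem s' (dim + 1) p \<noteq> 0" for p
      using that goodD(12)[OF s, of p] by (simp add: mem')
    show "\<exists>b. mem s' (dim + 1) p = code b \<and> val_is U (node nb ks p) b" if "mem s' (dim + 1) p \<noteq> 0" for p
      using that goodD(13)[OF s, of p] by (simp add: mem')
    show "rmem s' (int p) = U p" if "p < Suc N" for p
      using that goodD(14)[OF s, of p] by (cases "p = N") (simp_all add: rmem')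
    show "imem s' (int i) = imem (init_store (sites_input cs ks)) (int i)" if "k \<le> i" for i
      using goodD(8)[OF s that] by (simp add: imem')
    show "\<exists>b. imem s' (int i) = enc b \<and> val_is U (ks ! i, 0) b" if "i < k" for i
      using goodD(9)[OF s that] by (simp add: imem')
    show "k \<le> Suc N" using goodD(6)[OF s] by simp
    show "k \<le> length ks" by (rule goodD(7)[OF s])
  qed (use goodD(1-4)[OF s] drawn' in \<open>simp_all add: mem'\<close>)
qed

definition body :: "('m, 's) com" where
  "body = Cond (ILess (reg 2) (reg 1))
    (Seq visit_node (Seq output_symbol (set_reg 2 (IAdd (reg 2) (IConst 1))))) create_node"

text \<open>Whether a symbol is output depends on the value after the visit. It can be read off the
  final store, since neither the output nor the registers touch the value column. The third claim is
  the progress on which termination rests.\<close>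

lemma run_body_visit:
  assumes s: "good U ks N n k s" and n: "n < N" and k: "k < length ks"
  defines "s' \<equiv> run \<phi> U body s"
  shows "good U ks N (Suc n) (if mem s' (dim + 1) k = 0 then k else Suc k) s'"
    and "p \<noteq> n \<or> mem s (dim + 1) p \<noteq> 0 \<Longrightarrow> mem s' (dim + 1) p = mem s (dim + 1) p"
    and "vertex_index cs (node nb ks n) < N \<Longrightarrow>
      pick (known_part \<phi>) 0 (U (vertex_index cs (node nb ks n))) \<noteq> None
        \<or> (\<forall>i<CARD('m). mem s (dim + 1) (length ks + CARD('m) * n + i) \<noteq> 0)
      \<Longrightarrow> mem s' (dim + 1) n \<noteq> 0"
proof -
  have ks: "ks \<noteq> []" using k by auto
  define s1 where "s1 = run \<phi> U visit_node s"
  define s2 where "s2 = run \<phi> U output_symbol s1"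
  note 1 = run_visit_node[OF s n ks, folded s1_def]
  note 2 = run_output_symbol[OF 1(1) k, folded s2_def]
  have e: "ival (IAdd (reg 2) (IConst 1)) s2 = int (Suc n)"
    unfolding ival.simps(3) ival_reg_good(3)[OF 2(1)] by simp
  have s': "s' = run \<phi> U (set_reg 2 (IAdd (reg 2) (IConst 1))) s2"
    unfolding s'_def body_def s2_def s1_def run.simps(5,6) bval.simps(1) ival_reg_good(2,3)[OF s] using n by simp
  have "Suc n \<le> N" using n by simp
  note 3 = run_set_reg_2[OF 2(1) this e, folded s']
  have mem: "mem s' (dim + 1) p = mem s1 (dim + 1) p" for p
    by (simp only: 3(2) 2(2))
  show "good U ks N (Suc n) (if mem s' (dim + 1) k = 0 then k else Suc k) s'"
    unfolding mem by (rule 3(1))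
  show "mem s' (dim + 1) p = mem s (dim + 1) p" if "p \<noteq> n \<or> mem s (dim + 1) p \<noteq> 0"
    unfolding mem by (rule 1(2)[OF that])
  show "mem s' (dim + 1) n \<noteq> 0" if "vertex_index cs (node nb ks n) < N"
    "pick (known_part \<phi>) 0 (U (vertex_index cs (node nb ks n))) \<noteq> None
        \<or> (\<forall>i<CARD('m). mem s (dim + 1) (length ks + CARD('m) * n + i) \<noteq> 0)"
    unfolding mem by (rule 1(3)[OF that])
qed

lemma run_body_create:
  assumes s: "good U ks N N k s" and ks: "ks \<noteq> []"
  shows "good U ks (Suc N) 0 k (run \<phi> U body s)"
    and "mem (run \<phi> U body s) (dim + 1) p = mem s (dim + 1) p"
  using run_create_node[OF s ks] unfolding body_def run.simps(6) bval.simps(1) ival_reg_good(2,3)[OF s]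
  by simp_all

lemma straight_body: "straight body"
  unfolding body_def visit_node_def eval_node_def output_symbol_def create_node_def create_root_def
    create_child_def assign_val_def
  by (auto intro!: straight_pick_com straight_switch straight_assigns)

end

text \<open>Number of nodes created and node visited next, after \<open>t\<close> rounds. Every node is visited again
  after each creation, so no list of the nodes with newly known children is needed.\<close>

definition sched :: "nat \<Rightarrow> nat \<times> nat" where
  "sched t = ((\<lambda>(N, n). if n < N then (N, Suc n) else (Suc N, 0)) ^^ t) (0, 0)"

lemma sched_0 [simp]: "sched 0 = (0, 0)"
  by (simp add: sched_def)

lemma sched_Suc: "sched t = (N, n) \<Longrightarrow> sched (Suc t) = (if n < N then (N, Suc n) else (Suc N, 0))"
  by (simp add: sched_def)

lemma sched_le: "fst (sched t) \<le> t"
proof (induction t)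
  case (Suc t)
  then show ?case by (cases "sched t") (simp add: sched_Suc)
qed simp

lemma sched_row: "sched t = (N, 0) \<Longrightarrow> j \<le> N \<Longrightarrow> sched (t + j) = (N, j)"
  by (induction j) (simp_all add: sched_Suc)

lemma sched_row_start: "\<exists>t. sched t = (N, 0)"
proof (induction N)
  case 0
  show ?case by (intro exI[of _ 0]) simp
next
  case (Suc N)
  then obtain t where "sched t = (N, 0)" by blast
  then have "sched (Suc (t + N)) = (Suc N, 0)"
    using sched_row[of t N N] by (simp add: sched_Suc)
  then show ?case by blast
qed

text \<open>Fairness: every node is visited arbitrarily late and with arbitrarily many samples
  drawn. At most one node is created per round, so choosing a large number of nodes also makes the
  time large.\<close>

lemma sched_visit: "\<exists>t N. T \<le> t \<and> B \<le> N \<and> p < N \<and> sched t = (N, p)"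
proof -
  let ?N = "max T (max B (Suc p))"
  obtain t where t: "sched t = (?N, 0)" using sched_row_start by blast
  have "?N \<le> t" using sched_le[of t] t by simp
  moreover have "sched (t + p) = (?N, p)" by (rule sched_row[OF t]) simp
  ultimately show ?thesis by (intro exI[of _ "t + p"] exI[of _ ?N]) auto
qed

section \<open>Termination and correctness of the program\<close>

context sampler
begin

definition guard :: "('m, 's) bexp" where
  "guard = ILess (reg 3) (reg 0)"

definition program :: "('m, 's) com" where
  "program = Seq (set_reg 0 (IMem (IConst 0))) (While guard body)"

definition state :: "(nat \<Rightarrow> real) \<Rightarrow> (int ^ 'd) list \<Rightarrow> nat \<Rightarrow> store" where
  "state U ks t = (run \<phi> U body ^^ t) (run \<phi> U (set_reg 0 (IMem (IConst 0))) (init_store (sites_input cs ks)))"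

lemma good_start: "good U ks 0 0 0 (state U ks 0)"
proof -
  have "imem (init_store (sites_input cs ks)) 0 = int (length ks)"
    by (simp add: init_store_def sites_input_def)
  then have s: "state U ks 0 = put (dim + 2) 0 (int (length ks)) (init_store (sites_input cs ks))"
    by (simp only: state_def funpow_0 run_set_reg ival.simps)
  have "addr c p < 0" for c p
    unfolding addr_def by linarith
  then have "mem (init_store (sites_input cs ks)) c p = 0" for c p
    unfolding mem_def by (simp add: init_store_def not_le[symmetric] del: not_le)
  then have mem: "mem (state U ks 0) c p = (if c = dim + 2 \<and> p = 0 then int (length ks) else 0)"
    if "c < dim + 3" for c p
    using that unfolding s by (simp add: mem_put)
  show ?thesis
    unfolding good_def by (simp add: mem) (simp add: s init_store_def)
qed

lemma bval_guard: "good U ks N n k s \<Longrightarrow> bval \<phi> guard s \<longleftrightarrow> k < length ks"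
  unfolding guard_def bval.simps(1) by (simp only: ival_reg_good of_nat_less_iff)

lemma state_Suc: "state U ks (Suc t) = run \<phi> U body (state U ks t)"
  by (simp add: state_def)

text \<open>The node counters follow the deterministic schedule; only \<open>k\<close> depends on
  the samples. As long as the loop test holds, \<open>k < length ks\<close>, which
  \<open>run_body_visit\<close> requires.\<close>

lemma good_state:
  "(\<And>t'. t' < t \<Longrightarrow> bval \<phi> guard (state U ks t')) \<Longrightarrow>
    \<exists>k. good U ks (fst (sched t)) (snd (sched t)) k (state U ks t)"
proof (induction t)
  case 0
  show ?case using good_start by auto
next
  case (Suc t)
  obtain N n where sched: "sched t = (N, n)" by (cases "sched t")
  from Suc obtain k where s: "good U ks N n k (state U ks t)"
    unfolding sched by fastforce
  have k: "k < length ks"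
    using Suc.prems[of t] bval_guard[OF s] by simp
  then have ks: "ks \<noteq> []" by auto
  show ?case
  proof (cases "n < N")
    case True
    then show ?thesis
      using run_body_visit(1)[OF s True k] by (auto simp only: sched_Suc[OF sched] state_Suc fst_conv snd_conv if_True)
  next
    case False
    then have n: "n = N" using goodD(5)[OF s] by simp
    show ?thesis
      using run_body_create(1)[OF s[unfolded n] ks] False
      by (auto simp only: sched_Suc[OF sched] state_Suc fst_conv snd_conv if_False)
  qed
qed

text \<open>In a run without end, values are never erased, every determined node becomes known by
  induction on its depth, and the number \<open>K t\<close> of symbols output therefore passes each
  \<open>j \<le> length ks\<close> in turn, against the loop test.\<close>

lemma program_terminates:
  assumes det: "\<And>i. i < length ks \<Longrightarrow> \<exists>b. val_is U (ks ! i, 0) b"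
  shows "\<exists>t. \<not> bval \<phi> guard (state U ks t)"
proof (rule ccontr)
  assume "\<not> ?thesis"
  then have guard: "bval \<phi> guard (state U ks t)" for t by blast
  let ?s = "state U ks"
  define K where "K t = (SOME k. good U ks (fst (sched t)) (snd (sched t)) k (?s t))" for t
  have good: "good U ks (fst (sched t)) (snd (sched t)) (K t) (?s t)" for t
    unfolding K_def by (rule someI_ex[OF good_state]) (rule guard)
  have K: "K t < length ks" for t
    using guard[of t] bval_guard[OF good] by blast
  have ks: "ks \<noteq> []" using K[of 0] by auto
  have K_unique: "K t = k" if "good U ks N n k (?s t)" for t k N n
    using goodD(4)[OF good[of t]] goodD(4)[OF that] by simp
  have known_Suc: "mem (?s (Suc t)) (dim + 1) p \<noteq> 0" if "mem (?s t) (dim + 1) p \<noteq> 0" for t p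
  proof -
    obtain N n where sched: "sched t = (N, n)" by (cases "sched t")
    have s: "good U ks N n (K t) (?s t)" using good[of t] by (simp add: sched)
    show ?thesis
    proof (cases "n < N")
      case True
      show ?thesis
        unfolding state_Suc using run_body_visit(2)[OF s True K disjI2[OF that]] that by simp
    next
      case False
      then have "n = N" using goodD(5)[OF s] by simp
      then show ?thesis
        unfolding state_Suc using run_body_create(2)[OF s[unfolded \<open>n = N\<close>] ks] that by simp
    qed
  qed
  have known_mono: "mem (?s t') (dim + 1) p \<noteq> 0" if "mem (?s t) (dim + 1) p \<noteq> 0" "t \<le> t'" for t t' p
    using that(2)
  proof (induction t' rule: dec_induct)
    case base
    show ?case by (rule that(1))
  next
    case (step t')
    then show ?case by (intro known_Suc)
  qed
  have K_Suc: "K t \<le> K (Suc t)" for t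
  proof -
    obtain N n where sched: "sched t = (N, n)" by (cases "sched t")
    have s: "good U ks N n (K t) (?s t)" using good[of t] by (simp add: sched)
    show ?thesis
    proof (cases "n < N")
      case True
      have "K (Suc t) = (if mem (?s (Suc t)) (dim + 1) (K t) = 0 then K t else Suc (K t))"
        by (rule K_unique) (simp only: state_Suc, rule run_body_visit(1)[OF s True K])
      then show ?thesis by simp
    next
      case False
      then have n: "n = N" using goodD(5)[OF s] by simp
      have "K (Suc t) = K t"
        by (rule K_unique) (simp only: state_Suc, rule run_body_create(1)[OF s[unfolded n] ks])
      then show ?thesis by simp
    qed
  qed
  have K_mono: "K t \<le> K t'" if "t \<le> t'" for t t'
    using that by (induction t' rule: dec_induct) (auto intro: order.trans[OF _ K_Suc])
  have known: "\<exists>T. mem (?s T) (dim + 1) p \<noteq> 0"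
    if "kval nb \<phi> (\<lambda>v. U (vertex_index cs v)) \<tau> (node nb ks p) \<noteq> None" for \<tau> p
    using that
  proof (induction \<tau> arbitrary: p)
    case (Suc \<tau>)
    let ?v = "node nb ks p"
    \<comment> \<open>From some time on, a visit of \<open>p\<close> can fail only for want of its
      sample: if the children are required, they are finitely many, known by the induction
      hypothesis, and remain known.\<close>
    have "\<exists>T. \<forall>t\<ge>T. pick (known_part \<phi>) 0 (U (vertex_index cs ?v)) \<noteq> None
        \<or> (\<forall>i<CARD('m). mem (?s t) (dim + 1) (length ks + CARD('m) * p + i) \<noteq> 0)"
    proof (cases "pick (known_part \<phi>) 0 (U (vertex_index cs ?v)) = None")
      case True
      with Suc.prems have ch: "\<And>i. kval nb \<phi> (\<lambda>v. U (vertex_index cs v)) \<tau> (child nb ?v i) \<noteq> None"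
        by (auto split: if_splits)
      have "\<exists>T. mem (?s T) (dim + 1) (length ks + CARD('m) * p + i) \<noteq> 0" if "i < CARD('m)" for i
        by (rule Suc.IH) (unfold node_child[OF ks that], rule ch)
      then have "\<forall>i. \<exists>T. i < CARD('m) \<longrightarrow> mem (?s T) (dim + 1) (length ks + CARD('m) * p + i) \<noteq> 0"
        by blast
      then obtain T where T: "\<And>i. i < CARD('m) \<Longrightarrow> mem (?s (T i)) (dim + 1) (length ks + CARD('m) * p + i) \<noteq> 0"
        using choice[of "\<lambda>i T. i < CARD('m) \<longrightarrow> mem (?s T) (dim + 1) (length ks + CARD('m) * p + i) \<noteq> 0"]
        by blast
      have "mem (?s t) (dim + 1) (length ks + CARD('m) * p + i) \<noteq> 0"
        if "Max (T ` {..<CARD('m)}) \<le> t" "i < CARD('m)" for t i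
      proof (rule known_mono[OF T])
        have "T i \<le> Max (T ` {..<CARD('m)})" using that(2) by simp
        then show "T i \<le> t" using that(1) by (rule order.trans)
      qed (rule that(2))
      then show ?thesis by blast
    qed blast
    then obtain T where T: "\<And>t. T \<le> t \<Longrightarrow> pick (known_part \<phi>) 0 (U (vertex_index cs ?v)) \<noteq> None
        \<or> (\<forall>i<CARD('m). mem (?s t) (dim + 1) (length ks + CARD('m) * p + i) \<noteq> 0)"
      by blast
    obtain t N where t: "T \<le> t" "Suc (vertex_index cs ?v) \<le> N" "p < N" "sched t = (N, p)"
      using sched_visit by blast
    have s: "good U ks N p (K t) (?s t)" using good[of t] by (simp add: t(4))
    have "mem (?s (Suc t)) (dim + 1) p \<noteq> 0"
      unfolding state_Suc using t(2) by (intro run_body_visit(3)[OF s t(3) K _ T[OF t(1)]]) simp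
    then show ?case by blast
  qed simp
  have "\<exists>t. j \<le> K t" if "j \<le> length ks" for j
    using that
  proof (induction j)
    case (Suc j)
    then obtain t0 where t0: "j \<le> K t0" by auto
    from det[of j] Suc.prems obtain b where "val_is U (ks ! j, 0) b" by auto
    then obtain \<tau> where "kval nb \<phi> (\<lambda>v. U (vertex_index cs v)) \<tau> (node nb ks j) \<noteq> None"
      using Suc.prems by (auto simp: val_is_def node_root)
    from known[OF this] obtain T where T: "mem (?s T) (dim + 1) j \<noteq> 0" by blast
    \<comment> \<open>Node 0 is an arbitrary choice: every visiting round tries to output the next
      symbol, and root \<open>j\<close> is known by then.\<close>
    obtain t N where t: "max t0 T \<le> t" "0 \<le> N" "0 < N" "sched t = (N, 0)"
      using sched_visit by blast
    have s: "good U ks N 0 (K t) (?s t)" using good[of t] by (simp add: t(4))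
    have j: "j \<le> K t" using t0 K_mono[of t0 t] t(1) by simp
    have "K (Suc t) = (if mem (?s (Suc t)) (dim + 1) (K t) = 0 then K t else Suc (K t))"
      by (rule K_unique) (simp only: state_Suc, rule run_body_visit(1)[OF s t(3) K])
    moreover have "mem (?s (Suc t)) (dim + 1) j \<noteq> 0"
      by (rule known_mono[OF T]) (use t(1) in simp)
    ultimately have "Suc j \<le> K (Suc t)"
      using j K_Suc[of t] by (cases "j = K t") auto
    then show ?case by blast
  qed simp
  then obtain t where "length ks \<le> K t" by blast
  with K[of t] show False by simp
qed

lemma exec_program:
  "exec \<phi> U program (init_store (sites_input cs ks)) s \<longleftrightarrow>
    (\<exists>t. s = state U ks t \<and> \<not> bval \<phi> guard s \<and> (\<forall>t'<t. bval \<phi> guard (state U ks t')))"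
proof -
  have "exec \<phi> U program (init_store (sites_input cs ks)) s \<longleftrightarrow>
      exec \<phi> U (While guard body) (run \<phi> U (set_reg 0 (IMem (IConst 0))) (init_store (sites_input cs ks))) s"
    unfolding program_def using exec_straight[of "set_reg 0 (IMem (IConst 0))" \<phi> U]
    by (auto elim!: exec_SeqE intro: exec_Seq)
  then show ?thesis
    unfolding exec_While_straight[OF straight_body] state_def by simp
qed

text \<open>The equivalence holds for every sequence of samples: the invariant at exit makes each
  output correct, and termination with \<open>val_is_unique\<close> gives the converse. The exit
  time does not occur on the right, so it cannot bias the law, and the output event becomes visibly
  measurable.\<close>

lemma outputs_program:
  "outputs \<phi> U program enc cs ks w \<longleftrightarrow> (\<forall>i<length ks. val_is U (ks ! i, 0) (w (ks ! i)))"
proof -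
  have halt: "\<exists>b. imem (state U ks t) (int i) = enc b \<and> val_is U (ks ! i, 0) b"
    if "\<not> bval \<phi> guard (state U ks t)" "\<forall>t'<t. bval \<phi> guard (state U ks t')" "i < length ks" for t i
  proof -
    from good_state[of t U ks] that(2) obtain k
      where s: "good U ks (fst (sched t)) (snd (sched t)) k (state U ks t)" by blast
    have "i < k" using that(1,3) bval_guard[OF s] by simp
    then show ?thesis by (rule goodD(9)[OF s])
  qed
  show ?thesis
  proof
    assume "outputs \<phi> U program enc cs ks w"
    then obtain t where t: "\<not> bval \<phi> guard (state U ks t)" "\<forall>t'<t. bval \<phi> guard (state U ks t')"
      and out: "\<And>i. i < length ks \<Longrightarrow> imem (state U ks t) (int i) = enc (w (ks ! i))"
      unfolding outputs_def exec_program by blast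
    show "\<forall>i<length ks. val_is U (ks ! i, 0) (w (ks ! i))"
    proof (intro allI impI)
      fix i assume i: "i < length ks"
      obtain b where "imem (state U ks t) (int i) = enc b" "val_is U (ks ! i, 0) b"
        using halt[OF t i] by blast
      then show "val_is U (ks ! i, 0) (w (ks ! i))"
        using out[OF i] inj_enc by (simp add: inj_eq)
    qed
  next
    assume val: "\<forall>i<length ks. val_is U (ks ! i, 0) (w (ks ! i))"
    then have "\<exists>t. \<not> bval \<phi> guard (state U ks t)"
      by (intro program_terminates) blast
    then obtain t where t: "\<not> bval \<phi> guard (state U ks t)" "\<forall>t'<t. bval \<phi> guard (state U ks t')"
      using exists_least_iff[of "\<lambda>t. \<not> bval \<phi> guard (state U ks t)"] by blast
    have "imem (state U ks t) (int i) = enc (w (ks ! i))" if i: "i < length ks" for i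
    proof -
      obtain b where "imem (state U ks t) (int i) = enc b" "val_is U (ks ! i, 0) b"
        using halt[OF t i] by blast
      then show ?thesis using val i val_is_unique by blast
    qed
    with t show "outputs \<phi> U program enc cs ks w"
      unfolding outputs_def exec_program by blast
  qed
qed

end

section \<open>The law of the output\<close>

lemma distr_uniform_source:
  assumes "set cs = UNIV"
  shows "distr uniform_source site_source (\<lambda>U v. U (vertex_index cs v)) = site_source"
  using distr_PiM_map_reindex[OF prob_space_unif inj_vertex_index[OF assms], of "\<lambda>_ x. x" "\<lambda>_. unif"]
  by (simp add: site_source_def uniform_source_def distr_id2)

lemma measurable_uniform_source:
  "(\<lambda>U v. U (vertex_index cs v)) \<in> uniform_source \<rightarrow>\<^sub>M site_source"
  unfolding site_source_def uniform_source_def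
  by (intro measurable_PiM_single' measurable_component_singleton) auto

lemma admits_perfect_sampling_pca_limit:
  fixes nb :: "'m::finite \<Rightarrow> int ^ 'd::finite" and \<phi> :: "('m \<Rightarrow> 's::finite) \<Rightarrow> 's pmf"
  assumes "p_unknown \<phi> < p_crit nb"
  shows "admits_perfect_sampling \<phi> (pca_limit nb \<phi>)"
  unfolding admits_perfect_sampling_def
proof (intro allI impI)
  fix enc :: "'s \<Rightarrow> int" and cs :: "'d list"
  assume "inj enc" and "distinct cs" and cs: "set cs = UNIV"
  then interpret sampler nb \<phi> enc cs by unfold_locales
  interpret S: prob_space "site_source :: ((int ^ 'd) \<times> nat \<Rightarrow> real) measure"
    by (rule prob_space_site_source)
  let ?g = "\<lambda>U v. U (vertex_index cs v)"
  show "\<exists>c :: ('m, 's) com. \<forall>ks w. distinct ks \<longrightarrow>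
      {U \<in> space uniform_source. outputs \<phi> U c enc cs ks w} \<in> sets uniform_source \<and>
      measure uniform_source {U \<in> space uniform_source. outputs \<phi> U c enc cs ks w}
        = measure (pca_limit nb \<phi>) (cyl (set ks) w)"
  proof (rule exI[of _ program], intro allI impI)
    fix ks :: "(int ^ 'd) list" and w :: "('d, 's) config"
    \<comment> \<open>The output event in terms of the field. It differs from the limit event only
      on the null set of fields with an undetermined vertex.\<close>
    let ?W = "{V. \<forall>k\<in>set ks. \<exists>t. kval nb \<phi> V t (k, 0) = Some (w k)}"
    have "{V. kval nb \<phi> V t (k, 0) = Some (w k)} \<in> S.events" for t k
      by (rule sets_kval_Collect[where P = "\<lambda>x. x = Some (w k)"])
    then have "{V \<in> space site_source. \<forall>k\<in>set ks. \<exists>t. kval nb \<phi> V t (k, 0) = Some (w k)} \<in> S.events"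
      by (intro sets.sets_Collect_finite_All sets.sets_Collect_countable_Ex) simp_all
    then have W: "?W \<in> S.events" by simp
    have eq: "{U \<in> space uniform_source. outputs \<phi> U program enc cs ks w} = ?g -` ?W \<inter> space uniform_source"
      by (auto simp: outputs_program val_is_def all_set_conv_all_nth)
    have "S.prob ?W = S.prob (lim_event nb \<phi> (set ks) w)"
    proof (rule S.finite_measure_eq_AE)
      show "AE V in site_source. V \<in> ?W \<longleftrightarrow> V \<in> lim_event nb \<phi> (set ks) w"
        using AE_determined[OF assms]
      proof (rule AE_mp, intro AE_I2 impI)
        fix V assume det: "\<forall>v. \<exists>t. kval nb \<phi> V t v \<noteq> None"
        have "(\<exists>t. kval nb \<phi> V t (k, 0) = Some (w k)) \<longleftrightarrow> lim_val nb \<phi> V (k, 0) = w k" for k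
        proof -
          obtain t b where "kval nb \<phi> V t (k, 0) = Some b" using det by blast
          then show ?thesis using lim_val_eq by metis
        qed
        then show "V \<in> ?W \<longleftrightarrow> V \<in> lim_event nb \<phi> (set ks) w"
          by (simp add: lim_event_def)
      qed
    qed (simp_all add: W sets_lim_event)
    also have "\<dots> = measure (pca_limit nb \<phi>) (cyl (set ks) w)"
      by (simp add: measure_pca_limit_cyl)
    finally have "S.prob ?W = measure (pca_limit nb \<phi>) (cyl (set ks) w)" .
    moreover have "S.prob ?W = measure uniform_source (?g -` ?W \<inter> space uniform_source)"
      using measure_distr[OF measurable_uniform_source W, of cs] unfolding distr_uniform_source[OF cs] .
    moreover have "?g -` ?W \<inter> space uniform_source \<in> sets uniform_source"
      by (rule measurable_sets[OF measurable_uniform_source W])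
    ultimately show "{U \<in> space uniform_source. outputs \<phi> U program enc cs ks w} \<in> sets uniform_source \<and>
        measure uniform_source {U \<in> space uniform_source. outputs \<phi> U program enc cs ks w}
          = measure (pca_limit nb \<phi>) (cyl (set ks) w)"
      unfolding eq by simp
  qed
qed

theorem theorem3p5:
  fixes nb :: "'m::finite \<Rightarrow> int ^ 'd::finite"
    and \<phi> :: "('m \<Rightarrow> 's::finite) \<Rightarrow> 's pmf"
  assumes "p_unknown \<phi> < p_crit nb"
  shows "uniformly_ergodic (pca nb \<phi>) \<and>
    (\<forall>\<pi>. invariant_measure (pca nb \<phi>) \<pi> \<longrightarrow>
      spatially_mixing \<pi> \<and> admits_perfect_sampling \<phi> \<pi>)"
  using uniformly_ergodic_pca[OF assms] spatially_mixing_pca_limit[OF assms]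
    admits_perfect_sampling_pca_limit[OF assms] invariant_measure_unique[OF assms]
  by blast

end
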